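(* For each $n$, let $z\in\{\pm1\}^n$, $p\in[0,1]$, $\delta\in(0,1]$, and let $r\ge 4$ be an integer ($z$, $p$, $\delta$ and $r$ can depend on $n$). Let $G=(V,E)$, $V=\{1,\dots,n\}$, be an Erdős–Rényi random graph $G\sim\mathcal{G}(n,p)$, and suppose that we observe, for the pairs $(i,j)\in E$, the random measurements $$R_{ij} = R_{ji} = \begin{cases} z_i z_j & \text{with probability } \frac{1+\delta}{2},\\ -z_i z_j & \text{with probability } \frac{1-\delta}{2},\end{cases}$$ independently across edges. Let $C\in\mathbf{R}^{n\times n}$ be the cost matrix with $C_{ij}=R_{ij}$ if $(i,j)\in E$ and $C_{ij}=0$ otherwise. Suppose that, for some $0<\epsilon\leq 1/3$ independent of $n$, $$\frac{np}{\log n}\left(1 - \sqrt{1 - \left(\frac{r-3}{r-1}-\epsilon\right)^2\delta^2}\right)\geq 1.$$ Then, with probability $\to 1$ as $n\to\infty$, every second-order critical point $Y\in\mathbf{R}^{n\times r}$ of the problem $$\max_{Y \in \mathbf{R}^{n\times r}}~\langle C, YY^\top\rangle \quad \text{s.t. } \mathrm{ddiag}(YY^\top) = I_n$$ satisfies $Y = zu^\top$ for some unit-norm $u\in\mathbf{R}^r$. A more restrictive condition for which the same result holds is that, for some $\epsilon>0$ independent of $n$, $$\frac{1}{\delta}\leq\frac{r-3}{r-1}\sqrt{\frac{np}{(2+\epsilon)\log n}}.$$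
   Context: In $\mathcal{G}(n,p)$ each possible undirected edge $(i,j)$, $i\ne j$, is present with probability $p$ independently of the others. $\langle A,B\rangle = \mathrm{trace}(A^\top B)$ is the Frobenius inner product; $\mathrm{ddiag}\colon \mathbf{R}^{n\times n}\to\mathbf{R}^{n\times n}$ keeps the diagonal of a matrix and sets the off-diagonal entries to zero. The constraint $\mathrm{ddiag}(YY^\top)=I_n$ says that every row of $Y$ is a unit vector in $\mathbf{R}^r$, so the feasible set is a Riemannian manifold (a product of $n$ unit spheres embedded in $\mathbf{R}^r$). A second-order critical point is a feasible $Y$ at which the Riemannian gradient of the objective is zero and the Riemannian Hessian is negative semidefinite. Explicitly, for symmetric $C$, put $S(Y) = \mathrm{ddiag}(CYY^\top) - C$; a feasible $Y$ is second-order critical if and only if (i) $S(Y)Y = 0$, and (ii) $\langle S(Y), \dot Y \dot Y^\top\rangle \ge 0$ for every $\dot Y\in\mathbf{R}^{n\times r}$ such that $\mathrm{ddiag}(Y\dot Y^\top)=0$. *)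

theory Defs
  imports "HOL-Probability.Probability" "Jordan_Normal_Form.Matrix"
begin

unbundle no inner_syntax and no vec_syntax

section \<open>Matrices\<close>

definition mat_trace :: "real mat \<Rightarrow> real" where
  "mat_trace A = (\<Sum>i<dim_row A. A $$ (i, i))"

definition frob_inner :: "real mat \<Rightarrow> real mat \<Rightarrow> real" where
  "frob_inner A B = mat_trace (A\<^sup>T * B)"

definition ddiag :: "real mat \<Rightarrow> real mat" where
  "ddiag A = mat (dim_row A) (dim_col A) (\<lambda>(i, j). if i = j then A $$ (i, j) else 0)"

text \<open>The rank-one matrix \<open>z u\<^sup>T\<close>; \<open>mat_of_row\<close> turns a vector into a matrix with one row.\<close>

definition outer_prod :: "real vec \<Rightarrow> real vec \<Rightarrow> real mat" where
  "outer_prod z u = (mat_of_row z)\<^sup>T * mat_of_row u"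

definition vec_norm2 :: "real vec \<Rightarrow> real" where
  "vec_norm2 u = sqrt (u \<bullet> u)"


section \<open>Optimization over matrices with unit rows\<close>

definition feasible_set :: "nat \<Rightarrow> nat \<Rightarrow> real mat set" where
  "feasible_set n r = {Y \<in> carrier_mat n r. ddiag (Y * Y\<^sup>T) = 1\<^sub>m n}"

definition tangent_space :: "real mat \<Rightarrow> real mat set" where
  "tangent_space Y =
     {V \<in> carrier_mat (dim_row Y) (dim_col Y). ddiag (Y * V\<^sup>T) = 0\<^sub>m (dim_row Y) (dim_row Y)}"

text \<open>At a feasible \<open>Y\<close> this is the orthogonal projection onto the tangent space (see
  \<open>tangent_proj_in\<close> and \<open>tangent_proj_orthogonal\<close> below). The formula also makes sense for
  infeasible \<open>Y\<close>, which provides the smooth extension used for the Hessian.\<close>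

definition tangent_proj :: "real mat \<Rightarrow> real mat \<Rightarrow> real mat" where
  "tangent_proj Y Z = Z - ddiag (Z * Y\<^sup>T) * Y"

definition euclidean_grad :: "(real mat \<Rightarrow> real) \<Rightarrow> real mat \<Rightarrow> real mat" where
  "euclidean_grad f Y = mat (dim_row Y) (dim_col Y) (\<lambda>(i, j).
     deriv (\<lambda>t. f (Y + t \<cdot>\<^sub>m mat (dim_row Y) (dim_col Y) (\<lambda>kl. if kl = (i, j) then 1 else 0))) 0)"

definition riemannian_grad :: "(real mat \<Rightarrow> real) \<Rightarrow> real mat \<Rightarrow> real mat" where
  "riemannian_grad f Y = tangent_proj Y (euclidean_grad f Y)"

definition mat_dir_deriv :: "(real mat \<Rightarrow> real mat) \<Rightarrow> real mat \<Rightarrow> real mat \<Rightarrow> real mat" where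
  "mat_dir_deriv F Y V =
     mat (dim_row Y) (dim_col Y) (\<lambda>ij. deriv (\<lambda>t. F (Y + t \<cdot>\<^sub>m V) $$ ij) 0)"

text \<open>On a Riemannian submanifold of a Euclidean space, the Riemannian connection is the
  projection of the ordinary derivative of a (smoothly extended) tangent vector field; the
  Hessian at \<open>Y\<close> along a tangent \<open>V\<close> is that derivative of the gradient field.\<close>

definition riemannian_hess :: "(real mat \<Rightarrow> real) \<Rightarrow> real mat \<Rightarrow> real mat \<Rightarrow> real mat" where
  "riemannian_hess f Y V = tangent_proj Y (mat_dir_deriv (riemannian_grad f) Y V)"

text \<open>Second-order critical points of the maximization of \<open>f\<close> over \<open>feasible_set n r\<close>.\<close>

definition second_order_critical :: "nat \<Rightarrow> nat \<Rightarrow> (real mat \<Rightarrow> real) \<Rightarrow> real mat \<Rightarrow> bool" where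
  "second_order_critical n r f Y \<longleftrightarrow>
     Y \<in> feasible_set n r \<and>
     riemannian_grad f Y = 0\<^sub>m n r \<and>
     (\<forall>V\<in>tangent_space Y. frob_inner V (riemannian_hess f Y V) \<le> 0)"

definition objective :: "real mat \<Rightarrow> real mat \<Rightarrow> real" where
  "objective C Y = frob_inner C (Y * Y\<^sup>T)"


section \<open>Random measurements\<close>

text \<open>Vertices are \<open>0, \<dots>, n - 1\<close>; an undirected edge is represented by its increasing pair.\<close>

definition vertex_pairs :: "nat \<Rightarrow> (nat \<times> nat) set" where
  "vertex_pairs n = {(i, j). i < j \<and> j < n}"

definition erdos_renyi :: "nat \<Rightarrow> real \<Rightarrow> (nat \<times> nat) set pmf" where
  "erdos_renyi n p =
     map_pmf (\<lambda>b. {e \<in> vertex_pairs n. b e})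
       (Pi_pmf (vertex_pairs n) False (\<lambda>_. bernoulli_pmf p))"

definition measurement :: "real vec \<Rightarrow> real \<Rightarrow> nat \<times> nat \<Rightarrow> real pmf" where
  "measurement z \<delta> = (\<lambda>(i, j).
     map_pmf (\<lambda>b. if b then z $ i * z $ j else - (z $ i * z $ j)) (bernoulli_pmf ((1 + \<delta>) / 2)))"

definition cost_matrix :: "nat \<Rightarrow> (nat \<times> nat) set \<Rightarrow> (nat \<times> nat \<Rightarrow> real) \<Rightarrow> real mat" where
  "cost_matrix n E R = mat n n (\<lambda>(i, j).
     if (i, j) \<in> E then R (i, j) else if (j, i) \<in> E then R (j, i) else 0)"

definition cost_pmf :: "nat \<Rightarrow> real vec \<Rightarrow> real \<Rightarrow> real \<Rightarrow> real mat pmf" where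
  "cost_pmf n z p \<delta> = do {
     E \<leftarrow> erdos_renyi n p;
     R \<leftarrow> Pi_pmf E 0 (measurement z \<delta>);
     return_pmf (cost_matrix n E R)
   }"

definition exact_recovery :: "nat \<Rightarrow> nat \<Rightarrow> real vec \<Rightarrow> real mat \<Rightarrow> bool" where
  "exact_recovery n r z C \<longleftrightarrow>
     (\<forall>Y. second_order_critical n r (objective C) Y \<longrightarrow>
        (\<exists>u\<in>carrier_vec r. vec_norm2 u = 1 \<and> Y = outer_prod z u))"

definition recovery_prob :: "nat \<Rightarrow> real vec \<Rightarrow> real \<Rightarrow> real \<Rightarrow> nat \<Rightarrow> real" where
  "recovery_prob n z p \<delta> r = measure_pmf.prob (cost_pmf n z p \<delta>) {C. exact_recovery n r z C}"

lemma cost_pmf_symmetric: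
  assumes "C \<in> set_pmf (cost_pmf n z p \<delta>)"
  shows "C \<in> carrier_mat n n" and "C\<^sup>T = C"
proof -
  obtain E R where E: "E \<subseteq> vertex_pairs n" and C: "C = cost_matrix n E R"
  proof -
    from assms obtain b R where "C = cost_matrix n {e \<in> vertex_pairs n. b e} R"
      by (auto simp: cost_pmf_def erdos_renyi_def)
    then show thesis by (intro that[of "{e \<in> vertex_pairs n. b e}" R]) auto
  qed
  show "C \<in> carrier_mat n n" by (simp add: C cost_matrix_def)
  show "C\<^sup>T = C"
  proof (intro eq_matI)
    fix i j assume "i < dim_row C" "j < dim_col C"
    moreover have "\<not> ((i, j) \<in> E \<and> (j, i) \<in> E)"
      using subsetD[OF E, of "(i, j)"] subsetD[OF E, of "(j, i)"] by (auto simp: vertex_pairs_def)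
    ultimately show "C\<^sup>T $$ (i, j) = C $$ (i, j)" by (auto simp: C cost_matrix_def)
  qed (simp_all add: C cost_matrix_def)
qed


section \<open>Explicit form of second-order criticality\<close>

definition dual_cert :: "real mat \<Rightarrow> real mat \<Rightarrow> real mat" where
  "dual_cert C Y = ddiag (C * Y * Y\<^sup>T) - C"

lemma index_mult_sum:
  assumes "A \<in> carrier_mat n m" "B \<in> carrier_mat m k" "i < n" "j < k"
  shows "(A * B) $$ (i, j) = (\<Sum>l<m. A $$ (i, l) * B $$ (l, j))"
  using assms by (auto simp: scalar_prod_def atLeast0LessThan intro!: sum.cong)

lemma frob_inner_sum:
  assumes "A \<in> carrier_mat n m" "B \<in> carrier_mat n m"
  shows "frob_inner A B = (\<Sum>i<n. \<Sum>j<m. A $$ (i, j) * B $$ (i, j))"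
proof -
  have "frob_inner A B = (\<Sum>j<m. \<Sum>i<n. A $$ (i, j) * B $$ (i, j))"
    unfolding frob_inner_def mat_trace_def using assms
    by (auto simp: scalar_prod_def atLeast0LessThan intro!: sum.cong)
  then show ?thesis by (simp add: sum.swap[of _ "{..<m}"])
qed

lemma ddiag_mult_index:
  assumes "Z \<in> carrier_mat n r" "Y \<in> carrier_mat n r" "i < n" "j < r"
  shows "(ddiag (Z * Y\<^sup>T) * Y) $$ (i, j) = (\<Sum>k<r. Z $$ (i, k) * Y $$ (i, k)) * Y $$ (i, j)"
proof -
  have c: "ddiag (Z * Y\<^sup>T) \<in> carrier_mat n n"
    using assms by (auto simp: ddiag_def)
  have d: "ddiag (Z * Y\<^sup>T) $$ (i, l) =
      (if l = i then (\<Sum>k<r. Z $$ (i, k) * Y $$ (i, k)) else 0)" if "l < n" for l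
    using assms that
    by (auto simp: ddiag_def scalar_prod_def atLeast0LessThan intro!: sum.cong)
  show ?thesis
    unfolding index_mult_sum[OF c assms(2-4)]
    by (subst sum.cong[OF refl, of _ _ "\<lambda>l. if l = i then (\<Sum>k<r. Z $$ (i, k) * Y $$ (i, k)) * Y $$ (i, j) else 0"])
       (use assms d in auto)
qed

lemma ddiag_carrier: "A \<in> carrier_mat n n \<Longrightarrow> ddiag A \<in> carrier_mat n n"
  by (auto simp: ddiag_def)

lemma tangent_proj_carrier:
  assumes "Z \<in> carrier_mat n r" "Y \<in> carrier_mat n r"
  shows "tangent_proj Y Z \<in> carrier_mat n r"
  using assms by (auto simp: tangent_proj_def ddiag_def)

lemma tangent_proj_index:
  assumes "Z \<in> carrier_mat n r" "Y \<in> carrier_mat n r" "i < n" "j < r"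
  shows "tangent_proj Y Z $$ (i, j) =
    Z $$ (i, j) - (\<Sum>k<r. Z $$ (i, k) * Y $$ (i, k)) * Y $$ (i, j)"
proof -
  have "dim_row (ddiag (Z * Y\<^sup>T)) = n" using assms by (auto simp: ddiag_def)
  then show ?thesis
    unfolding tangent_proj_def using assms ddiag_mult_index[OF assms]
    by (subst index_minus_mat) auto
qed

lemma tangent_space_iff:
  assumes "Y \<in> carrier_mat n r"
  shows "V \<in> tangent_space Y \<longleftrightarrow>
    V \<in> carrier_mat n r \<and> (\<forall>i<n. (\<Sum>k<r. Y $$ (i, k) * V $$ (i, k)) = 0)"
proof -
  have "ddiag (Y * V\<^sup>T) = 0\<^sub>m n n \<longleftrightarrow> (\<forall>i<n. (\<Sum>k<r. Y $$ (i, k) * V $$ (i, k)) = 0)"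
    if V: "V \<in> carrier_mat n r"
  proof -
    have e: "ddiag (Y * V\<^sup>T) $$ (i, j) =
        (if i = j then (\<Sum>k<r. Y $$ (i, k) * V $$ (i, k)) else 0)" if "i < n" "j < n" for i j
      using assms V that
      by (auto simp: ddiag_def scalar_prod_def atLeast0LessThan intro!: sum.cong)
    have "dim_row (ddiag (Y * V\<^sup>T)) = n" "dim_col (ddiag (Y * V\<^sup>T)) = n"
      using assms V by (auto simp: ddiag_def)
    then show ?thesis by (auto simp: mat_eq_iff e)
  qed
  then show ?thesis using assms by (auto simp: tangent_space_def)
qed

lemma feasible_set_iff:
  "Y \<in> feasible_set n r \<longleftrightarrow> Y \<in> carrier_mat n r \<and> (\<forall>i<n. (\<Sum>k<r. (Y $$ (i, k))\<^sup>2) = 1)"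
proof -
  have "ddiag (Y * Y\<^sup>T) = 1\<^sub>m n \<longleftrightarrow> (\<forall>i<n. (\<Sum>k<r. (Y $$ (i, k))\<^sup>2) = 1)"
    if Y: "Y \<in> carrier_mat n r"
  proof -
    have e: "ddiag (Y * Y\<^sup>T) $$ (i, j) = (if i = j then (\<Sum>k<r. (Y $$ (i, k))\<^sup>2) else 0)"
      if "i < n" "j < n" for i j
      using Y that
      by (auto simp: ddiag_def scalar_prod_def atLeast0LessThan power2_eq_square intro!: sum.cong)
    have "dim_row (ddiag (Y * Y\<^sup>T)) = n" "dim_col (ddiag (Y * Y\<^sup>T)) = n"
      using Y by (auto simp: ddiag_def)
    then show ?thesis by (auto simp: mat_eq_iff e)
  qed
  then show ?thesis by (auto simp: feasible_set_def)
qed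

lemma tangent_proj_in:
  assumes Y: "Y \<in> feasible_set n r" and Z: "Z \<in> carrier_mat n r"
  shows "tangent_proj Y Z \<in> tangent_space Y"
proof -
  have Yc: "Y \<in> carrier_mat n r" and unit: "\<And>i. i < n \<Longrightarrow> (\<Sum>k<r. (Y $$ (i, k))\<^sup>2) = 1"
    using Y by (auto simp: feasible_set_iff)
  have "(\<Sum>k<r. Y $$ (i, k) * tangent_proj Y Z $$ (i, k)) = 0" if i: "i < n" for i
  proof -
    let ?s = "\<Sum>k<r. Z $$ (i, k) * Y $$ (i, k)"
    have "(\<Sum>k<r. Y $$ (i, k) * tangent_proj Y Z $$ (i, k)) =
        (\<Sum>k<r. Z $$ (i, k) * Y $$ (i, k) - ?s * (Y $$ (i, k))\<^sup>2)"
      by (intro sum.cong)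
         (auto simp: tangent_proj_index[OF Z Yc i] power2_eq_square algebra_simps)
    also have "\<dots> = ?s - ?s * (\<Sum>k<r. (Y $$ (i, k))\<^sup>2)"
      by (simp add: sum_subtractf sum_distrib_left)
    finally show ?thesis using unit[OF i] by simp
  qed
  then show ?thesis using tangent_proj_carrier[OF Z Yc] by (auto simp: tangent_space_iff[OF Yc])
qed

lemma frob_inner_tangent_proj:
  assumes Yc: "Y \<in> carrier_mat n r" and Z: "Z \<in> carrier_mat n r" and V: "V \<in> tangent_space Y"
  shows "frob_inner V (tangent_proj Y Z) = frob_inner V Z"
proof -
  have Vc: "V \<in> carrier_mat n r" and t: "\<And>i. i < n \<Longrightarrow> (\<Sum>k<r. Y $$ (i, k) * V $$ (i, k)) = 0"
    using V by (auto simp: tangent_space_iff[OF Yc])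
  have "(\<Sum>j<r. V $$ (i, j) * tangent_proj Y Z $$ (i, j)) = (\<Sum>j<r. V $$ (i, j) * Z $$ (i, j))"
    if i: "i < n" for i
  proof -
    let ?s = "\<Sum>k<r. Z $$ (i, k) * Y $$ (i, k)"
    have "(\<Sum>j<r. V $$ (i, j) * tangent_proj Y Z $$ (i, j)) =
        (\<Sum>j<r. V $$ (i, j) * Z $$ (i, j) - ?s * (Y $$ (i, j) * V $$ (i, j)))"
      by (intro sum.cong) (auto simp: tangent_proj_index[OF Z Yc i] algebra_simps)
    also have "\<dots> = (\<Sum>j<r. V $$ (i, j) * Z $$ (i, j)) - ?s * (\<Sum>j<r. Y $$ (i, j) * V $$ (i, j))"
      by (simp add: sum_subtractf sum_distrib_left)
    finally show ?thesis using t[OF i] by simp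
  qed
  then show ?thesis
    by (simp add: frob_inner_sum[OF Vc tangent_proj_carrier[OF Z Yc]] frob_inner_sum[OF Vc Z])
qed

lemma tangent_proj_orthogonal:
  assumes Y: "Y \<in> feasible_set n r" and Z: "Z \<in> carrier_mat n r" and V: "V \<in> tangent_space Y"
  shows "frob_inner V (Z - tangent_proj Y Z) = 0"
proof -
  have Yc: "Y \<in> carrier_mat n r" using Y by (simp add: feasible_set_def)
  have Vc: "V \<in> carrier_mat n r" using V by (simp add: tangent_space_iff[OF Yc])
  have P: "tangent_proj Y Z \<in> carrier_mat n r" by (rule tangent_proj_carrier[OF Z Yc])
  have "frob_inner V (Z - tangent_proj Y Z) = frob_inner V Z - frob_inner V (tangent_proj Y Z)"
    using Z P by (simp add: frob_inner_sum[OF Vc] minus_carrier_mat right_diff_distrib sum_subtractf)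
  then show ?thesis using frob_inner_tangent_proj[OF Yc Z V] by simp
qed

lemma objective_sum:
  assumes C: "C \<in> carrier_mat n n" and Y: "Y \<in> carrier_mat n r"
  shows "objective C Y = (\<Sum>i<n. \<Sum>k<n. \<Sum>j<r. C $$ (i, k) * (Y $$ (i, j) * Y $$ (k, j)))"
proof -
  have c: "Y * Y\<^sup>T \<in> carrier_mat n n" using Y by auto
  have "(Y * Y\<^sup>T) $$ (i, k) = (\<Sum>j<r. Y $$ (i, j) * Y $$ (k, j))" if "i < n" "k < n" for i k
    using Y that by (auto simp: scalar_prod_def atLeast0LessThan intro!: sum.cong)
  then show ?thesis
    unfolding objective_def frob_inner_sum[OF C c]
    by (auto simp: sum_distrib_left intro!: sum.cong)
qed

lemma objective_line:
  assumes C: "C \<in> carrier_mat n n" and sym: "C\<^sup>T = C"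
    and Y: "Y \<in> carrier_mat n r" and V: "V \<in> carrier_mat n r"
  shows "objective C (Y + t \<cdot>\<^sub>m V) =
    objective C Y + t * (2 * frob_inner V (C * Y)) + t\<^sup>2 * objective C V"
proof -
  have s: "C $$ (i, k) = C $$ (k, i)" if "i < n" "k < n" for i k
  proof -
    have "C\<^sup>T $$ (i, k) = C $$ (k, i)" using that C by simp
    then show ?thesis using sym by simp
  qed
  let ?B = "\<lambda>A B. \<Sum>i<n. \<Sum>k<n. \<Sum>j<r. C $$ (i, k) * (A $$ (i, j) * B $$ (k, j))"
  have swap: "?B A B = ?B B A" for A B :: "real mat"
    by (subst sum.swap) (auto intro!: sum.cong simp: s mult.commute)
  have fr: "frob_inner V (C * Y) = ?B V Y"
  proof -
    have "frob_inner V (C * Y) = (\<Sum>i<n. \<Sum>j<r. \<Sum>k<n. C $$ (i, k) * (V $$ (i, j) * Y $$ (k, j)))"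
      using C Y by (subst frob_inner_sum[OF V])
        (auto intro!: sum.cong simp del: index_mult_mat simp: index_mult_sum[OF C Y] sum_distrib_left algebra_simps)
    also have "\<dots> = ?B V Y" by (intro sum.cong refl sum.swap)
    finally show ?thesis .
  qed
  have W: "Y + t \<cdot>\<^sub>m V \<in> carrier_mat n r" using Y V by auto
  have "objective C (Y + t \<cdot>\<^sub>m V) = (\<Sum>i<n. \<Sum>k<n. \<Sum>j<r.
      C $$ (i, k) * (Y $$ (i, j) * Y $$ (k, j)) + t * (C $$ (i, k) * (Y $$ (i, j) * V $$ (k, j))) +
      t * (C $$ (i, k) * (V $$ (i, j) * Y $$ (k, j))) + t\<^sup>2 * (C $$ (i, k) * (V $$ (i, j) * V $$ (k, j))))"
    unfolding objective_sum[OF C W] using Y V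
    by (auto intro!: sum.cong simp: algebra_simps power2_eq_square)
  also have "\<dots> = ?B Y Y + t * ?B Y V + t * ?B V Y + t\<^sup>2 * ?B V V"
    by (simp add: sum.distrib sum_distrib_left)
  finally show ?thesis
    by (simp add: objective_sum[OF C Y] objective_sum[OF C V] fr swap[of Y V])
qed

lemma euclidean_grad_objective:
  assumes C: "C \<in> carrier_mat n n" and sym: "C\<^sup>T = C" and Y: "Y \<in> carrier_mat n r"
  shows "euclidean_grad (objective C) Y = 2 \<cdot>\<^sub>m (C * Y)"
proof (rule eq_matI)
  fix i j assume "i < dim_row (2 \<cdot>\<^sub>m (C * Y))" "j < dim_col (2 \<cdot>\<^sub>m (C * Y))"
  then have ij: "i < n" "j < r" using C Y by auto
  let ?E = "mat n r (\<lambda>kl. if kl = (i, j) then 1 else 0) :: real mat"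
  have E: "?E \<in> carrier_mat n r" by simp
  have CY: "C * Y \<in> carrier_mat n r" using C Y by auto
  have fE: "frob_inner ?E (C * Y) = (C * Y) $$ (i, j)"
  proof -
    have "frob_inner ?E (C * Y) =
        (\<Sum>k<n. \<Sum>l<r. if k = i then if l = j then (C * Y) $$ (i, j) else 0 else 0)"
      unfolding frob_inner_sum[OF E CY] by (intro sum.cong refl) auto
    also have "\<dots> = (\<Sum>k<n. if k = i then (C * Y) $$ (i, j) else 0)"
      using ij by (intro sum.cong refl) auto
    finally show ?thesis using ij by simp
  qed
  have "((\<lambda>t. objective C (Y + t \<cdot>\<^sub>m ?E)) has_field_derivative 2 * frob_inner ?E (C * Y)) (at 0)"
    unfolding objective_line[OF C sym Y E] by (auto intro!: derivative_eq_intros)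
  then show "euclidean_grad (objective C) Y $$ (i, j) = (2 \<cdot>\<^sub>m (C * Y)) $$ (i, j)"
    using ij Y C unfolding euclidean_grad_def fE by (auto dest!: DERIV_imp_deriv)
qed (use C Y in \<open>auto simp: euclidean_grad_def\<close>)

lemma riemannian_grad_objective_index:
  assumes C: "C \<in> carrier_mat n n" and sym: "C\<^sup>T = C" and Y: "Y \<in> carrier_mat n r"
    and ij: "i < n" "j < r"
  shows "riemannian_grad (objective C) Y $$ (i, j) =
    2 * ((C * Y) $$ (i, j) - (\<Sum>k<r. (C * Y) $$ (i, k) * Y $$ (i, k)) * Y $$ (i, j))"
proof -
  have CY: "C * Y \<in> carrier_mat n r" using C Y by auto
  have c: "2 \<cdot>\<^sub>m (C * Y) \<in> carrier_mat n r" using CY by auto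
  have e: "(2 \<cdot>\<^sub>m (C * Y)) $$ (i, k) = 2 * (C * Y) $$ (i, k)" if "k < r" for k
    using that ij CY by (subst index_smult_mat) auto
  have "(\<Sum>k<r. (2 \<cdot>\<^sub>m (C * Y)) $$ (i, k) * Y $$ (i, k)) =
      2 * (\<Sum>k<r. (C * Y) $$ (i, k) * Y $$ (i, k))"
    by (simp only: sum_distrib_left, intro sum.cong refl) (auto simp: e simp del: index_smult_mat index_mult_mat)
  then show ?thesis
    unfolding riemannian_grad_def euclidean_grad_objective[OF C sym Y] tangent_proj_index[OF c Y ij]
    by (simp add: e[OF ij(2)] algebra_simps del: index_smult_mat index_mult_mat)
qed

lemma riemannian_grad_objective:
  assumes C: "C \<in> carrier_mat n n" and sym: "C\<^sup>T = C" and Y: "Y \<in> carrier_mat n r"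
  shows "riemannian_grad (objective C) Y = 0\<^sub>m n r \<longleftrightarrow> dual_cert C Y * Y = 0\<^sub>m n r"
proof -
  have CY: "C * Y \<in> carrier_mat n r" using C Y by auto
  have D: "ddiag (C * Y * Y\<^sup>T) \<in> carrier_mat n n" using CY Y by (intro ddiag_carrier) auto
  have S: "dual_cert C Y * Y = ddiag (C * Y * Y\<^sup>T) * Y - C * Y"
    unfolding dual_cert_def by (rule minus_mult_distrib_mat[OF D C Y])
  have DY: "ddiag (C * Y * Y\<^sup>T) * Y \<in> carrier_mat n r" using D Y by auto
  have i1: "(dual_cert C Y * Y) $$ (i, j) =
      (\<Sum>k<r. (C * Y) $$ (i, k) * Y $$ (i, k)) * Y $$ (i, j) - (C * Y) $$ (i, j)"
    if "i < n" "j < r" for i j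
    unfolding S using that CY DY ddiag_mult_index[OF CY Y that]
    by (subst index_minus_mat) auto
  have c1: "riemannian_grad (objective C) Y \<in> carrier_mat n r"
    unfolding riemannian_grad_def euclidean_grad_objective[OF C sym Y]
    using CY Y by (intro tangent_proj_carrier) auto
  have c2: "dual_cert C Y * Y \<in> carrier_mat n r"
    unfolding S using CY DY by (intro minus_carrier_mat) auto
  have "riemannian_grad (objective C) Y = 0\<^sub>m n r \<longleftrightarrow>
      (\<forall>i<n. \<forall>j<r. riemannian_grad (objective C) Y $$ (i, j) = 0)"
    using c1 by (auto simp: mat_eq_iff)
  also have "\<dots> \<longleftrightarrow> (\<forall>i<n. \<forall>j<r. (dual_cert C Y * Y) $$ (i, j) = 0)"
    by (intro all_cong arg_cong[where f = "\<lambda>x. _ \<longrightarrow> x"])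
       (auto simp: i1 riemannian_grad_objective_index[OF C sym Y] simp del: index_mult_mat)
  also have "\<dots> \<longleftrightarrow> dual_cert C Y * Y = 0\<^sub>m n r"
    using c2 by (auto simp: mat_eq_iff simp del: index_mult_mat(1))
  finally show ?thesis .
qed

lemma riemannian_hess_objective:
  assumes C: "C \<in> carrier_mat n n" and sym: "C\<^sup>T = C" and Y: "Y \<in> carrier_mat n r"
    and V: "V \<in> tangent_space Y"
  shows "frob_inner V (riemannian_hess (objective C) Y V) =
    - 2 * frob_inner (dual_cert C Y) (V * V\<^sup>T)"
proof -
  have Vc: "V \<in> carrier_mat n r" and t: "\<And>i. i < n \<Longrightarrow> (\<Sum>k<r. Y $$ (i, k) * V $$ (i, k)) = 0"
    using V by (auto simp: tangent_space_iff[OF Y])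
  have CY: "C * Y \<in> carrier_mat n r" and CV: "C * V \<in> carrier_mat n r" using C Y Vc by auto
  define d where "d i = (\<Sum>k<r. (C * Y) $$ (i, k) * Y $$ (i, k))" for i
  define d' where "d' i = (\<Sum>k<r. (C * V) $$ (i, k) * Y $$ (i, k) + (C * Y) $$ (i, k) * V $$ (i, k))" for i
  define M where "M = mat_dir_deriv (riemannian_grad (objective C)) Y V"
  have Mc: "M \<in> carrier_mat n r" using Y by (simp add: M_def mat_dir_deriv_def)
  have Mi: "M $$ (i, j) = 2 * ((C * V) $$ (i, j) - d i * V $$ (i, j) - d' i * Y $$ (i, j))"
    if ij: "i < n" "j < r" for i j
  proof -
    have W: "Y + t \<cdot>\<^sub>m V \<in> carrier_mat n r" for t using Y Vc by auto
    have CW: "(C * (Y + t \<cdot>\<^sub>m V)) $$ (i, k) = (C * Y) $$ (i, k) + t * (C * V) $$ (i, k)"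
      if "k < r" for t k
      using that ij Y Vc
      by (simp del: index_mult_mat(1) add: index_mult_sum[OF C W] index_mult_sum[OF C Y] index_mult_sum[OF C Vc]
            sum_distrib_left sum.distrib[symmetric] algebra_simps)
    have WI: "(Y + t \<cdot>\<^sub>m V) $$ (i, k) = Y $$ (i, k) + t * V $$ (i, k)" if "k < r" for t k
      using that ij Y Vc by auto
    have "riemannian_grad (objective C) (Y + t \<cdot>\<^sub>m V) $$ (i, j) =
       2 * (((C * Y) $$ (i, j) + t * (C * V) $$ (i, j)) -
         (\<Sum>k<r. ((C * Y) $$ (i, k) + t * (C * V) $$ (i, k)) * (Y $$ (i, k) + t * V $$ (i, k)))
         * (Y $$ (i, j) + t * V $$ (i, j)))" for t
      unfolding riemannian_grad_objective_index[OF C sym W ij]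
      using ij by (simp del: index_mult_mat index_add_mat add: CW WI cong: sum.cong_simp)
    moreover have "((\<lambda>t. 2 * (((C * Y) $$ (i, j) + t * (C * V) $$ (i, j)) -
         (\<Sum>k<r. ((C * Y) $$ (i, k) + t * (C * V) $$ (i, k)) * (Y $$ (i, k) + t * V $$ (i, k)))
         * (Y $$ (i, j) + t * V $$ (i, j)))) has_field_derivative
       2 * ((C * V) $$ (i, j) - d i * V $$ (i, j) - d' i * Y $$ (i, j))) (at 0)"
      unfolding d_def d'_def
      by (rule derivative_eq_intros refl | simp del: index_mult_mat)+
         (simp add: algebra_simps sum.distrib del: index_mult_mat)
    ultimately have "((\<lambda>t. riemannian_grad (objective C) (Y + t \<cdot>\<^sub>m V) $$ (i, j)) has_field_derivative
       2 * ((C * V) $$ (i, j) - d i * V $$ (i, j) - d' i * Y $$ (i, j))) (at 0)"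
      by presburger
    then show ?thesis
      using ij Y by (simp add: M_def mat_dir_deriv_def DERIV_imp_deriv del: index_mult_mat)
  qed
  have "frob_inner V (riemannian_hess (objective C) Y V) = frob_inner V M"
    unfolding riemannian_hess_def M_def[symmetric] by (rule frob_inner_tangent_proj[OF Y Mc V])
  also have "\<dots> = (\<Sum>i<n. 2 * ((\<Sum>j<r. V $$ (i, j) * (C * V) $$ (i, j)) - d i * (\<Sum>j<r. (V $$ (i, j))\<^sup>2)))"
    unfolding frob_inner_sum[OF Vc Mc]
  proof (intro sum.cong refl)
    fix i assume "i \<in> {..<n}"
    then have i: "i < n" by simp
    have "(\<Sum>j<r. V $$ (i, j) * M $$ (i, j)) = (\<Sum>j<r. 2 * (V $$ (i, j) * (C * V) $$ (i, j))
        - 2 * d i * (V $$ (i, j))\<^sup>2 - 2 * d' i * (Y $$ (i, j) * V $$ (i, j)))"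
      by (intro sum.cong refl) (simp add: Mi[OF i] algebra_simps power2_eq_square del: index_mult_mat)
    also have "\<dots> = 2 * (\<Sum>j<r. V $$ (i, j) * (C * V) $$ (i, j)) - 2 * d i * (\<Sum>j<r. (V $$ (i, j))\<^sup>2)
        - 2 * d' i * (\<Sum>j<r. Y $$ (i, j) * V $$ (i, j))"
      by (simp only: sum_subtractf sum_distrib_left)
    finally show "(\<Sum>j<r. V $$ (i, j) * M $$ (i, j)) =
        2 * ((\<Sum>j<r. V $$ (i, j) * (C * V) $$ (i, j)) - d i * (\<Sum>j<r. (V $$ (i, j))\<^sup>2))"
      using t[OF i] by (simp add: algebra_simps del: index_mult_mat)
  qed
  also have "\<dots> = - 2 * frob_inner (dual_cert C Y) (V * V\<^sup>T)"
  proof -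
    have D: "ddiag (C * Y * Y\<^sup>T) \<in> carrier_mat n n" using CY Y by (intro ddiag_carrier) auto
    have Sc: "dual_cert C Y \<in> carrier_mat n n"
      unfolding dual_cert_def by (rule minus_carrier_mat[OF C])
    have VV: "V * V\<^sup>T \<in> carrier_mat n n" using Vc by auto
    have VVi: "(V * V\<^sup>T) $$ (i, k) = (\<Sum>j<r. V $$ (i, j) * V $$ (k, j))" if "i < n" "k < n" for i k
      using Vc that by (auto simp: scalar_prod_def atLeast0LessThan intro!: sum.cong)
    have Si: "dual_cert C Y $$ (i, k) = (if k = i then d i else 0) - C $$ (i, k)"
      if "i < n" "k < n" for i k
    proof -
      have "ddiag (C * Y * Y\<^sup>T) $$ (i, k) = (if k = i then (C * Y * Y\<^sup>T) $$ (i, i) else 0)"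
        using that CY Y C by (auto simp: ddiag_def simp del: index_mult_mat(1))
      moreover have "(C * Y * Y\<^sup>T) $$ (i, i) = d i"
        unfolding d_def using that Y
        by (subst index_mult_sum[OF CY _ that(1) that(1)]) (auto intro!: sum.cong simp del: index_mult_mat(1))
      ultimately show ?thesis unfolding dual_cert_def using that C by simp
    qed
    have "frob_inner (dual_cert C Y) (V * V\<^sup>T) =
        (\<Sum>i<n. d i * (\<Sum>j<r. (V $$ (i, j))\<^sup>2) - (\<Sum>j<r. V $$ (i, j) * (C * V) $$ (i, j)))"
      unfolding frob_inner_sum[OF Sc VV]
    proof (intro sum.cong refl)
      fix i assume "i \<in> {..<n}"
      then have i: "i < n" by simp
      have "(\<Sum>k<n. dual_cert C Y $$ (i, k) * (V * V\<^sup>T) $$ (i, k)) =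
        (\<Sum>k<n. (if k = i then d i * (\<Sum>j<r. (V $$ (i, j))\<^sup>2) else 0)
           - (\<Sum>j<r. V $$ (i, j) * (C $$ (i, k) * V $$ (k, j))))"
        by (intro sum.cong refl)
           (auto simp: Si[OF i] VVi[OF i] i left_diff_distrib right_diff_distrib sum_distrib_left
             power2_eq_square mult.left_commute sum_subtractf sum_negf simp del: index_mult_mat)
      also have "\<dots> = d i * (\<Sum>j<r. (V $$ (i, j))\<^sup>2)
           - (\<Sum>k<n. \<Sum>j<r. V $$ (i, j) * (C $$ (i, k) * V $$ (k, j)))"
        using i by (simp add: sum_subtractf)
      also have "(\<Sum>k<n. \<Sum>j<r. V $$ (i, j) * (C $$ (i, k) * V $$ (k, j))) =
          (\<Sum>j<r. V $$ (i, j) * (C * V) $$ (i, j))"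
        by (subst sum.swap) (auto intro!: sum.cong simp: index_mult_sum[OF C Vc i] sum_distrib_left simp del: index_mult_mat)
      finally show "(\<Sum>k<n. dual_cert C Y $$ (i, k) * (V * V\<^sup>T) $$ (i, k)) =
        d i * (\<Sum>j<r. (V $$ (i, j))\<^sup>2) - (\<Sum>j<r. V $$ (i, j) * (C * V) $$ (i, j))" .
    qed
    then show ?thesis
      by (simp only: sum_distrib_left[of "- 2"]) (auto intro!: sum.cong simp del: index_mult_mat)
  qed
  finally show ?thesis .
qed

theorem second_order_critical_iff:
  assumes C: "C \<in> carrier_mat n n" and sym: "C\<^sup>T = C"
  shows "second_order_critical n r (objective C) Y \<longleftrightarrow>
    Y \<in> feasible_set n r \<and>
    dual_cert C Y * Y = 0\<^sub>m n r \<and>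
    (\<forall>V \<in> carrier_mat n r. ddiag (Y * V\<^sup>T) = 0\<^sub>m n n \<longrightarrow>
       frob_inner (dual_cert C Y) (V * V\<^sup>T) \<ge> 0)"
proof (cases "Y \<in> feasible_set n r")
  case True
  then have Y: "Y \<in> carrier_mat n r" by (simp add: feasible_set_def)
  have T: "V \<in> tangent_space Y \<longleftrightarrow> V \<in> carrier_mat n r \<and> ddiag (Y * V\<^sup>T) = 0\<^sub>m n n" for V
    using Y by (auto simp: tangent_space_def)
  have "(\<forall>V\<in>tangent_space Y. frob_inner V (riemannian_hess (objective C) Y V) \<le> 0) \<longleftrightarrow>
      (\<forall>V\<in>tangent_space Y. frob_inner (dual_cert C Y) (V * V\<^sup>T) \<ge> 0)"
    by (intro ball_cong refl) (simp add: riemannian_hess_objective[OF C sym Y])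
  then show ?thesis
    unfolding second_order_critical_def riemannian_grad_objective[OF C sym Y] using T by blast
qed (simp add: second_order_critical_def)

end

theory Submission
  imports Defs "HOL-Real_Asymp.Real_Asymp"
begin

text \<open>
Put \<open>y\<^sub>i = z\<^sub>i Y\<^sub>i\<close> for the rows \<open>Y\<^sub>i\<close> of \<open>Y\<close>, and \<open>W\<^sub>i\<^sub>j = z\<^sub>i C\<^sub>i\<^sub>j z\<^sub>j\<close>. The entries of \<open>W\<close> are independent
signs on the edges, with mean \<open>q = p\<delta>\<close>, and the claim becomes that all \<open>y\<^sub>i\<close> agree.

\<^bold>\<open>Deterministic part.\<close> Move all rows in a common direction, projected onto their tangent spaces, and
sum the Hessian inequality over an orthonormal basis of directions. With \<open>c\<^sub>i\<^sub>j\<close> the inner product of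
\<open>y\<^sub>i\<close> and \<open>y\<^sub>j\<close> this gives \<open>\<Sum> W\<^sub>i\<^sub>j ((r - 1) (1 - c\<^sub>i\<^sub>j) - (1 - c\<^sub>i\<^sub>j\<^sup>2)) \<le> 0\<close>
(\<open>second_order_trace_inequality\<close>). Here \<open>1 - c\<^sub>i\<^sub>j\<close> is half the squared distance of \<open>y\<^sub>i\<close> and \<open>y\<^sub>j\<close>, and
\<open>1 - c\<^sub>i\<^sub>j\<^sup>2\<close> is half the squared distance of their tensor squares. So both parts are Laplacian forms,
which split into a diagonal part, weighted by the row sums \<open>D\<^sub>i\<close> of \<open>W\<close>, and a quadratic form in \<open>W\<close>,
and the vectors may be translated at will before splitting. The \<open>y\<^sub>i\<close> are centred at their mean \<open>m a\<close>
with \<open>a\<close> a unit vector, which kills the constant part \<open>q\<close> of \<open>W\<close>; the tensor squares are centred at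
the tensor square of \<open>a\<close>, where the constant part has the favourable sign. With \<open>h\<^sub>i = y\<^sub>i - m a\<close> and
\<open>x\<^sub>i\<close> the inner product of \<open>y\<^sub>i\<close> and \<open>a\<close>, the diagonal parts combine to
\<open>\<Sum> D\<^sub>i ((r - 3) |h\<^sub>i|\<^sup>2 + 2 (x\<^sub>i - m)\<^sup>2)\<close>, so row sums that exceed a multiple of \<open>q\<close> and of the norm of the
noise \<open>W - q (J - I)\<close>, with \<open>J\<close> the all-ones matrix, force every \<open>h\<^sub>i\<close> to vanish (\<open>unit_rows_equal\<close>).

\<^bold>\<open>Row sums.\<close> A Chernoff bound with the tilt \<open>t\<close> given by \<open>tanh t = \<theta>\<delta>\<close> shows that \<open>D\<^sub>i\<close> falls below
\<open>(1 - \<theta>) n p \<delta>\<close> with probability at most a constant times \<open>exp (- n p (1 - sqrt (1 - \<theta>\<^sup>2\<delta>\<^sup>2)))\<close>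
(\<open>row_sum_tail\<close>). This is the expression in the threshold; taking \<open>\<theta>\<close> slightly larger than there
beats the union bound over the \<open>n\<close> rows, while \<open>1 - \<theta>\<close> stays away from zero.

\<^bold>\<open>Noise.\<close> The threshold gives \<open>(n p \<delta>)\<^sup>2 \<ge> n p ln n\<close>, so the noise has to have norm
\<open>o(sqrt (n p ln n))\<close>. Expand the expected trace of a power \<open>2k\<close> over closed walks. Since the entries
have mean zero, only walks that use every edge at least twice count, a walk with \<open>v\<close> vertices
contributes at most \<open>4\<^sup>k p\<^sup>v\<^sup>-\<^sup>1\<close>, and the number of walks of a given shape is the falling factorial of
\<open>n\<close> of length \<open>v \<le> k + 1\<close>. Comparing shape by shape with a dense matrix of dimension
\<open>d \<ge> n p + k\<close>, whose entries have all higher moments at least 1, bounds the trace moment by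
\<open>4\<^sup>k n / d\<close> times that of the dense matrix, in the manner of Bandeira and van Handel
(\<open>trace_moment_comparison\<close>). With \<open>k\<close> about \<open>n p\<close> and \<open>d = 2k\<close> the power is comparable to the dimension, so a net argument suffices for the dense matrix
(\<open>dense_trace_moment\<close>): its norm is of order \<open>sqrt k\<close>. Since \<open>k \<ge> ln n\<close>, the remaining factor \<open>n\<close>
costs only a constant factor in the norm, so the noise has norm of order \<open>sqrt (n p)\<close>
(\<open>noise_tail\<close>).
\<close>

section \<open>Quadratic forms with centred weights\<close>

definition sq_norm :: "nat \<Rightarrow> (nat \<Rightarrow> real) \<Rightarrow> real" where
  "sq_norm n x = (\<Sum>i<n. (x i)\<^sup>2)"

definition bilin :: "nat \<Rightarrow> (nat \<Rightarrow> nat \<Rightarrow> real) \<Rightarrow> (nat \<Rightarrow> real) \<Rightarrow> (nat \<Rightarrow> real) \<Rightarrow> real" where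
  "bilin n M x y = (\<Sum>i<n. \<Sum>j<n. M i j * x i * y j)"

definition symmetric_below :: "nat \<Rightarrow> (nat \<Rightarrow> nat \<Rightarrow> real) \<Rightarrow> bool" where
  "symmetric_below n M \<longleftrightarrow> (\<forall>i<n. \<forall>j<n. M i j = M j i)"

text \<open>The diagonal stays untouched because the weights of interest vanish there: their mean is \<open>q\<close> off the
diagonal only.\<close>

definition centred :: "real \<Rightarrow> (nat \<Rightarrow> nat \<Rightarrow> real) \<Rightarrow> nat \<Rightarrow> nat \<Rightarrow> real" where
  "centred q W i j = W i j - (if i = j then 0 else q)"

lemma weighted_sum_sq_diff:
  assumes sym: "symmetric_below n W"
  shows "(\<Sum>i<n. \<Sum>j<n. W i j * (x i - x j)\<^sup>2) =
    2 * (\<Sum>i<n. (\<Sum>j<n. W i j) * (x i)\<^sup>2) - 2 * bilin n W x x"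
proof -
  have "(\<Sum>i<n. \<Sum>j<n. W i j * (x i - x j)\<^sup>2) =
      (\<Sum>i<n. \<Sum>j<n. W i j * (x i)\<^sup>2) + (\<Sum>i<n. \<Sum>j<n. W i j * (x j)\<^sup>2) - 2 * bilin n W x x"
    by (simp add: bilin_def power2_diff algebra_simps sum.distrib sum_subtractf sum_distrib_left)
  also have "(\<Sum>i<n. \<Sum>j<n. W i j * (x j)\<^sup>2) = (\<Sum>i<n. \<Sum>j<n. W i j * (x i)\<^sup>2)"
    by (subst sum.swap) (use sym in \<open>auto intro!: sum.cong simp: symmetric_below_def\<close>)
  finally show ?thesis by (simp add: sum_distrib_right)
qed

text \<open>The left side is translation invariant in \<open>h\<close> whereas the two terms on the right are not, which leaves the
choice of a convenient origin. The index set \<open>K\<close> serves for vectors as well as for their tensor squares.\<close>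

lemma weighted_sum_sq_dist:
  fixes h :: "nat \<Rightarrow> 'k \<Rightarrow> real"
  assumes sym: "symmetric_below n W"
  shows "(\<Sum>i<n. \<Sum>j<n. W i j * (\<Sum>k\<in>K. (h i k - h j k)\<^sup>2)) =
    2 * (\<Sum>i<n. (\<Sum>j<n. W i j) * (\<Sum>k\<in>K. (h i k)\<^sup>2))
    - 2 * (\<Sum>k\<in>K. bilin n W (\<lambda>i. h i k) (\<lambda>i. h i k))"
proof -
  have "(\<Sum>i<n. \<Sum>j<n. W i j * (\<Sum>k\<in>K. (h i k - h j k)\<^sup>2)) =
      (\<Sum>k\<in>K. \<Sum>i<n. \<Sum>j<n. W i j * (h i k - h j k)\<^sup>2)"
    by (simp add: sum_distrib_left sum.swap[of _ K])
  also have "\<dots> = (\<Sum>k\<in>K. 2 * (\<Sum>i<n. (\<Sum>j<n. W i j) * (h i k)\<^sup>2)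
      - 2 * bilin n W (\<lambda>i. h i k) (\<lambda>i. h i k))"
    by (simp add: weighted_sum_sq_diff[OF sym])
  also have "\<dots> = 2 * (\<Sum>k\<in>K. \<Sum>i<n. (\<Sum>j<n. W i j) * (h i k)\<^sup>2)
      - 2 * (\<Sum>k\<in>K. bilin n W (\<lambda>i. h i k) (\<lambda>i. h i k))"
    by (simp add: sum_subtractf sum_distrib_left)
  also have "(\<Sum>k\<in>K. \<Sum>i<n. (\<Sum>j<n. W i j) * (h i k)\<^sup>2) = (\<Sum>i<n. (\<Sum>j<n. W i j) * (\<Sum>k\<in>K. (h i k)\<^sup>2))"
    by (subst sum.swap) (simp add: sum_distrib_left)
  finally show ?thesis .
qed

lemma bilin_centred:
  "bilin n W x x = bilin n (centred q W) x x + q * (\<Sum>i<n. x i)\<^sup>2 - q * sq_norm n x"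
proof -
  have "bilin n W x x = (\<Sum>i<n. \<Sum>j<n. centred q W i j * x i * x j + q * (x i * x j)
      - (if j = i then q * (x i)\<^sup>2 else 0))"
    unfolding bilin_def
    by (intro sum.cong refl) (auto simp: centred_def algebra_simps power2_eq_square)
  also have "\<dots> = bilin n (centred q W) x x + q * (\<Sum>i<n. \<Sum>j<n. x i * x j) - q * sq_norm n x"
    by (simp add: bilin_def sq_norm_def sum.distrib sum_subtractf sum_distrib_left)
  finally show ?thesis by (simp add: power2_eq_square sum_product)
qed

lemma sum_tensor:
  fixes f g :: "nat \<Rightarrow> real"
  shows "(\<Sum>kl\<in>{..<r} \<times> {..<r}. (f (fst kl) * f (snd kl)) * (g (fst kl) * g (snd kl))) =
    (\<Sum>k<r. f k * g k)\<^sup>2"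
  by (simp add: power2_eq_square sum_product sum.cartesian_product case_prod_beta mult_ac)

lemma sum_tensor_diff_sq:
  fixes f g :: "nat \<Rightarrow> real"
  assumes "(\<Sum>k<r. (f k)\<^sup>2) = 1" "(\<Sum>k<r. (g k)\<^sup>2) = 1"
  shows "(\<Sum>kl\<in>{..<r} \<times> {..<r}. (f (fst kl) * f (snd kl) - g (fst kl) * g (snd kl))\<^sup>2) =
    2 - 2 * (\<Sum>k<r. f k * g k)\<^sup>2"
proof -
  have "(\<Sum>kl\<in>{..<r} \<times> {..<r}. (f (fst kl) * f (snd kl) - g (fst kl) * g (snd kl))\<^sup>2) =
      (\<Sum>kl\<in>{..<r} \<times> {..<r}. (f (fst kl) * f (snd kl)) * (f (fst kl) * f (snd kl))
        + (g (fst kl) * g (snd kl)) * (g (fst kl) * g (snd kl))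
        - 2 * ((f (fst kl) * f (snd kl)) * (g (fst kl) * g (snd kl))))"
    by (intro sum.cong refl) (simp add: power2_eq_square algebra_simps)
  also have "\<dots> = (\<Sum>k<r. f k * f k)\<^sup>2 + (\<Sum>k<r. g k * g k)\<^sup>2 - 2 * (\<Sum>k<r. f k * g k)\<^sup>2"
    by (simp only: sum.distrib sum_subtractf sum_distrib_left[symmetric] sum_tensor)
  finally show ?thesis using assms by (simp add: power2_eq_square)
qed

text \<open>Apply the splitting of weighted squared distances to \<open>y\<^sub>i\<close>, centred at the mean \<open>m a\<close>, and to the tensor
squares of \<open>y\<^sub>i\<close>, centred at that of the unit vector \<open>a\<close>. If \<open>H\<^sub>i\<close> and \<open>K\<^sub>i\<close> are the squared lengths after
centring and \<open>x\<^sub>i\<close> is the inner product of \<open>y\<^sub>i\<close> and \<open>a\<close>, then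
\<open>(r - 1) H\<^sub>i - K\<^sub>i = (r - 3) H\<^sub>i + 2 (x\<^sub>i - m)\<^sup>2\<close>; the case \<open>r = 3\<close> of this identity also gives \<open>K\<^sub>i \<le> 2 H\<^sub>i\<close>.
So the diagonal terms have total at least \<open>(r - 3) \<mu> \<Sum> H\<^sub>i\<close>, and the error terms at most
\<open>((r + 1) B + 2 q) \<Sum> H\<^sub>i\<close>.\<close>

lemma unit_rows_equal:
  fixes y W :: "nat \<Rightarrow> nat \<Rightarrow> real" and r :: nat
  defines "c \<equiv> \<lambda>i j. \<Sum>k<r. y i k * y j k"
  assumes sym: "symmetric_below n W"
    and unit: "\<And>i. i < n \<Longrightarrow> (\<Sum>k<r. (y i k)\<^sup>2) = 1"
    and r: "r \<ge> 4"
    and second_order: "(\<Sum>i<n. \<Sum>j<n. W i j * ((real r - 1) * (1 - c i j) - (1 - (c i j)\<^sup>2))) \<le> 0"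
    and row: "\<And>i. i < n \<Longrightarrow> (\<Sum>j<n. W i j) \<ge> \<mu>"
    and noise: "\<And>x. \<bar>bilin n (centred q W) x x\<bar> \<le> B * sq_norm n x"
    and "q \<ge> 0" "B \<ge> 0" and gap: "(real r - 3) * \<mu> > (real r + 1) * B + 2 * q"
  shows "\<exists>u. \<forall>i<n. \<forall>k<r. y i k = u k"
proof -
  define ybar where "ybar k = (\<Sum>i<n. y i k) / n" for k
  define h where "h i k = y i k - ybar k" for i k
  define m where "m = sqrt (\<Sum>k<r. (ybar k)\<^sup>2)"
  have msq: "m\<^sup>2 = (\<Sum>k<r. (ybar k)\<^sup>2)"
    unfolding m_def by (simp add: sum_nonneg)
  \<comment> \<open>If the mean vanishes, any unit vector will do as its direction.\<close>
  obtain a where a1: "(\<Sum>k<r. (a k)\<^sup>2) = 1" and am: "\<And>k. k < r \<Longrightarrow> ybar k = m * a k"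
  proof (cases "m = 0")
    case True
    then have "(\<Sum>k<r. (ybar k)\<^sup>2) = 0" using msq by simp
    then have "\<And>k. k < r \<Longrightarrow> ybar k = 0"
      by (subst (asm) sum_nonneg_eq_0_iff) auto
    then show thesis using True r
      by (intro that[of "\<lambda>k. if k = 0 then 1 else 0"]) (auto simp: if_distrib[of "\<lambda>x. x\<^sup>2"] cong: if_cong)
  next
    case False
    then show thesis
      by (intro that[of "\<lambda>k. ybar k / m"]) (auto simp: power_divide sum_divide_distrib[symmetric] msq[symmetric])
  qed
  define x where "x i = (\<Sum>k<r. y i k * a k)" for i
  define H where "H i = (\<Sum>k<r. (h i k)\<^sup>2)" for i
  define T where "T i kl = y i (fst kl) * y i (snd kl) - a (fst kl) * a (snd kl)" for i kl
  define K where "K i = (\<Sum>kl\<in>{..<r} \<times> {..<r}. (T i kl)\<^sup>2)" for i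
  define D where "D i = (\<Sum>j<n. W i j)" for i
  have H_eq: "H i = 1 - 2 * m * x i + m\<^sup>2" if "i < n" for i
  proof -
    have "H i = (\<Sum>k<r. (y i k)\<^sup>2 - 2 * m * (y i k * a k) + m\<^sup>2 * (a k)\<^sup>2)"
      unfolding H_def h_def by (intro sum.cong refl) (simp add: am power2_eq_square algebra_simps)
    also have "\<dots> = (\<Sum>k<r. (y i k)\<^sup>2) - 2 * m * x i + m\<^sup>2 * (\<Sum>k<r. (a k)\<^sup>2)"
      by (simp add: sum.distrib sum_subtractf sum_distrib_left x_def)
    finally show ?thesis using that by (simp add: unit a1)
  qed
  have K_eq: "K i = 2 - 2 * (x i)\<^sup>2" if "i < n" for i
    unfolding K_def T_def x_def using that by (intro sum_tensor_diff_sq unit a1)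
  have HK: "(real r - 1) * H i - K i = (real r - 3) * H i + 2 * (x i - m)\<^sup>2" if "i < n" for i
    unfolding K_eq[OF that] H_eq[OF that] by (simp add: power2_eq_square algebra_simps)
  have K_le: "K i \<le> 2 * H i" if "i < n" for i
    unfolding K_eq[OF that] H_eq[OF that]
    using zero_le_power2[of "x i - m"] by (simp add: power2_diff algebra_simps)
  have H0: "H i \<ge> 0" for i by (simp add: H_def sum_nonneg)
  have distH: "(\<Sum>k<r. (h i k - h j k)\<^sup>2) = 2 * (1 - c i j)" if "i < n" "j < n" for i j
  proof -
    have "(\<Sum>k<r. (h i k - h j k)\<^sup>2) = (\<Sum>k<r. (y i k)\<^sup>2 + (y j k)\<^sup>2 - 2 * (y i k * y j k))"
      by (intro sum.cong refl) (simp add: h_def power2_diff)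
    then show ?thesis
      using that by (simp add: sum.distrib sum_subtractf sum_distrib_left[symmetric] unit c_def)
  qed
  have distK: "(\<Sum>kl\<in>{..<r} \<times> {..<r}. (T i kl - T j kl)\<^sup>2) = 2 * (1 - (c i j)\<^sup>2)" if "i < n" "j < n" for i j
    unfolding c_def using sum_tensor_diff_sq[of "y i" r "y j"] that by (simp add: T_def unit)
  have sumh: "(\<Sum>i<n. h i k) = 0" for k
    by (cases "n = 0") (simp_all add: h_def sum_subtractf ybar_def)
  \<comment> \<open>The mean of the \<open>h\<^sub>i\<close> is zero, so the constant part of \<open>W\<close> contributes nothing positive.\<close>
  have E1: "(\<Sum>i<n. \<Sum>j<n. W i j * (1 - c i j)) \<ge> (\<Sum>i<n. D i * H i) - B * (\<Sum>i<n. H i)"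
  proof -
    have "(\<Sum>i<n. \<Sum>j<n. W i j * (\<Sum>k<r. (h i k - h j k)\<^sup>2)) = 2 * (\<Sum>i<n. \<Sum>j<n. W i j * (1 - c i j))"
      by (simp add: distH sum_distrib_left mult.left_commute[of 2] del: right_diff_distrib_numeral)
    moreover have "(\<Sum>k<r. bilin n W (\<lambda>i. h i k) (\<lambda>i. h i k)) \<le> (\<Sum>k<r. B * sq_norm n (\<lambda>i. h i k))"
    proof (rule sum_mono)
      fix k
      have "q * sq_norm n (\<lambda>i. h i k) \<ge> 0" using \<open>q \<ge> 0\<close> by (simp add: sq_norm_def sum_nonneg)
      then show "bilin n W (\<lambda>i. h i k) (\<lambda>i. h i k) \<le> B * sq_norm n (\<lambda>i. h i k)"
        using noise[of "\<lambda>i. h i k"] unfolding bilin_centred[of n W _ q] by (simp add: sumh)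
    qed
    moreover have "(\<Sum>k<r. B * sq_norm n (\<lambda>i. h i k)) = B * (\<Sum>i<n. H i)"
      unfolding sq_norm_def H_def sum_distrib_left[symmetric] by (subst sum.swap) simp
    ultimately show ?thesis
      unfolding D_def H_def using weighted_sum_sq_dist[OF sym, where h = h and K = "{..<r}"] by simp
  qed
  \<comment> \<open>The tensors need not sum to zero, but their sum enters with the right sign, as a square.\<close>
  have E2: "(\<Sum>i<n. \<Sum>j<n. W i j * (1 - (c i j)\<^sup>2)) \<le> (\<Sum>i<n. D i * K i) + (B + q) * (\<Sum>i<n. K i)"
  proof -
    let ?R = "{..<r} \<times> {..<r}"
    have "(\<Sum>i<n. \<Sum>j<n. W i j * (\<Sum>kl\<in>?R. (T i kl - T j kl)\<^sup>2)) = 2 * (\<Sum>i<n. \<Sum>j<n. W i j * (1 - (c i j)\<^sup>2))"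
      by (simp add: distK sum_distrib_left mult.left_commute[of 2] del: right_diff_distrib_numeral)
    moreover have "(\<Sum>kl\<in>?R. bilin n W (\<lambda>i. T i kl) (\<lambda>i. T i kl)) \<ge> (\<Sum>kl\<in>?R. - (B + q) * sq_norm n (\<lambda>i. T i kl))"
    proof (rule sum_mono)
      fix kl
      have "q * (\<Sum>i<n. T i kl)\<^sup>2 \<ge> 0" using \<open>q \<ge> 0\<close> by simp
      then show "- (B + q) * sq_norm n (\<lambda>i. T i kl) \<le> bilin n W (\<lambda>i. T i kl) (\<lambda>i. T i kl)"
        using noise[of "\<lambda>i. T i kl"] unfolding bilin_centred[of n W _ q] by (simp add: algebra_simps)
    qed
    moreover have "(\<Sum>kl\<in>?R. - (B + q) * sq_norm n (\<lambda>i. T i kl)) = - (B + q) * (\<Sum>i<n. K i)"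
      unfolding sq_norm_def K_def sum_distrib_left[symmetric] by (subst sum.swap) simp
    ultimately show ?thesis
      unfolding D_def K_def using weighted_sum_sq_dist[OF sym, where h = T and K = ?R]
      by (simp add: algebra_simps)
  qed
  have \<mu>0: "\<mu> \<ge> 0"
  proof -
    have "(real r + 1) * B + 2 * q \<ge> 0" using \<open>q \<ge> 0\<close> \<open>B \<ge> 0\<close> by simp
    then have "(real r - 3) * \<mu> > 0" using gap by linarith
    then show ?thesis using r by (simp add: zero_less_mult_iff)
  qed
  have row_sum: "(\<Sum>i<n. D i * ((real r - 1) * H i - K i)) \<ge> (\<Sum>i<n. \<mu> * ((real r - 3) * H i))"
  proof (rule sum_mono)
    fix i assume "i \<in> {..<n}"
    then have i: "i < n" by simp
    have "\<mu> * ((real r - 3) * H i) \<le> D i * ((real r - 3) * H i)"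
      using row[OF i] r H0[of i] by (intro mult_right_mono) (auto simp: D_def)
    also have "\<dots> \<le> D i * ((real r - 3) * H i + 2 * (x i - m)\<^sup>2)"
      using row[OF i] \<mu>0 by (intro mult_left_mono) (auto simp: D_def)
    finally show "\<mu> * ((real r - 3) * H i) \<le> D i * ((real r - 1) * H i - K i)"
      by (simp add: HK[OF i])
  qed
  have "0 \<ge> (real r - 1) * (\<Sum>i<n. \<Sum>j<n. W i j * (1 - c i j)) - (\<Sum>i<n. \<Sum>j<n. W i j * (1 - (c i j)\<^sup>2))"
  proof -
    have "(real r - 1) * (\<Sum>i<n. \<Sum>j<n. W i j * (1 - c i j)) - (\<Sum>i<n. \<Sum>j<n. W i j * (1 - (c i j)\<^sup>2)) =
        (\<Sum>i<n. \<Sum>j<n. W i j * ((real r - 1) * (1 - c i j) - (1 - (c i j)\<^sup>2)))"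
      by (simp only: sum_distrib_left sum_subtractf[symmetric] right_diff_distrib[of "W _ _"]
            mult.left_commute[of "W _ _"])
    then show ?thesis using second_order by simp
  qed
  moreover have "(real r - 1) * (\<Sum>i<n. \<Sum>j<n. W i j * (1 - c i j)) \<ge>
      (real r - 1) * ((\<Sum>i<n. D i * H i) - B * (\<Sum>i<n. H i))"
    using E1 r by (intro mult_left_mono) auto
  ultimately have "0 \<ge> (real r - 1) * ((\<Sum>i<n. D i * H i) - B * (\<Sum>i<n. H i))
      - (\<Sum>i<n. D i * K i) - (B + q) * (\<Sum>i<n. K i)"
    using E2 by linarith
  also have "(real r - 1) * ((\<Sum>i<n. D i * H i) - B * (\<Sum>i<n. H i))
      - (\<Sum>i<n. D i * K i) - (B + q) * (\<Sum>i<n. K i) =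
      (\<Sum>i<n. D i * ((real r - 1) * H i - K i)) - (real r - 1) * B * (\<Sum>i<n. H i) - (B + q) * (\<Sum>i<n. K i)"
    by (simp add: right_diff_distrib sum_subtractf sum_distrib_left mult_ac)
  finally have "0 \<ge> (\<Sum>i<n. \<mu> * ((real r - 3) * H i)) - (real r - 1) * B * (\<Sum>i<n. H i) - (B + q) * (\<Sum>i<n. K i)"
    using row_sum by linarith
  moreover have "(B + q) * (\<Sum>i<n. K i) \<le> (B + q) * (2 * (\<Sum>i<n. H i))"
    using \<open>q \<ge> 0\<close> \<open>B \<ge> 0\<close> by (intro mult_left_mono) (auto simp: sum_distrib_left K_le intro!: sum_mono)
  moreover have "(\<Sum>i<n. \<mu> * ((real r - 3) * H i)) = \<mu> * (real r - 3) * (\<Sum>i<n. H i)"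
    by (simp add: sum_distrib_left mult.assoc)
  ultimately have "((real r - 3) * \<mu> - ((real r + 1) * B + 2 * q)) * (\<Sum>i<n. H i) \<le> 0"
    by (simp add: algebra_simps)
  then have "(\<Sum>i<n. H i) \<le> 0"
    using gap by (simp add: mult_le_0_iff)
  then have "(\<Sum>i<n. H i) = 0"
    using sum_nonneg[of "{..<n}" H] H0 by auto
  then have "H i = 0" if "i < n" for i
    using that H0 by (subst (asm) sum_nonneg_eq_0_iff) auto
  then have "h i k = 0" if "i < n" "k < r" for i k
    using that unfolding H_def by (subst (asm) sum_nonneg_eq_0_iff) auto
  then show ?thesis unfolding h_def by (intro exI[of _ ybar]) auto
qed


section \<open>The Hessian inequality summed over common directions\<close>

text \<open>The left side is the trace of the product of the projections orthogonal to \<open>f\<close> and to \<open>g\<close>.\<close>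

lemma sum_projection_products:
  fixes f g :: "nat \<Rightarrow> real" and r :: nat
  assumes "(\<Sum>k<r. (f k)\<^sup>2) = 1" "(\<Sum>k<r. (g k)\<^sup>2) = 1"
  shows "(\<Sum>l<r. \<Sum>k<r. ((if k = l then 1 else 0) - f l * f k) * ((if k = l then 1 else 0) - g l * g k)) =
    real r - 2 + (\<Sum>k<r. f k * g k)\<^sup>2"
proof -
  have "(\<Sum>k<r. ((if k = l then 1 else 0) - f l * f k) * ((if k = l then 1 else 0) - g l * g k)) =
      1 - (f l)\<^sup>2 - (g l)\<^sup>2 + f l * g l * (\<Sum>k<r. f k * g k)" if "l < r" for l
  proof -
    have "(\<Sum>k<r. ((if k = l then 1 else 0) - f l * f k) * ((if k = l then 1 else 0) - g l * g k)) =
        (\<Sum>k<r. (if k = l then 1 - (f l)\<^sup>2 - (g l)\<^sup>2 else 0) + f l * g l * (f k * g k))"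
      by (intro sum.cong refl) (simp add: algebra_simps power2_eq_square)
    then show ?thesis using that by (simp add: sum.distrib sum_distrib_left)
  qed
  then have "(\<Sum>l<r. \<Sum>k<r. ((if k = l then 1 else 0) - f l * f k) * ((if k = l then 1 else 0) - g l * g k)) =
      (\<Sum>l<r. 1 - (f l)\<^sup>2 - (g l)\<^sup>2 + f l * g l * (\<Sum>k<r. f k * g k))"
    by simp
  also have "\<dots> = real r - 1 - 1 + (\<Sum>k<r. f k * g k) * (\<Sum>k<r. f k * g k)"
    by (simp only: sum.distrib sum_subtractf assms sum_distrib_right[symmetric]) simp
  finally show ?thesis by (simp add: power2_eq_square)
qed

lemma dual_cert_index:
  assumes C: "C \<in> carrier_mat n n" and Y: "Y \<in> carrier_mat n r" and ij: "i < n" "j < n"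
  shows "dual_cert C Y $$ (i, j) =
    (if i = j then \<Sum>l<n. C $$ (i, l) * (\<Sum>k<r. Y $$ (i, k) * Y $$ (l, k)) else 0) - C $$ (i, j)"
proof -
  have CY: "C * Y \<in> carrier_mat n r" and YT: "Y\<^sup>T \<in> carrier_mat r n" using C Y by auto
  have "(C * Y * Y\<^sup>T) $$ (i, i) = (\<Sum>k<r. (\<Sum>l<n. C $$ (i, l) * Y $$ (l, k)) * Y $$ (i, k))"
    using ij Y by (simp add: index_mult_sum[OF CY YT] index_mult_sum[OF C Y] del: index_mult_mat(1))
  also have "\<dots> = (\<Sum>l<n. C $$ (i, l) * (\<Sum>k<r. Y $$ (i, k) * Y $$ (l, k)))"
    unfolding sum_distrib_left sum_distrib_right by (subst sum.swap) (simp add: mult_ac)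
  finally show ?thesis
    using ij C Y CY unfolding dual_cert_def
    by (auto simp: ddiag_def simp del: index_mult_mat(1) assoc_mult_mat)
qed

text \<open>The diagonal of the dual certificate depends on \<open>Y\<close>; distributing it over the columns makes every term
carry a factor \<open>C\<^sub>i\<^sub>j\<close>, so that the Hessian becomes a sum over edges.\<close>

lemma frob_inner_dual_cert:
  assumes C: "C \<in> carrier_mat n n" and Y: "Y \<in> carrier_mat n r" and V: "V \<in> carrier_mat n r"
  shows "frob_inner (dual_cert C Y) (V * V\<^sup>T) =
    (\<Sum>i<n. \<Sum>j<n. C $$ (i, j) * ((\<Sum>k<r. Y $$ (i, k) * Y $$ (j, k)) * (\<Sum>k<r. V $$ (i, k) * V $$ (i, k))
       - (\<Sum>k<r. V $$ (i, k) * V $$ (j, k))))"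
proof -
  have S: "dual_cert C Y \<in> carrier_mat n n"
    unfolding dual_cert_def by (rule minus_carrier_mat[OF C])
  have VV: "V * V\<^sup>T \<in> carrier_mat n n" and VT: "V\<^sup>T \<in> carrier_mat r n" using V by auto
  have VVi: "(V * V\<^sup>T) $$ (i, j) = (\<Sum>k<r. V $$ (i, k) * V $$ (j, k))" if "i < n" "j < n" for i j
    using that V by (simp add: index_mult_sum[OF V VT] del: index_mult_mat(1))
  have row: "(\<Sum>j<n. dual_cert C Y $$ (i, j) * (V * V\<^sup>T) $$ (i, j)) =
      (\<Sum>j<n. C $$ (i, j) * ((\<Sum>k<r. Y $$ (i, k) * Y $$ (j, k)) * (\<Sum>k<r. V $$ (i, k) * V $$ (i, k))
       - (\<Sum>k<r. V $$ (i, k) * V $$ (j, k))))" if i: "i < n" for i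
  proof -
    have "(\<Sum>j<n. dual_cert C Y $$ (i, j) * (V * V\<^sup>T) $$ (i, j)) =
        (\<Sum>j<n. (if i = j then (\<Sum>l<n. C $$ (i, l) * (\<Sum>k<r. Y $$ (i, k) * Y $$ (l, k)))
             * (\<Sum>k<r. V $$ (i, k) * V $$ (i, k)) else 0)
          - C $$ (i, j) * (\<Sum>k<r. V $$ (i, k) * V $$ (j, k)))"
      using i by (intro sum.cong refl)
        (auto simp: dual_cert_index[OF C Y] VVi algebra_simps simp del: index_mult_mat(1))
    then show ?thesis using i
      by (simp add: sum_subtractf right_diff_distrib sum_distrib_right mult.assoc del: index_mult_mat(1))
  qed
  then show ?thesis
    unfolding frob_inner_sum[OF S VV] by (intro sum.cong[OF refl] row) simp
qed

text \<open>The direction \<open>V l\<close> moves every row, up to its sign \<open>z i\<close>, along the \<open>l\<close>-th basis vector, as far as the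
tangent space allows. For equal rows these are the rotations of all of them at once, along which the
objective is constant, so they detect how far the rows are from being equal.\<close>

lemma second_order_trace_inequality:
  fixes z :: "nat \<Rightarrow> real"
  assumes C: "C \<in> carrier_mat n n" and sym: "C\<^sup>T = C"
    and crit: "second_order_critical n r (objective C) Y"
    and z: "\<And>i. i < n \<Longrightarrow> z i * z i = 1"
  defines "y \<equiv> \<lambda>i k. z i * Y $$ (i, k)"
  defines "c \<equiv> \<lambda>i j. \<Sum>k<r. y i k * y j k"
  shows "(\<Sum>i<n. \<Sum>j<n. (z i * C $$ (i, j) * z j) *
    ((real r - 1) * (1 - c i j) - (1 - (c i j)\<^sup>2))) \<le> 0"
proof -
  have Y: "Y \<in> carrier_mat n r" and unit: "\<And>i. i < n \<Longrightarrow> (\<Sum>k<r. (Y $$ (i, k))\<^sup>2) = 1"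
    using crit by (auto simp: second_order_critical_def feasible_set_iff)
  have yunit: "(\<Sum>k<r. (y i k)\<^sup>2) = 1" if "i < n" for i
    using unit[OF that] z[OF that] by (simp add: y_def power_mult_distrib power2_eq_square[of "z i"])
  define P where "P l i k = (if k = l then 1 else 0) - y i l * y i k" for l i k
  define V where "V l = mat n r (\<lambda>(i, k). z i * P l i k)" for l
  have V: "V l \<in> carrier_mat n r" for l by (simp add: V_def)
  have Vi: "V l $$ (i, k) = z i * P l i k" if "i < n" "k < r" for l i k
    using that by (simp add: V_def)
  have tangent: "V l \<in> tangent_space Y" if "l < r" for l
  proof -
    have "(\<Sum>k<r. Y $$ (i, k) * V l $$ (i, k)) = 0" if i: "i < n" for i
    proof -
      have "(\<Sum>k<r. Y $$ (i, k) * V l $$ (i, k)) =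
          (\<Sum>k<r. (if k = l then y i l else 0) - y i l * (y i k)\<^sup>2)"
        using i by (intro sum.cong refl) (simp add: Vi P_def y_def algebra_simps power2_eq_square)
      also have "\<dots> = y i l - y i l * (\<Sum>k<r. (y i k)\<^sup>2)"
        using \<open>l < r\<close> by (simp add: sum_subtractf sum_distrib_left)
      finally show ?thesis using yunit[OF i] by simp
    qed
    then show ?thesis using V by (simp add: tangent_space_iff[OF Y])
  qed
  have VV: "(\<Sum>k<r. V l $$ (i, k) * V l $$ (j, k)) = z i * z j * (\<Sum>k<r. P l i k * P l j k)"
    if "i < n" "j < n" for l i j
    using that by (simp add: Vi sum_distrib_left mult_ac)
  have YY: "(\<Sum>k<r. Y $$ (i, k) * Y $$ (j, k)) = z i * z j * c i j" if "i < n" "j < n" for i j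
  proof -
    have "z i * z j * c i j = (\<Sum>k<r. (z i * z i) * (z j * z j) * (Y $$ (i, k) * Y $$ (j, k)))"
      by (simp add: c_def y_def sum_distrib_left mult_ac)
    then show ?thesis using that by (simp add: z)
  qed
  have PP: "(\<Sum>l<r. \<Sum>k<r. P l i k * P l j k) = real r - 2 + (c i j)\<^sup>2" if "i < n" "j < n" for i j
    unfolding P_def c_def by (rule sum_projection_products) (simp_all add: yunit that)
  have cii: "c i i = 1" if "i < n" for i
    using yunit[OF that] by (simp add: c_def power2_eq_square)
  have "0 \<le> (\<Sum>l<r. frob_inner (dual_cert C Y) (V l * (V l)\<^sup>T))"
  proof (rule sum_nonneg)
    fix l assume "l \<in> {..<r}"
    then show "0 \<le> frob_inner (dual_cert C Y) (V l * (V l)\<^sup>T)"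
      using crit tangent[of l] Y V[of l]
      by (simp add: second_order_critical_iff[OF C sym] tangent_space_def)
  qed
  also have "\<dots> = (\<Sum>l<r. \<Sum>i<n. \<Sum>j<n. z i * C $$ (i, j) * z j *
      (c i j * (\<Sum>k<r. P l i k * P l i k) - (\<Sum>k<r. P l i k * P l j k)))"
    unfolding frob_inner_dual_cert[OF C Y V]
    by (intro sum.cong refl) (simp add: VV YY z algebra_simps)
  also have "\<dots> = (\<Sum>i<n. \<Sum>j<n. z i * C $$ (i, j) * z j *
      (c i j * (\<Sum>l<r. \<Sum>k<r. P l i k * P l i k) - (\<Sum>l<r. \<Sum>k<r. P l i k * P l j k)))"
    by (simp add: sum_distrib_left sum_subtractf right_diff_distrib sum.swap[of _ "{..<r}" "{..<n}"])
  also have "\<dots> = (\<Sum>i<n. \<Sum>j<n. z i * C $$ (i, j) * z j *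
      - ((real r - 1) * (1 - c i j) - (1 - (c i j)\<^sup>2)))"
    by (intro sum.cong refl arg_cong2[where f = "(*)"]) (simp add: PP cii algebra_simps)
  also have "\<dots> = - (\<Sum>i<n. \<Sum>j<n. z i * C $$ (i, j) * z j *
      ((real r - 1) * (1 - c i j) - (1 - (c i j)\<^sup>2)))"
    by (simp only: mult_minus_right sum_negf)
  finally show ?thesis by simp
qed


section \<open>Norm and trace of powers of a symmetric matrix\<close>

definition mat_vec :: "nat \<Rightarrow> (nat \<Rightarrow> nat \<Rightarrow> real) \<Rightarrow> (nat \<Rightarrow> real) \<Rightarrow> nat \<Rightarrow> real" where
  "mat_vec n M x i = (\<Sum>j<n. M i j * x j)"

definition unit_fun :: "nat \<Rightarrow> nat \<Rightarrow> real" where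
  "unit_fun i j = (if j = i then 1 else 0)"

definition trace_power :: "nat \<Rightarrow> (nat \<Rightarrow> nat \<Rightarrow> real) \<Rightarrow> nat \<Rightarrow> real" where
  "trace_power n M m = (\<Sum>i<n. (mat_vec n M ^^ m) (unit_fun i) i)"

lemma mat_vec_adjoint:
  assumes sym: "symmetric_below n M"
  shows "(\<Sum>i<n. x i * mat_vec n M y i) = (\<Sum>i<n. mat_vec n M x i * y i)"
proof -
  have "(\<Sum>i<n. x i * mat_vec n M y i) = (\<Sum>j<n. \<Sum>i<n. x i * (M i j * y j))"
    unfolding mat_vec_def sum_distrib_left by (rule sum.swap)
  also have "\<dots> = (\<Sum>i<n. mat_vec n M x i * y i)"
    unfolding mat_vec_def sum_distrib_right using sym by (intro sum.cong refl) (auto simp: symmetric_below_def)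
  finally show ?thesis .
qed

lemma mat_vec_power_adjoint:
  assumes sym: "symmetric_below n M"
  shows "(\<Sum>i<n. x i * (mat_vec n M ^^ m) y i) = (\<Sum>i<n. (mat_vec n M ^^ m) x i * y i)"
proof (induction m arbitrary: x y)
  case (Suc m)
  have "(\<Sum>i<n. x i * (mat_vec n M ^^ Suc m) y i) =
      (\<Sum>i<n. mat_vec n M x i * (mat_vec n M ^^ m) y i)"
    by (simp add: mat_vec_adjoint[OF sym])
  also have "\<dots> = (\<Sum>i<n. (mat_vec n M ^^ Suc m) x i * y i)"
    by (simp add: Suc funpow_swap1)
  finally show ?case .
qed simp

lemma sum_unit_fun: "i < n \<Longrightarrow> (\<Sum>j<n. unit_fun i j * x j) = x i"
  by (simp add: unit_fun_def if_distrib[of "\<lambda>a. a * _"] cong: if_cong)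

text \<open>An entry of a power, read off through self-adjointness, so that the linearity of the power need not be
developed separately.\<close>

lemma mat_vec_power_entry:
  assumes sym: "symmetric_below n M" and "i < n"
  shows "(mat_vec n M ^^ m) x i = (\<Sum>j<n. (mat_vec n M ^^ m) (unit_fun i) j * x j)"
  using mat_vec_power_adjoint[OF sym, of "unit_fun i" m x] assms(2) by (simp add: sum_unit_fun)

lemma trace_power_even:
  assumes sym: "symmetric_below n M"
  shows "trace_power n M (2 * k) = (\<Sum>i<n. sq_norm n ((mat_vec n M ^^ k) (unit_fun i)))"
  unfolding trace_power_def
proof (intro sum.cong refl)
  fix i assume "i \<in> {..<n}"
  then have "(mat_vec n M ^^ (k + k)) (unit_fun i) i =
      (\<Sum>j<n. (mat_vec n M ^^ k) (unit_fun i) j * (mat_vec n M ^^ k) (unit_fun i) j)"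
    unfolding funpow_add comp_apply by (intro mat_vec_power_entry[OF sym]) simp_all
  then show "(mat_vec n M ^^ (2 * k)) (unit_fun i) i = sq_norm n ((mat_vec n M ^^ k) (unit_fun i))"
    by (simp add: sq_norm_def power2_eq_square mult_2)
qed

lemma sq_norm_nonneg: "sq_norm n x \<ge> 0"
  by (simp add: sq_norm_def sum_nonneg)

lemma sum_mult_sq_le: "(\<Sum>i<n. x i * y i)\<^sup>2 \<le> sq_norm n x * sq_norm n y"
  unfolding sq_norm_def by (rule Cauchy_Schwarz_ineq_sum)

lemma sq_norm_power_le_trace:
  assumes sym: "symmetric_below n M"
  shows "sq_norm n ((mat_vec n M ^^ k) x) \<le> trace_power n M (2 * k) * sq_norm n x"
proof -
  have "sq_norm n ((mat_vec n M ^^ k) x) \<le>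
      (\<Sum>i<n. sq_norm n ((mat_vec n M ^^ k) (unit_fun i)) * sq_norm n x)"
    unfolding sq_norm_def[of n "(mat_vec n M ^^ k) x"]
  proof (rule sum_mono)
    fix i assume "i \<in> {..<n}"
    then show "((mat_vec n M ^^ k) x i)\<^sup>2 \<le> sq_norm n ((mat_vec n M ^^ k) (unit_fun i)) * sq_norm n x"
      using sum_mult_sq_le[where x = "(mat_vec n M ^^ k) (unit_fun i)" and y = x and n = n]
      by (simp add: mat_vec_power_entry[OF sym, symmetric])
  qed
  then show ?thesis by (simp add: trace_power_even[OF sym] sum_distrib_right)
qed

text \<open>The norms of the iterates of a symmetric matrix form a log-convex sequence: the square of each is the inner
product of its two neighbours, to which Cauchy-Schwarz applies. This replaces the spectral theorem
in comparing a quadratic form with the trace of a high power.\<close>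

lemma mat_vec_norms_log_convex:
  assumes sym: "symmetric_below n M"
  defines "A \<equiv> \<lambda>x j. sq_norm n ((mat_vec n M ^^ j) x)"
  shows "A x 1 * A x j \<le> A x 0 * A x (Suc j)"
proof (induction j)
  case (Suc j)
  have step: "(A x (Suc j))\<^sup>2 \<le> A x j * A x (Suc (Suc j))"
  proof -
    let ?u = "(mat_vec n M ^^ j) x"
    have "A x (Suc j) = (\<Sum>i<n. ?u i * mat_vec n M (mat_vec n M ?u) i)"
      by (simp add: A_def sq_norm_def power2_eq_square mat_vec_adjoint[OF sym, of ?u])
    then show ?thesis
      using sum_mult_sq_le[where x = ?u and y = "mat_vec n M (mat_vec n M ?u)" and n = n] by (simp add: A_def)
  qed
  have nn: "A x i \<ge> 0" for i by (simp add: A_def sq_norm_nonneg)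
  show ?case
  proof (cases "A x j = 0")
    case True
    then have "A x (Suc j) = 0" using step by simp
    then show ?thesis using nn by simp
  next
    case False
    then have pos: "A x j > 0" using nn[of j] by simp
    have "A x j * (A x 1 * A x (Suc j)) = (A x 1 * A x j) * A x (Suc j)" by simp
    also have "\<dots> \<le> (A x 0 * A x (Suc j)) * A x (Suc j)"
      using Suc nn by (intro mult_right_mono)
    also have "\<dots> = A x 0 * (A x (Suc j))\<^sup>2" by (simp add: power2_eq_square)
    also have "\<dots> \<le> A x 0 * (A x j * A x (Suc (Suc j)))"
      using step nn by (intro mult_left_mono)
    finally have "A x j * (A x 1 * A x (Suc j)) \<le> A x j * (A x 0 * A x (Suc (Suc j)))"
      by (simp add: mult_ac)
    then show ?thesis using pos by simp
  qed
qed simp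

lemma mat_vec_norm_power_le:
  assumes sym: "symmetric_below n M"
  shows "(sq_norm n (mat_vec n M x)) ^ Suc k \<le>
    sq_norm n x ^ k * sq_norm n ((mat_vec n M ^^ Suc k) x)"
proof (induction k)
  case (Suc k)
  let ?A = "\<lambda>j. sq_norm n ((mat_vec n M ^^ j) x)"
  have "(sq_norm n (mat_vec n M x)) ^ Suc (Suc k) \<le> ?A 1 * (?A 0 ^ k * ?A (Suc k))"
    using mult_left_mono[OF Suc sq_norm_nonneg[of n "mat_vec n M x"]] by simp
  also have "\<dots> = ?A 0 ^ k * (?A 1 * ?A (Suc k))" by simp
  also have "\<dots> \<le> ?A 0 ^ k * (?A 0 * ?A (Suc (Suc k)))"
    by (intro mult_left_mono mat_vec_norms_log_convex[OF sym]) (auto simp: sq_norm_nonneg)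
  finally show ?case by (simp add: mult_ac)
qed simp

lemma bilin_eq_mat_vec: "bilin n M x y = (\<Sum>i<n. x i * mat_vec n M y i)"
  by (simp add: bilin_def mat_vec_def sum_distrib_left mult_ac)

text \<open>In spectral terms, the \<open>2k\<close>-th power of an eigenvalue is at most the sum of the \<open>2k\<close>-th powers of all of them.\<close>

lemma quadratic_form_power_le_trace:
  assumes sym: "symmetric_below n M" and "k > 0"
  shows "(bilin n M x x) ^ (2 * k) \<le> trace_power n M (2 * k) * sq_norm n x ^ (2 * k)"
proof -
  obtain k' where k: "k = Suc k'" using \<open>k > 0\<close> by (cases k) auto
  let ?A = "\<lambda>j. sq_norm n ((mat_vec n M ^^ j) x)"
  have "(bilin n M x x) ^ (2 * k) = ((bilin n M x x)\<^sup>2) ^ k"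
    by (simp add: power_mult)
  also have "\<dots> \<le> (?A 0 * ?A 1) ^ k"
    using sum_mult_sq_le[where x = x and y = "mat_vec n M x" and n = n] by (intro power_mono) (simp_all add: bilin_eq_mat_vec)
  also have "\<dots> = ?A 0 ^ k * ?A 1 ^ k" by (simp add: power_mult_distrib)
  also have "\<dots> \<le> ?A 0 ^ k * (?A 0 ^ k' * ?A k)"
    using mat_vec_norm_power_le[OF sym, of x k'] unfolding k
    by (intro mult_left_mono) (auto simp: sq_norm_nonneg)
  also have "\<dots> \<le> ?A 0 ^ k * (?A 0 ^ k' * (trace_power n M (2 * k) * ?A 0))"
    using sq_norm_power_le_trace[OF sym, of k x]
    by (intro mult_left_mono) (auto simp: sq_norm_nonneg)
  also have "\<dots> = trace_power n M (2 * k) * sq_norm n x ^ (2 * k)"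
    unfolding k by (simp add: power_add mult_2 mult_2_right mult_ac)
  finally show ?thesis .
qed

lemma quadratic_form_bound_of_trace:
  assumes sym: "symmetric_below n M" and "k > 0"
    and tr: "trace_power n M (2 * k) \<le> B ^ (2 * k)" and "B \<ge> 0"
  shows "\<bar>bilin n M x x\<bar> \<le> B * sq_norm n x"
proof (rule power_le_imp_le_base)
  have "\<bar>bilin n M x x\<bar> ^ (2 * k) = (bilin n M x x) ^ (2 * k)" by (simp add: power_even_abs)
  also have "\<dots> \<le> trace_power n M (2 * k) * sq_norm n x ^ (2 * k)"
    by (rule quadratic_form_power_le_trace[OF sym \<open>k > 0\<close>])
  also have "\<dots> \<le> B ^ (2 * k) * sq_norm n x ^ (2 * k)"
    using tr by (intro mult_right_mono) (auto simp: sq_norm_nonneg)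
  finally show "\<bar>bilin n M x x\<bar> ^ Suc (2 * k - 1) \<le> (B * sq_norm n x) ^ Suc (2 * k - 1)"
    using \<open>k > 0\<close> by (simp add: power_mult_distrib)
qed (use \<open>B \<ge> 0\<close> in \<open>auto simp: sq_norm_nonneg\<close>)

lemma trace_power_le_of_mat_vec_bound:
  assumes sym: "symmetric_below n M"
    and bnd: "\<And>x. sq_norm n (mat_vec n M x) \<le> S\<^sup>2 * sq_norm n x"
  shows "trace_power n M (2 * k) \<le> real n * S ^ (2 * k)"
proof -
  have p: "sq_norm n ((mat_vec n M ^^ k) x) \<le> S ^ (2 * k) * sq_norm n x" for x
  proof (induction k)
    case (Suc k)
    have "sq_norm n ((mat_vec n M ^^ Suc k) x) \<le> S\<^sup>2 * sq_norm n ((mat_vec n M ^^ k) x)"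
      by (simp add: bnd)
    also have "\<dots> \<le> S\<^sup>2 * (S ^ (2 * k) * sq_norm n x)"
      using Suc by (intro mult_left_mono) auto
    finally show ?case by (simp add: power2_eq_square mult_ac)
  qed simp
  have "trace_power n M (2 * k) \<le> (\<Sum>i<n. S ^ (2 * k))"
    unfolding trace_power_even[OF sym, of k]
  proof (rule sum_mono)
    fix i assume "i \<in> {..<n}"
    then have "sq_norm n (unit_fun i) = 1"
      using sum_unit_fun[of i n "unit_fun i"] by (simp add: sq_norm_def power2_eq_square unit_fun_def)
    then show "sq_norm n ((mat_vec n M ^^ k) (unit_fun i)) \<le> S ^ (2 * k)"
      using p[of "unit_fun i"] by simp
  qed
  then show ?thesis by simp
qed


section \<open>Closed walks and their patterns\<close>

definition walks :: "nat \<Rightarrow> nat \<Rightarrow> nat list set" where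
  "walks n m = {xs. set xs \<subseteq> {..<n} \<and> length xs = m}"

definition walk_weight :: "(nat \<Rightarrow> nat \<Rightarrow> real) \<Rightarrow> nat list \<Rightarrow> real" where
  "walk_weight M xs = (\<Prod>l<length xs - 1. M (xs ! l) (xs ! Suc l))"

lemma finite_walks [simp]: "finite (walks n m)"
  unfolding walks_def by (rule finite_lists_length_eq) simp

lemma walk_weight_Cons: "walk_weight M (i # j # xs) = M i j * walk_weight M (j # xs)"
  by (simp add: walk_weight_def prod.lessThan_Suc_shift del: prod.lessThan_Suc)

lemma sum_walks_Suc: "(\<Sum>xs\<in>walks n (Suc m). f xs) = (\<Sum>i<n. \<Sum>xs\<in>walks n m. f (i # xs))"
proof -
  have "walks n (Suc m) = (\<lambda>(i, xs). i # xs) ` ({..<n} \<times> walks n m)"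
    by (auto simp: walks_def length_Suc_conv image_iff)
  moreover have "inj_on (\<lambda>(i, xs). i # xs) ({..<n} \<times> walks n m)"
    by (auto simp: inj_on_def)
  ultimately have "(\<Sum>xs\<in>walks n (Suc m). f xs) = (\<Sum>(i, xs)\<in>{..<n} \<times> walks n m. f (i # xs))"
    by (simp only: sum.reindex) (simp add: case_prod_unfold)
  then show ?thesis by (simp add: sum.cartesian_product)
qed

lemma walks_0: "walks n 0 = {[]}"
  by (auto simp: walks_def)

lemma mat_vec_power_walks:
  "(mat_vec n M ^^ m) x i = (\<Sum>xs\<in>walks n m. walk_weight M (i # xs) * x (last (i # xs)))"
proof (induction m arbitrary: i)
  case 0
  then show ?case by (simp add: walks_0 walk_weight_def)
next
  case (Suc m)
  have "(mat_vec n M ^^ Suc m) x i =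
      (\<Sum>k<n. M i k * (\<Sum>xs\<in>walks n m. walk_weight M (k # xs) * x (last (k # xs))))"
    by (simp add: mat_vec_def[of n M "(mat_vec n M ^^ m) x"] Suc)
  also have "\<dots> = (\<Sum>xs\<in>walks n (Suc m). walk_weight M (i # xs) * x (last (i # xs)))"
    unfolding sum_walks_Suc by (simp add: sum_distrib_left walk_weight_Cons mult_ac)
  finally show ?case .
qed

text \<open>A closed walk of \<open>m\<close> steps is a list of \<open>m + 1\<close> vertices that ends where it begins.\<close>

lemma trace_power_walks:
  "trace_power n M m = (\<Sum>xs\<in>walks n (Suc m). if last xs = hd xs then walk_weight M xs else 0)"
  unfolding trace_power_def mat_vec_power_walks sum_walks_Suc
  by (intro sum.cong refl) (simp add: unit_fun_def)

text \<open>A walk up to renaming of its vertices: each vertex is replaced by the position of its first visit. Two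
walks have the same pattern exactly if an injective renaming maps one to the other.\<close>

definition pattern :: "nat list \<Rightarrow> nat list" where
  "pattern xs = map (\<lambda>x. LEAST i. i < length xs \<and> xs ! i = x) xs"

lemma pattern_map:
  assumes "inj_on \<sigma> (set xs)"
  shows "pattern (map \<sigma> xs) = pattern xs"
proof -
  have "(LEAST i. i < length xs \<and> map \<sigma> xs ! i = \<sigma> x) = (LEAST i. i < length xs \<and> xs ! i = x)"
    if "x \<in> set xs" for x
    using that assms by (intro arg_cong[of _ _ Least] ext) (auto simp: inj_on_eq_iff)
  then show ?thesis by (simp add: pattern_def)
qed

lemma first_index:
  assumes "x \<in> set xs"
  shows "(LEAST i. i < length xs \<and> xs ! i = x) < length xs"
    and "xs ! (LEAST i. i < length xs \<and> xs ! i = x) = x"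
proof -
  obtain i where "i < length xs \<and> xs ! i = x" using assms by (auto simp: in_set_conv_nth)
  from LeastI[of "\<lambda>i. i < length xs \<and> xs ! i = x", OF this]
  show "(LEAST i. i < length xs \<and> xs ! i = x) < length xs"
    and "xs ! (LEAST i. i < length xs \<and> xs ! i = x) = x" by auto
qed

lemma map_nth_pattern: "map (\<lambda>i. xs ! i) (pattern xs) = xs"
  by (simp add: pattern_def first_index map_idI)

lemma inj_on_nth_pattern: "inj_on (\<lambda>i. xs ! i) (set (pattern xs))"
  by (auto simp: inj_on_def pattern_def first_index)

lemma length_pattern [simp]: "length (pattern xs) = length xs"
  by (simp add: pattern_def)

lemma pattern_pattern: "pattern (pattern xs) = pattern xs"
  using pattern_map[OF inj_on_nth_pattern[of xs]] by (simp add: map_nth_pattern)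

lemma pattern_in_walks: "pattern xs \<in> walks (length xs) (length xs)"
  by (auto simp: walks_def pattern_def first_index)

definition patterns :: "nat \<Rightarrow> nat list set" where
  "patterns m = {c \<in> walks m m. pattern c = c}"

text \<open>The walks of pattern \<open>c\<close> correspond to the injections of the vertices of \<open>c\<close> into the vertex set. The falling
factorial is formed with truncated subtraction, so it vanishes when there are too few vertices.\<close>

lemma pattern_class_card:
  assumes "pattern c = c" "length c = m"
  shows "real (card {xs \<in> walks n m. pattern xs = c}) = real (\<Prod>l<card (set c). n - l)"
proof -
  let ?F = "{\<sigma> \<in> set c \<rightarrow>\<^sub>E {..<n}. inj_on \<sigma> (set c)}"
  have "{xs \<in> walks n m. pattern xs = c} = (\<lambda>\<sigma>. map \<sigma> c) ` ?F"
  proof (intro equalityI subsetI)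
    fix xs assume "xs \<in> {xs \<in> walks n m. pattern xs = c}"
    then have xs: "set xs \<subseteq> {..<n}" "length xs = m" "pattern xs = c" by (auto simp: walks_def)
    let ?s = "restrict (\<lambda>i. xs ! i) (set c)"
    have "xs = map ?s c" using map_nth_pattern[of xs] xs(3) by (simp cong: map_cong)
    moreover have "?s \<in> set c \<rightarrow>\<^sub>E {..<n}"
    proof (intro restrict_PiE_iff[THEN iffD2] ballI)
      fix i assume "i \<in> set c"
      then have "i < length xs" using pattern_in_walks[of xs] xs(3) by (auto simp: walks_def)
      then show "xs ! i \<in> {..<n}" using xs(1) nth_mem by blast
    qed
    moreover have "inj_on ?s (set c)"
      using inj_on_nth_pattern[of xs] xs(3) by (simp add: inj_on_def)
    ultimately show "xs \<in> (\<lambda>\<sigma>. map \<sigma> c) ` ?F" by blast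
  next
    fix xs assume "xs \<in> (\<lambda>\<sigma>. map \<sigma> c) ` ?F"
    then show "xs \<in> {xs \<in> walks n m. pattern xs = c}"
      using assms by (auto simp: walks_def pattern_map PiE_def Pi_def)
  qed
  moreover have "inj_on (\<lambda>\<sigma>. map \<sigma> c) ?F"
    by (rule inj_onI, rule PiE_ext[of _ "set c" "\<lambda>_. {..<n}"]) auto
  moreover have "card ?F = (\<Prod>l<card (set c). n - l)"
    using card_inj_on_subset_funcset[of "set c" "{..<n}" "set c"] by (simp add: atLeast0LessThan)
  ultimately show ?thesis by (simp add: card_image)
qed

text \<open>The dimension \<open>n\<close> enters the right side only through falling factorials, over an index set of patterns
that does not depend on \<open>n\<close>. This is what allows matrices of different dimensions to be compared.\<close>

lemma sum_walks_by_pattern: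
  fixes g :: "nat list \<Rightarrow> real"
  assumes inv: "\<And>xs. length xs = m \<Longrightarrow> g (pattern xs) = g xs"
  shows "(\<Sum>xs\<in>walks n m. g xs) = (\<Sum>c\<in>patterns m. real (\<Prod>l<card (set c). n - l) * g c)"
proof -
  have "(\<Sum>xs\<in>walks n m. g xs) = (\<Sum>c\<in>patterns m. \<Sum>xs\<in>{xs \<in> walks n m. pattern xs = c}. g xs)"
  proof (rule sum.group[symmetric])
    show "pattern ` walks n m \<subseteq> patterns m"
      using pattern_in_walks by (auto simp: patterns_def pattern_pattern walks_def)
  qed (auto simp: patterns_def)
  also have "\<dots> = (\<Sum>c\<in>patterns m. real (\<Prod>l<card (set c). n - l) * g c)"
  proof (intro sum.cong refl)
    fix c assume "c \<in> patterns m"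
    then have c: "pattern c = c" "length c = m" by (auto simp: patterns_def walks_def)
    have "(\<Sum>xs\<in>{xs \<in> walks n m. pattern xs = c}. g xs) = (\<Sum>xs\<in>{xs \<in> walks n m. pattern xs = c}. g c)"
      using inv by (intro sum.cong refl) (auto simp: walks_def)
    then show "(\<Sum>xs\<in>{xs \<in> walks n m. pattern xs = c}. g xs) = real (\<Prod>l<card (set c). n - l) * g c"
      using pattern_class_card[OF c, of n] by simp
  qed
  finally show ?thesis .
qed

text \<open>These are the walks that survive in the expected trace: closed, without loops, and traversing each edge, in
either direction, at least twice. A centred edge weight that occurs only once has expectation zero.\<close>

definition good_walk :: "nat list \<Rightarrow> bool" where
  "good_walk xs \<longleftrightarrow> last xs = hd xs \<and> (\<forall>l<length xs - 1. xs ! l \<noteq> xs ! Suc l \<and>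
     (\<exists>l'<length xs - 1. l' \<noteq> l \<and> {xs ! l', xs ! Suc l'} = {xs ! l, xs ! Suc l}))"

lemma good_walk_map:
  assumes "inj_on \<sigma> (set xs)" "xs \<noteq> []"
  shows "good_walk (map \<sigma> xs) \<longleftrightarrow> good_walk xs"
proof -
  have eq: "\<sigma> x = \<sigma> y \<longleftrightarrow> x = y" if "x \<in> set xs" "y \<in> set xs" for x y
    using assms(1) that by (simp add: inj_on_eq_iff)
  have i: "l < length xs" "Suc l < length xs" if "l < length xs - 1" for l using that by auto
  have "{map \<sigma> xs ! l', map \<sigma> xs ! Suc l'} = {map \<sigma> xs ! l, map \<sigma> xs ! Suc l} \<longleftrightarrow>
      {xs ! l', xs ! Suc l'} = {xs ! l, xs ! Suc l}" if "l < length xs - 1" "l' < length xs - 1" for l l'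
    using i[OF that(1)] i[OF that(2)] by (simp add: doubleton_eq_iff eq)
  moreover have "map \<sigma> xs ! l = map \<sigma> xs ! Suc l \<longleftrightarrow> xs ! l = xs ! Suc l" if "l < length xs - 1" for l
    using i[OF that] by (simp add: eq)
  moreover have "last (map \<sigma> xs) = hd (map \<sigma> xs) \<longleftrightarrow> last xs = hd xs"
    using assms(2) by (simp add: last_map hd_map eq)
  ultimately show ?thesis by (simp add: good_walk_def cong: conj_cong) 
qed

lemma good_walk_pattern: "xs \<noteq> [] \<Longrightarrow> good_walk (pattern xs) \<longleftrightarrow> good_walk xs"
  using good_walk_map[OF inj_on_nth_pattern[of xs]] map_nth_pattern[of xs]
  by (metis length_0_conv length_pattern)

lemma card_set_pattern: "card (set (pattern xs)) = card (set xs)"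
proof -
  have "set xs = (\<lambda>i. xs ! i) ` set (pattern xs)"
    using arg_cong[OF map_nth_pattern[of xs], of set] by simp
  then show ?thesis using card_image[OF inj_on_nth_pattern[of xs]] by simp
qed

definition walk_edges :: "nat list \<Rightarrow> nat set set" where
  "walk_edges xs = (\<lambda>l. {xs ! l, xs ! Suc l}) ` {..<length xs - 1}"

text \<open>A walk is connected: each new vertex is reached along a new edge.\<close>

lemma card_vertices_le_edges:
  assumes "xs \<noteq> []"
  shows "card (set xs) \<le> Suc (card (walk_edges xs))"
proof -
  have "card ((\<lambda>l. xs ! l) ` {..j}) \<le> Suc (card ((\<lambda>l. {xs ! l, xs ! Suc l}) ` {..<j}))" for j
  proof (induction j)
    case (Suc j)
    let ?V = "(\<lambda>l. xs ! l) ` {..j}" and ?E = "(\<lambda>l. {xs ! l, xs ! Suc l}) ` {..<j}"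
    have V: "(\<lambda>l. xs ! l) ` {..Suc j} = insert (xs ! Suc j) ?V" by (auto simp: atMost_Suc)
    have E: "(\<lambda>l. {xs ! l, xs ! Suc l}) ` {..<Suc j} = insert {xs ! j, xs ! Suc j} ?E"
      by (auto simp: lessThan_Suc)
    show ?case
    proof (cases "xs ! Suc j \<in> ?V")
      case True
      then show ?thesis unfolding V E using Suc
        by (simp add: insert_absorb card_insert_if)
    next
      case False
      then have "{xs ! j, xs ! Suc j} \<notin> ?E"
        by (auto simp: doubleton_eq_iff)
      then show ?thesis unfolding V E using Suc False by simp
    qed
  qed simp
  from this[of "length xs - 1"] show ?thesis
  proof -
    assume *: "card ((\<lambda>l. xs ! l) ` {..length xs - 1}) \<le> Suc (card ((\<lambda>l. {xs ! l, xs ! Suc l}) ` {..<length xs - 1}))"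
    have "{..length xs - 1} = {..<length xs}" using assms by (cases xs) auto
    then have "(\<lambda>l. xs ! l) ` {..length xs - 1} = set xs"
      by (auto simp: set_conv_nth)
    then show ?thesis using * by (simp add: walk_edges_def)
  qed
qed

lemma good_walk_edges:
  assumes "good_walk xs" "length xs = Suc m"
  shows "2 * card (walk_edges xs) \<le> m"
proof -
  let ?e = "\<lambda>l. {xs ! l, xs ! Suc l}"
  have fin: "finite (walk_edges xs)" by (simp add: walk_edges_def)
  have "2 * card (walk_edges xs) = (\<Sum>e\<in>walk_edges xs. 2)" by simp
  also have "\<dots> \<le> (\<Sum>e\<in>walk_edges xs. card {l \<in> {..<m}. ?e l = e})"
  proof (rule sum_mono)
    fix e assume "e \<in> walk_edges xs"
    then obtain l where l: "l < m" "e = ?e l" using assms(2) by (auto simp: walk_edges_def)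
    then obtain l' where l': "l' < m" "l' \<noteq> l" "?e l' = ?e l"
      using assms by (auto simp: good_walk_def)
    have "card {l, l'} \<le> card {l \<in> {..<m}. ?e l = e}"
      using l l' by (intro card_mono) auto
    then show "2 \<le> card {l \<in> {..<m}. ?e l = e}" using l' by simp
  qed
  also have "\<dots> = (\<Sum>e\<in>walk_edges xs. \<Sum>l\<in>{l \<in> {..<m}. ?e l = e}. 1)" by simp
  also have "\<dots> = (\<Sum>l\<in>{..<m}. 1)"
    using assms(2) by (intro sum.group fin) (auto simp: walk_edges_def)
  finally show ?thesis by simp
qed


section \<open>Comparison of trace moments\<close>

text \<open>Edges are increasing pairs, as in \<open>vertex_pairs\<close>, so a function on pairs determines a symmetric matrix with
zero diagonal.\<close>

definition sym_entry :: "(nat \<times> nat \<Rightarrow> real) \<Rightarrow> nat \<Rightarrow> nat \<Rightarrow> real" where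
  "sym_entry w i j = (if i = j then 0 else w (min i j, max i j))"

lemma symmetric_sym_entry: "symmetric_below n (sym_entry w)"
  by (auto simp: symmetric_below_def sym_entry_def min.commute max.commute)

lemma finite_vertex_pairs [simp]: "finite (vertex_pairs n)"
  by (rule finite_subset[of _ "{..<n} \<times> {..<n}"]) (auto simp: vertex_pairs_def)

lemma finite_set_Pi_pmf:
  assumes "finite A" "finite (set_pmf \<mu>)"
  shows "finite (set_pmf (Pi_pmf A d (\<lambda>_. \<mu>)))"
  using assms by (simp add: set_Pi_pmf finite_PiE_dflt)

text \<open>The factors may change sign, so the product rule is taken from independence and not from a rule for
nonnegative factors.\<close>

lemma expectation_prod_iid:
  fixes f :: "'a \<Rightarrow> real \<Rightarrow> real"
  assumes "finite A" "finite (set_pmf \<mu>)"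
  shows "measure_pmf.expectation (Pi_pmf A d (\<lambda>_. \<mu>)) (\<lambda>w. \<Prod>e\<in>A. f e (w e)) =
    (\<Prod>e\<in>A. measure_pmf.expectation \<mu> (f e))"
proof -
  let ?P = "Pi_pmf A d (\<lambda>_. \<mu>)"
  have "prob_space.indep_vars (measure_pmf ?P) (\<lambda>_. borel) (\<lambda>e w. f e (w e)) A"
    by (rule prob_space.indep_vars_compose2[OF measure_pmf.prob_space_axioms indep_vars_Pi_pmf])
       (use assms in auto)
  then have "measure_pmf.expectation ?P (\<lambda>w. \<Prod>e\<in>A. f e (w e)) =
      (\<Prod>e\<in>A. measure_pmf.expectation ?P (\<lambda>w. f e (w e)))"
    by (intro prob_space.indep_vars_lebesgue_integral)
       (use assms in \<open>auto intro!: integrable_measure_pmf_finite finite_set_Pi_pmf measure_pmf.prob_space_axioms\<close>)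
  also have "\<dots> = (\<Prod>e\<in>A. measure_pmf.expectation \<mu> (f e))"
  proof (intro prod.cong refl)
    fix e assume "e \<in> A"
    then have "\<mu> = map_pmf (\<lambda>w. w e) ?P" using assms by (simp add: Pi_pmf_component)
    then have "measure_pmf.expectation \<mu> (f e) = measure_pmf.expectation (map_pmf (\<lambda>w. w e) ?P) (f e)"
      by simp
    then show "measure_pmf.expectation ?P (\<lambda>w. f e (w e)) = measure_pmf.expectation \<mu> (f e)"
      by simp
  qed
  finally show ?thesis .
qed

definition pair_edge :: "nat list \<Rightarrow> nat \<Rightarrow> nat \<times> nat" where
  "pair_edge xs l = (min (xs ! l) (xs ! Suc l), max (xs ! l) (xs ! Suc l))"

text \<open>The exponent of the weight of edge \<open>e\<close> in the weight of the walk.\<close>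

definition traversals :: "nat list \<Rightarrow> nat \<times> nat \<Rightarrow> nat" where
  "traversals xs e = card {l \<in> {..<length xs - 1}. pair_edge xs l = e}"

definition loop_free :: "nat list \<Rightarrow> bool" where
  "loop_free xs \<longleftrightarrow> (\<forall>l<length xs - 1. xs ! l \<noteq> xs ! Suc l)"

lemma pair_edge_eq_iff:
  "pair_edge xs l = pair_edge xs l' \<longleftrightarrow> {xs ! l, xs ! Suc l} = {xs ! l', xs ! Suc l'}"
  by (auto simp: pair_edge_def doubleton_eq_iff min_def max_def split: if_splits)

lemma pair_edge_in_vertex_pairs:
  assumes "xs \<in> walks n (Suc m)" "loop_free xs" "l < m"
  shows "pair_edge xs l \<in> vertex_pairs n"
proof -
  have "xs ! l \<in> set xs" "xs ! Suc l \<in> set xs" "xs ! l \<noteq> xs ! Suc l"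
    using assms by (auto simp: walks_def loop_free_def)
  then show ?thesis
    using assms(1) by (auto simp: walks_def pair_edge_def vertex_pairs_def min_def max_def)
qed

lemma walk_weight_sym_entry:
  assumes "xs \<in> walks n (Suc m)" "loop_free xs"
  shows "walk_weight (sym_entry w) xs = (\<Prod>e\<in>vertex_pairs n. w e ^ traversals xs e)"
proof -
  have L: "length xs = Suc m" using assms by (simp add: walks_def)
  have "walk_weight (sym_entry w) xs = (\<Prod>l\<in>{..<m}. w (pair_edge xs l))"
    unfolding walk_weight_def L diff_Suc_1 using assms(2)
    by (intro prod.cong refl) (auto simp: sym_entry_def pair_edge_def loop_free_def L)
  also have "\<dots> = (\<Prod>e\<in>vertex_pairs n. \<Prod>l\<in>{l \<in> {..<m}. pair_edge xs l = e}. w (pair_edge xs l))"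
    by (rule prod.group[symmetric]) (use pair_edge_in_vertex_pairs[OF assms] in auto)
  also have "\<dots> = (\<Prod>e\<in>vertex_pairs n. w e ^ traversals xs e)"
    by (intro prod.cong refl) (simp add: traversals_def L)
  finally show ?thesis .
qed

lemma walk_weight_loop: "\<not> loop_free xs \<Longrightarrow> walk_weight (sym_entry w) xs = 0"
  unfolding walk_weight_def loop_free_def by (auto simp: sym_entry_def intro!: prod_zero)

lemma sum_traversals:
  assumes "xs \<in> walks n (Suc m)" "loop_free xs"
  shows "(\<Sum>e\<in>vertex_pairs n. traversals xs e) = m"
proof -
  have L: "length xs = Suc m" using assms by (simp add: walks_def)
  have "(\<Sum>e\<in>vertex_pairs n. \<Sum>l\<in>{l \<in> {..<m}. pair_edge xs l = e}. 1) = (\<Sum>l\<in>{..<m}. 1::nat)"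
    by (rule sum.group) (use pair_edge_in_vertex_pairs[OF assms] in auto)
  then show ?thesis by (simp add: traversals_def L)
qed

lemma good_walk_iff_traversals:
  assumes "xs \<in> walks n (Suc m)" "loop_free xs" "last xs = hd xs"
  shows "good_walk xs \<longleftrightarrow> (\<forall>e\<in>vertex_pairs n. traversals xs e \<noteq> 1)"
proof -
  have L: "length xs = Suc m" using assms by (simp add: walks_def)
  have gw: "good_walk xs \<longleftrightarrow> (\<forall>l<m. \<exists>l'<m. l' \<noteq> l \<and> pair_edge xs l' = pair_edge xs l)"
    using assms by (auto simp: good_walk_def L loop_free_def pair_edge_eq_iff)
  show ?thesis
  proof
    assume g: "good_walk xs"
    show "\<forall>e\<in>vertex_pairs n. traversals xs e \<noteq> 1"
    proof (intro ballI notI)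
      fix e assume "traversals xs e = 1"
      then obtain l where l: "{l \<in> {..<m}. pair_edge xs l = e} = {l}"
        unfolding traversals_def L diff_Suc_1 by (auto simp: card_1_singleton_iff)
      then have "l < m" "pair_edge xs l = e" by auto
      then obtain l' where "l' < m" "l' \<noteq> l" "pair_edge xs l' = e" using g gw by auto
      then show False using l by auto
    qed
  next
    assume t: "\<forall>e\<in>vertex_pairs n. traversals xs e \<noteq> 1"
    show "good_walk xs" unfolding gw
    proof (intro allI impI)
      fix l assume l: "l < m"
      have "{k \<in> {..<m}. pair_edge xs k = pair_edge xs l} \<noteq> {l}"
        using t pair_edge_in_vertex_pairs[OF assms(1,2) l] by (auto simp: traversals_def L)
      then show "\<exists>l'<m. l' \<noteq> l \<and> pair_edge xs l' = pair_edge xs l" using l by blast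
    qed
  qed
qed

lemma card_walk_edges_le:
  assumes "xs \<in> walks n (Suc m)" "loop_free xs"
  shows "card (walk_edges xs) \<le> card {e \<in> vertex_pairs n. traversals xs e \<noteq> 0}"
proof -
  have L: "length xs = Suc m" using assms by (simp add: walks_def)
  have "walk_edges xs = (\<lambda>(i, j). {i, j}) ` pair_edge xs ` {..<m}"
    unfolding walk_edges_def L diff_Suc_1 image_image
    by (intro image_cong refl) (auto simp: pair_edge_def min_def max_def)
  then have "card (walk_edges xs) \<le> card (pair_edge xs ` {..<m})"
    by (simp add: card_image_le)
  also have "\<dots> \<le> card {e \<in> vertex_pairs n. traversals xs e \<noteq> 0}"
    using pair_edge_in_vertex_pairs[OF assms] by (intro card_mono) (auto simp: traversals_def L)
  finally show ?thesis .
qed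

lemma expectation_walk_weight:
  assumes "finite (set_pmf \<mu>)" "xs \<in> walks n (Suc m)" "loop_free xs"
  shows "measure_pmf.expectation (Pi_pmf (vertex_pairs n) d (\<lambda>_. \<mu>)) (\<lambda>w. walk_weight (sym_entry w) xs) =
    (\<Prod>e\<in>vertex_pairs n. measure_pmf.expectation \<mu> (\<lambda>v. v ^ traversals xs e))"
  unfolding walk_weight_sym_entry[OF assms(2,3)]
  by (rule expectation_prod_iid) (simp_all add: assms)

text \<open>Each of the distinct edges of a good walk contributes one factor \<open>p\<close>, and a walk with \<open>v\<close> vertices has at
least \<open>v - 1\<close> distinct edges; the powers of two multiply to \<open>2\<^sup>m\<close> over the \<open>m\<close> steps.\<close>

lemma expectation_walk_weight_upper:
  assumes fin: "finite (set_pmf \<mu>)" and xs: "xs \<in> walks n (Suc m)" and closed: "last xs = hd xs"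
    and mean: "measure_pmf.expectation \<mu> (\<lambda>v. v) = 0"
    and mom: "\<And>j. j \<ge> 2 \<Longrightarrow> \<bar>measure_pmf.expectation \<mu> (\<lambda>v. v ^ j)\<bar> \<le> 2 ^ j * p"
    and p: "0 \<le> p" "p \<le> 1"
  shows "measure_pmf.expectation (Pi_pmf (vertex_pairs n) d (\<lambda>_. \<mu>)) (\<lambda>w. walk_weight (sym_entry w) xs)
    \<le> (if good_walk xs then 2 ^ m * p ^ (card (set xs) - 1) else 0)"
proof (cases "loop_free xs")
  case False
  then show ?thesis using p by (simp add: walk_weight_loop)
next
  case lf: True
  let ?M = "\<lambda>j. measure_pmf.expectation \<mu> (\<lambda>v. v ^ j)"
  note E = expectation_walk_weight[OF fin xs lf, of d]
  show ?thesis
  proof (cases "good_walk xs")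
    case False
    then obtain e where "e \<in> vertex_pairs n" "traversals xs e = 1"
      using good_walk_iff_traversals[OF xs lf closed] by blast
    then have zero: "(\<Prod>e\<in>vertex_pairs n. ?M (traversals xs e)) = 0"
      using mean by (auto intro!: prod_zero bexI[of _ e])
    show ?thesis unfolding E zero using False by simp
  next
    case True
    have t: "traversals xs e = 0 \<or> traversals xs e \<ge> 2" if "e \<in> vertex_pairs n" for e
      using good_walk_iff_traversals[OF xs lf closed] True that by (auto simp: numeral_2_eq_2 Suc_le_eq)
    have "(\<Prod>e\<in>vertex_pairs n. ?M (traversals xs e)) \<le> (\<Prod>e\<in>vertex_pairs n. \<bar>?M (traversals xs e)\<bar>)"
      using abs_ge_self[of "\<Prod>e\<in>vertex_pairs n. ?M (traversals xs e)"] by (simp only: abs_prod)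
    also have "\<dots> \<le> (\<Prod>e\<in>vertex_pairs n. 2 ^ traversals xs e * (if traversals xs e = 0 then 1 else p))"
      using t mom by (intro prod_mono) (auto dest!: t)
    also have "\<dots> = 2 ^ m * p ^ card {e \<in> vertex_pairs n. traversals xs e \<noteq> 0}"
      by (simp add: prod.distrib power_sum[symmetric] sum_traversals[OF xs lf] prod.If_cases
            Collect_neg_eq[symmetric] Int_def conj_commute)
    also have "\<dots> \<le> 2 ^ m * p ^ (card (set xs) - 1)"
    proof -
      have "xs \<noteq> []" using xs by (auto simp: walks_def)
      then have "card (set xs) - 1 \<le> card {e \<in> vertex_pairs n. traversals xs e \<noteq> 0}"
        using card_vertices_le_edges[of xs] card_walk_edges_le[OF xs lf] by linarith
      then show ?thesis using p by (intro mult_left_mono power_decreasing) auto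
    qed
    finally show ?thesis unfolding E using True by simp
  qed
qed

lemma expectation_walk_weight_lower:
  assumes fin: "finite (set_pmf \<mu>)" and xs: "xs \<in> walks n (Suc m)" and closed: "last xs = hd xs"
    and mean: "measure_pmf.expectation \<mu> (\<lambda>v. v) = 0"
    and mom: "\<And>j. j \<ge> 2 \<Longrightarrow> measure_pmf.expectation \<mu> (\<lambda>v. v ^ j) \<ge> 1"
  shows "measure_pmf.expectation (Pi_pmf (vertex_pairs n) d (\<lambda>_. \<mu>)) (\<lambda>w. walk_weight (sym_entry w) xs)
    \<ge> (if good_walk xs then 1 else 0)"
proof (cases "loop_free xs")
  case False
  then have "\<not> good_walk xs" by (auto simp: good_walk_def loop_free_def)
  then show ?thesis using False by (simp add: walk_weight_loop)
next
  case lf: True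
  note E = expectation_walk_weight[OF fin xs lf, of d]
  show ?thesis
  proof (cases "good_walk xs")
    case False
    then obtain e where "e \<in> vertex_pairs n" "traversals xs e = 1"
      using good_walk_iff_traversals[OF xs lf closed] by blast
    then have zero: "(\<Prod>e\<in>vertex_pairs n. measure_pmf.expectation \<mu> (\<lambda>v. v ^ traversals xs e)) = 0"
      using mean by (auto intro!: prod_zero bexI[of _ e])
    show ?thesis unfolding E zero using False by simp
  next
    case True
    have t: "traversals xs e = 0 \<or> traversals xs e \<ge> 2" if "e \<in> vertex_pairs n" for e
      using good_walk_iff_traversals[OF xs lf closed] True that by (auto simp: numeral_2_eq_2 Suc_le_eq)
    have "1 \<le> (\<Prod>e\<in>vertex_pairs n. measure_pmf.expectation \<mu> (\<lambda>v. v ^ traversals xs e))"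
    proof (rule prod_ge_1)
      fix e assume "e \<in> vertex_pairs n"
      then show "1 \<le> measure_pmf.expectation \<mu> (\<lambda>v. v ^ traversals xs e)"
        using t[of e] mom[of "traversals xs e"] by auto
    qed
    then show ?thesis unfolding E using True by simp
  qed
qed

lemma expectation_trace_power:
  assumes "finite (set_pmf \<mu>)"
  shows "measure_pmf.expectation (Pi_pmf (vertex_pairs n) d (\<lambda>_. \<mu>)) (\<lambda>w. trace_power n (sym_entry w) m) =
    (\<Sum>xs\<in>walks n (Suc m). if last xs = hd xs then
       measure_pmf.expectation (Pi_pmf (vertex_pairs n) d (\<lambda>_. \<mu>)) (\<lambda>w. walk_weight (sym_entry w) xs) else 0)"
  unfolding trace_power_walks
  by (subst Bochner_Integration.integral_sum)
     (auto intro!: sum.cong integrable_measure_pmf_finite finite_set_Pi_pmf assms)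

text \<open>The falling factorial of \<open>n\<close> is at most \<open>n\<close> times \<open>n\<^sup>v\<^sup>-\<^sup>1\<close>, whereas every factor of that of \<open>d\<close> is at least
\<open>d - k \<ge> n p\<close>.\<close>

lemma falling_factorial_compare:
  fixes p :: real
  assumes d: "real n * p + real k \<le> real d" and v: "1 \<le> v" "v \<le> k + 1" and "p \<ge> 0"
  shows "real d * (real (\<Prod>l<v. n - l) * p ^ (v - 1)) \<le> real n * real (\<Prod>l<v. d - l)"
proof -
  obtain u where u: "v = Suc u" using v by (cases v) auto
  have "real (\<Prod>l<v. n - l) * p ^ (v - 1) = real n * ((\<Prod>l<u. real (n - Suc l)) * p ^ u)"
    unfolding u by (simp add: prod.lessThan_Suc_shift del: prod.lessThan_Suc)
  also have "\<dots> = real n * (\<Prod>l<u. real (n - Suc l) * p)"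
    by (simp add: prod.distrib)
  finally have 1: "real (\<Prod>l<v. n - l) * p ^ (v - 1) = real n * (\<Prod>l<u. real (n - Suc l) * p)" .
  have 2: "real (\<Prod>l<v. d - l) = real d * (\<Prod>l<u. real (d - Suc l))"
    unfolding u by (simp add: prod.lessThan_Suc_shift del: prod.lessThan_Suc)
  have "(\<Prod>l<u. real (n - Suc l) * p) \<le> (\<Prod>l<u. real (d - Suc l))"
  proof (rule prod_mono)
    fix l assume "l \<in> {..<u}"
    then have "Suc l \<le> k" using v u by auto
    then have "real d - real (Suc l) \<ge> real n * p" using d by linarith
    moreover have "real (n - Suc l) * p \<le> real n * p" using \<open>p \<ge> 0\<close> by (intro mult_right_mono) auto
    ultimately show "0 \<le> real (n - Suc l) * p \<and> real (n - Suc l) * p \<le> real (d - Suc l)"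
      using \<open>p \<ge> 0\<close> by auto
  qed
  then show ?thesis unfolding 1 2
    by (simp add: mult_left_mono mult.left_commute)
qed

text \<open>A sparse matrix of dimension \<open>n\<close>, whose nonzero entries occur at rate \<open>p\<close>, behaves like a dense one whose
dimension is the expected number \<open>n p\<close> of neighbours of a vertex, enlarged by \<open>k\<close> to accommodate the
walks. The moments of \<open>\<nu>\<close> have to be at least 1 for odd exponents too, since an edge may be traversed
three times; this rules out symmetric signs for \<open>\<nu>\<close>.\<close>

theorem trace_moment_comparison:
  assumes fin: "finite (set_pmf \<mu>)" "finite (set_pmf \<nu>)"
    and mean: "measure_pmf.expectation \<mu> (\<lambda>v. v) = 0" "measure_pmf.expectation \<nu> (\<lambda>v. v) = 0"
    and mom\<mu>: "\<And>j. j \<ge> 2 \<Longrightarrow> \<bar>measure_pmf.expectation \<mu> (\<lambda>v. v ^ j)\<bar> \<le> 2 ^ j * p"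
    and mom\<nu>: "\<And>j. j \<ge> 2 \<Longrightarrow> measure_pmf.expectation \<nu> (\<lambda>v. v ^ j) \<ge> 1"
    and p: "0 \<le> p" "p \<le> 1" and d: "real n * p + real k \<le> real d"
  shows "real d * measure_pmf.expectation (Pi_pmf (vertex_pairs n) a (\<lambda>_. \<mu>)) (\<lambda>w. trace_power n (sym_entry w) (2 * k))
    \<le> 4 ^ k * real n * measure_pmf.expectation (Pi_pmf (vertex_pairs d) b (\<lambda>_. \<nu>)) (\<lambda>w. trace_power d (sym_entry w) (2 * k))"
proof -
  let ?m = "Suc (2 * k)"
  let ?g = "\<lambda>xs. if good_walk xs then p ^ (card (set xs) - 1) else 0"
  have "measure_pmf.expectation (Pi_pmf (vertex_pairs n) a (\<lambda>_. \<mu>)) (\<lambda>w. trace_power n (sym_entry w) (2 * k))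
      \<le> (\<Sum>xs\<in>walks n ?m. 4 ^ k * ?g xs)"
    unfolding expectation_trace_power[OF fin(1)]
  proof (intro sum_mono)
    fix xs assume xs: "xs \<in> walks n ?m"
    show "(if last xs = hd xs then measure_pmf.expectation (Pi_pmf (vertex_pairs n) a (\<lambda>_. \<mu>))
        (\<lambda>w. walk_weight (sym_entry w) xs) else 0) \<le> 4 ^ k * ?g xs"
      using expectation_walk_weight_upper[OF fin(1) xs _ mean(1) mom\<mu> p, of a] p
      by (auto simp: power_mult)
  qed
  also have "\<dots> = 4 ^ k * (\<Sum>c\<in>patterns ?m. real (\<Prod>l<card (set c). n - l) * ?g c)"
  proof -
    have "(\<Sum>xs\<in>walks n ?m. ?g xs) = (\<Sum>c\<in>patterns ?m. real (\<Prod>l<card (set c). n - l) * ?g c)"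
    proof (rule sum_walks_by_pattern)
      fix xs :: "nat list" assume "length xs = ?m"
      then have "xs \<noteq> []" by auto
      then show "?g (pattern xs) = ?g xs" by (simp add: good_walk_pattern card_set_pattern)
    qed
    then show ?thesis by (simp only: sum_distrib_left[symmetric])
  qed
  finally have upper: "measure_pmf.expectation (Pi_pmf (vertex_pairs n) a (\<lambda>_. \<mu>)) (\<lambda>w. trace_power n (sym_entry w) (2 * k))
      \<le> 4 ^ k * (\<Sum>c\<in>patterns ?m. real (\<Prod>l<card (set c). n - l) * ?g c)" .
  have "(\<Sum>c\<in>patterns ?m. real (\<Prod>l<card (set c). d - l) * (if good_walk c then 1 else 0)) =
      (\<Sum>xs\<in>walks d ?m. if good_walk xs then 1 else 0)"
  proof (rule sum_walks_by_pattern[symmetric])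
    fix xs :: "nat list" assume "length xs = ?m"
    then have "xs \<noteq> []" by auto
    then show "(if good_walk (pattern xs) then 1 else 0) = (if good_walk xs then 1 else (0::real))"
      by (simp add: good_walk_pattern)
  qed
  also have "\<dots> \<le> measure_pmf.expectation (Pi_pmf (vertex_pairs d) b (\<lambda>_. \<nu>)) (\<lambda>w. trace_power d (sym_entry w) (2 * k))"
    unfolding expectation_trace_power[OF fin(2)]
  proof (intro sum_mono)
    fix xs assume xs: "xs \<in> walks d ?m"
    show "(if good_walk xs then 1 else 0) \<le> (if last xs = hd xs then
        measure_pmf.expectation (Pi_pmf (vertex_pairs d) b (\<lambda>_. \<nu>)) (\<lambda>w. walk_weight (sym_entry w) xs) else 0)"
      using expectation_walk_weight_lower[OF fin(2) xs _ mean(2) mom\<nu>, of b]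
      by (auto simp: good_walk_def)
  qed
  finally have lower: "(\<Sum>c\<in>patterns ?m. real (\<Prod>l<card (set c). d - l) * (if good_walk c then 1 else 0))
      \<le> measure_pmf.expectation (Pi_pmf (vertex_pairs d) b (\<lambda>_. \<nu>)) (\<lambda>w. trace_power d (sym_entry w) (2 * k))" .
  have "real d * (\<Sum>c\<in>patterns ?m. real (\<Prod>l<card (set c). n - l) * ?g c)
      \<le> real n * (\<Sum>c\<in>patterns ?m. real (\<Prod>l<card (set c). d - l) * (if good_walk c then 1 else 0))"
    unfolding sum_distrib_left
  proof (rule sum_mono)
    fix c assume "c \<in> patterns ?m"
    then have len: "length c = ?m" "c \<noteq> []" by (auto simp: patterns_def walks_def)
    have "1 \<le> card (set c)" using len by (simp add: Suc_le_eq card_gt_0_iff)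
    moreover have "card (set c) \<le> k + 1" if "good_walk c"
      using card_vertices_le_edges[OF len(2)] good_walk_edges[OF that len(1)] by simp
    ultimately show "real d * (real (\<Prod>l<card (set c). n - l) * ?g c)
        \<le> real n * (real (\<Prod>l<card (set c). d - l) * (if good_walk c then 1 else 0))"
      using falling_factorial_compare[OF d, of "card (set c)"] p by auto
  qed
  also have "\<dots> \<le> real n * measure_pmf.expectation (Pi_pmf (vertex_pairs d) b (\<lambda>_. \<nu>)) (\<lambda>w. trace_power d (sym_entry w) (2 * k))"
    using lower by (intro mult_left_mono) auto
  finally have cmp: "real d * (\<Sum>c\<in>patterns ?m. real (\<Prod>l<card (set c). n - l) * ?g c)
      \<le> real n * measure_pmf.expectation (Pi_pmf (vertex_pairs d) b (\<lambda>_. \<nu>)) (\<lambda>w. trace_power d (sym_entry w) (2 * k))" .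
  have "real d * measure_pmf.expectation (Pi_pmf (vertex_pairs n) a (\<lambda>_. \<mu>)) (\<lambda>w. trace_power n (sym_entry w) (2 * k))
      \<le> real d * (4 ^ k * (\<Sum>c\<in>patterns ?m. real (\<Prod>l<card (set c). n - l) * ?g c))"
    using upper by (intro mult_left_mono) auto
  also have "\<dots> = 4 ^ k * (real d * (\<Sum>c\<in>patterns ?m. real (\<Prod>l<card (set c). n - l) * ?g c))"
    by (simp only: mult.left_commute)
  also have "\<dots> \<le> 4 ^ k * (real n * measure_pmf.expectation (Pi_pmf (vertex_pairs d) b (\<lambda>_. \<nu>)) (\<lambda>w. trace_power d (sym_entry w) (2 * k)))"
    using cmp by (intro mult_left_mono) auto
  finally show ?thesis by (simp only: mult.assoc)
qed


section \<open>A lattice net of the unit ball\<close>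

text \<open>Lattice points in the ball of radius \<open>4 sqrt d\<close>. Scaled by \<open>1 / (4 sqrt d)\<close> they form a net of mesh \<open>1/4\<close> in the
unit ball. The bound on single coordinates only makes the ambient set finite.\<close>

definition lattice_net :: "nat \<Rightarrow> (nat \<Rightarrow> int) set" where
  "lattice_net d = {v \<in> {..<d} \<rightarrow>\<^sub>E {-16 * int d..16 * int d}. (\<Sum>i<d. (v i)\<^sup>2) \<le> 16 * int d}"

definition net_point :: "nat \<Rightarrow> (nat \<Rightarrow> int) \<Rightarrow> nat \<Rightarrow> real" where
  "net_point d v i = of_int (v i) / (4 * sqrt (real d))"

lemma finite_lattice_net [simp]: "finite (lattice_net d)"
  by (rule finite_subset[of _ "{..<d} \<rightarrow>\<^sub>E {-16 * int d..16 * int d}"])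
    (auto simp: lattice_net_def intro!: finite_PiE)

lemma sum_exp_neg_sq_le: "(\<Sum>a\<in>{-int N..int N}. exp (- (real_of_int a)\<^sup>2)) \<le> 3"
proof -
  have "(\<Sum>a\<in>{-int N..int N}. exp (- (real_of_int a)\<^sup>2)) \<le> 3 - 2 * (1 / 2) ^ N"
  proof (induction N)
    case (Suc N)
    have "{-int (Suc N)..int (Suc N)} = insert (- int (Suc N)) (insert (int (Suc N)) {-int N..int N})"
      by auto
    then have "(\<Sum>a\<in>{-int (Suc N)..int (Suc N)}. exp (- (real_of_int a)\<^sup>2)) =
        2 * exp (- (real (Suc N))\<^sup>2) + (\<Sum>a\<in>{-int N..int N}. exp (- (real_of_int a)\<^sup>2))"
      by (simp add: power2_commute[of _ "real N"] power2_eq_square algebra_simps)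
    moreover have "exp (- (real (Suc N))\<^sup>2) \<le> (1 / 2) ^ Suc N"
    proof -
      have "real (Suc N) \<le> (real (Suc N))\<^sup>2" by (simp add: power2_eq_square)
      then have "exp (- (real (Suc N))\<^sup>2) \<le> exp (- real (Suc N))" by simp
      also have "\<dots> = exp (-1) ^ Suc N" by (simp only: exp_of_nat_mult[symmetric]) simp
      also have "\<dots> \<le> (1 / 2) ^ Suc N"
        using exp_ge_add_one_self[of 1] by (intro power_mono) (auto simp: exp_minus field_simps)
      finally show ?thesis .
    qed
    ultimately show ?case using Suc by simp
  qed simp
  then show ?thesis by (rule order_trans) simp
qed

text \<open>Each point \<open>v\<close> of the net satisfies \<open>exp (16 d - |v|\<^sup>2) \<ge> 1\<close>, and the sum of the left sides over the whole box
factorises over the coordinates. This gives an exponential bound in \<open>d\<close> without volumes.\<close>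

lemma card_lattice_net: "real (card (lattice_net d)) \<le> (3 * exp 16) ^ d"
proof -
  let ?B = "{-16 * int d..16 * int d}"
  let ?g = "\<lambda>v. \<Prod>i<d. exp (- (real_of_int (v i))\<^sup>2)"
  have "real (card (lattice_net d)) = (\<Sum>v\<in>lattice_net d. 1)" by simp
  also have "\<dots> \<le> (\<Sum>v\<in>lattice_net d. exp (16 * real d) * ?g v)"
  proof (rule sum_mono)
    fix v assume "v \<in> lattice_net d"
    then have "(\<Sum>i<d. (v i)\<^sup>2) \<le> 16 * int d" by (simp add: lattice_net_def)
    then have "real_of_int (\<Sum>i<d. (v i)\<^sup>2) \<le> real_of_int (16 * int d)" by (simp only: of_int_le_iff)
    then have le: "(\<Sum>i<d. (real_of_int (v i))\<^sup>2) \<le> 16 * real d" by simp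
    have "?g v = exp (\<Sum>i<d. - (real_of_int (v i))\<^sup>2)" by (rule exp_sum[symmetric]) simp
    then have "exp (16 * real d) * ?g v = exp (16 * real d - (\<Sum>i<d. (real_of_int (v i))\<^sup>2))"
      by (simp only: mult_exp_exp sum_negf) simp
    then show "1 \<le> exp (16 * real d) * ?g v" using le by simp
  qed
  also have "\<dots> \<le> (\<Sum>v\<in>({..<d} \<rightarrow>\<^sub>E ?B). exp (16 * real d) * ?g v)"
  proof (rule sum_mono2)
    show "finite ({..<d} \<rightarrow>\<^sub>E ?B)" by (intro finite_PiE) simp_all
    show "lattice_net d \<subseteq> {..<d} \<rightarrow>\<^sub>E ?B" unfolding lattice_net_def by blast
    show "0 \<le> exp (16 * real d) * ?g v" for v by (intro mult_nonneg_nonneg prod_nonneg) simp_all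
  qed
  also have "\<dots> = exp (16 * real d) * (\<Sum>v\<in>({..<d} \<rightarrow>\<^sub>E ?B). ?g v)"
    by (rule sum_distrib_left[symmetric])
  also have "(\<Sum>v\<in>({..<d} \<rightarrow>\<^sub>E ?B). ?g v) = (\<Prod>i<d. \<Sum>a\<in>?B. exp (- (real_of_int a)\<^sup>2))"
    by (rule prod_sum_PiE[symmetric]) simp_all
  also have "exp (16 * real d) * (\<Prod>i<d. \<Sum>a\<in>?B. exp (- (real_of_int a)\<^sup>2)) \<le>
      exp (16 * real d) * (\<Prod>i<d. 3)"
    using sum_exp_neg_sq_le[of "16 * d"]
    by (intro mult_left_mono prod_mono conjI sum_nonneg) simp_all
  also have "\<dots> = (3 * exp 16) ^ d"
    using exp_of_nat_mult[of d "16 :: real"] by (simp add: power_mult_distrib mult.commute)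
  finally show ?thesis .
qed

lemma sq_norm_net_point_le:
  assumes v: "v \<in> lattice_net d" and "d > 0"
  shows "sq_norm d (net_point d v) \<le> 1"
proof -
  have "real_of_int (\<Sum>i<d. (v i)\<^sup>2) \<le> real_of_int (16 * int d)"
    using v unfolding lattice_net_def of_int_le_iff by simp
  then have "(\<Sum>i<d. (real_of_int (v i))\<^sup>2) / (16 * real d) \<le> (16 * real d) / (16 * real d)"
    by (intro divide_right_mono) simp_all
  moreover have "sq_norm d (net_point d v) = (\<Sum>i<d. (real_of_int (v i))\<^sup>2) / (16 * real d)"
    unfolding sq_norm_def sum_divide_distrib
    by (intro sum.cong refl) (simp add: net_point_def power_divide power_mult_distrib)
  ultimately show ?thesis using \<open>d > 0\<close> by simp
qed

lemma truncate_towards_zero: "\<exists>v::int. \<bar>t - of_int v\<bar> \<le> 1 \<and> \<bar>of_int v\<bar> \<le> \<bar>t :: real\<bar>"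
proof (cases "t \<ge> 0")
  case True
  then show ?thesis by (intro exI[of _ "\<lfloor>t\<rfloor>"]) (auto, linarith+)
next
  case False
  then show ?thesis by (intro exI[of _ "\<lceil>t\<rceil>"]) (auto, linarith+)
qed

text \<open>Rounding towards zero does not increase the norm, so the rounded point stays in the ball, and each
coordinate moves by at most \<open>1 / (4 sqrt d)\<close>.\<close>

lemma lattice_net_approx:
  assumes x: "sq_norm d x \<le> 1" and "d > 0"
  shows "\<exists>v\<in>lattice_net d. sq_norm d (\<lambda>i. x i - net_point d v i) \<le> 1 / 16"
proof -
  let ?s = "4 * sqrt (real d)"
  have s: "?s > 0" "?s\<^sup>2 = 16 * real d" using \<open>d > 0\<close> by (auto simp: power_mult_distrib)
  obtain v0 where v0: "\<And>i. \<bar>?s * x i - of_int (v0 i)\<bar> \<le> 1 \<and> \<bar>of_int (v0 i)\<bar> \<le> \<bar>?s * x i\<bar>"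
    using choice[of "\<lambda>i v. \<bar>?s * x i - of_int v\<bar> \<le> 1 \<and> \<bar>of_int v\<bar> \<le> \<bar>?s * x i\<bar>"] truncate_towards_zero
    by blast
  define v where "v = restrict v0 {..<d}"
  have sq: "(real_of_int (v i))\<^sup>2 \<le> 16 * real d * (x i)\<^sup>2" "(?s * x i - of_int (v i))\<^sup>2 \<le> 1" if "i < d" for i
  proof -
    have "(real_of_int (v i))\<^sup>2 \<le> (?s * x i)\<^sup>2" using v0[of i] that by (simp add: v_def abs_le_square_iff)
    then show "(real_of_int (v i))\<^sup>2 \<le> 16 * real d * (x i)\<^sup>2" by (simp only: power_mult_distrib[of ?s] s(2))
    show "(?s * x i - of_int (v i))\<^sup>2 \<le> 1" using v0[of i] that by (simp add: v_def abs_square_le_1)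
  qed
  have "(\<Sum>i<d. (real_of_int (v i))\<^sup>2) \<le> (\<Sum>i<d. 16 * real d * (x i)\<^sup>2)"
    by (rule sum_mono) (simp add: sq)
  also have "\<dots> = 16 * real d * sq_norm d x" by (simp add: sq_norm_def sum_distrib_left)
  also have "\<dots> \<le> 16 * real d" using x by (simp add: mult_left_le)
  finally have sumv: "(\<Sum>i<d. (real_of_int (v i))\<^sup>2) \<le> 16 * real d" .
  then have "real_of_int (\<Sum>i<d. (v i)\<^sup>2) \<le> real_of_int (16 * int d)" by simp
  then have sumvi: "(\<Sum>i<d. (v i)\<^sup>2) \<le> 16 * int d" by (simp only: of_int_le_iff)
  have "\<bar>v i\<bar> \<le> 16 * int d" if "i < d" for i
  proof -
    have "\<bar>v i\<bar> * (if v i = 0 then 0 else 1) \<le> \<bar>v i\<bar> * \<bar>v i\<bar>"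
      by (intro mult_left_mono) auto
    then have "\<bar>v i\<bar> \<le> (v i)\<^sup>2"
      by (simp add: power2_eq_square split: if_splits)
    also have "\<dots> \<le> (\<Sum>i<d. (v i)\<^sup>2)" using that by (intro member_le_sum) auto
    finally show ?thesis using sumvi by simp
  qed
  then have "v \<in> lattice_net d"
    using sumvi by (auto simp: lattice_net_def v_def abs_le_iff minus_le_iff)
  moreover have "sq_norm d (\<lambda>i. x i - net_point d v i) \<le> 1 / 16"
  proof -
    have "sq_norm d (\<lambda>i. x i - net_point d v i) = (\<Sum>i<d. (?s * x i - of_int (v i))\<^sup>2) / ?s\<^sup>2"
      unfolding sq_norm_def sum_divide_distrib
    proof (intro sum.cong refl)
      fix i
      have "x i - net_point d v i = (?s * x i - of_int (v i)) / ?s"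
        using \<open>d > 0\<close> by (simp add: net_point_def field_simps)
      then show "(x i - net_point d v i)\<^sup>2 = (?s * x i - of_int (v i))\<^sup>2 / ?s\<^sup>2"
        by (simp only: power_divide)
    qed
    also have "\<dots> \<le> (\<Sum>i<d. 1) / ?s\<^sup>2"
      using sq(2) by (intro divide_right_mono sum_mono) auto
    finally show ?thesis using \<open>d > 0\<close> unfolding s(2) by simp
  qed
  ultimately show ?thesis by blast
qed

lemma bilin_diff_left: "bilin n M (\<lambda>i. x i - x' i) y = bilin n M x y - bilin n M x' y"
  by (simp add: bilin_def algebra_simps sum_subtractf)

lemma bilin_diff_right: "bilin n M x (\<lambda>i. y i - y' i) = bilin n M x y - bilin n M x y'"
  by (simp add: bilin_def algebra_simps sum_subtractf)

lemma bilin_scale: "bilin n M (\<lambda>i. a * x i) (\<lambda>i. b * y i) = a * b * bilin n M x y"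
  by (simp add: bilin_def sum_distrib_left mult_ac)

lemma sq_norm_scale: "sq_norm n (\<lambda>i. a * x i) = a\<^sup>2 * sq_norm n x"
  by (simp add: sq_norm_def power_mult_distrib sum_distrib_left)

lemma sq_norm_component: "i < n \<Longrightarrow> (x i)\<^sup>2 \<le> sq_norm n x"
  unfolding sq_norm_def by (rule member_le_sum) auto

text \<open>Let \<open>S\<close> be the supremum over the unit ball. Replacing both arguments by net points costs at most \<open>S / 4\<close>
each, so \<open>S \<le> \<beta> + S / 2\<close>.\<close>

lemma bilin_le_of_net:
  assumes net: "\<And>v w. v \<in> lattice_net d \<Longrightarrow> w \<in> lattice_net d \<Longrightarrow>
      \<bar>bilin d M (net_point d v) (net_point d w)\<bar> \<le> \<beta>"
    and "d > 0" and x: "sq_norm d x \<le> 1" and y: "sq_norm d y \<le> 1"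
  shows "\<bar>bilin d M x y\<bar> \<le> 2 * \<beta>"
proof -
  define U where "U = {x. sq_norm d x \<le> 1}"
  define S where "S = (SUP (x, y)\<in>U \<times> U. \<bar>bilin d M x y\<bar>)"
  have le1: "\<bar>x i\<bar> \<le> 1" if "x \<in> U" "i < d" for x i
    using that sq_norm_component[of i d x] by (auto simp: U_def abs_square_le_1[symmetric])
  have bdd: "bdd_above ((\<lambda>(x, y). \<bar>bilin d M x y\<bar>) ` (U \<times> U))"
  proof (intro bdd_aboveI2[where M = "\<Sum>i<d. \<Sum>j<d. \<bar>M i j\<bar>"], clarify)
    fix x y assume U: "x \<in> U" "y \<in> U"
    have "\<bar>M i j * x i * y j\<bar> \<le> \<bar>M i j\<bar>" if "i < d" "j < d" for i j
    proof -
      have "\<bar>x i\<bar> * \<bar>y j\<bar> \<le> 1 * 1" using le1[OF U(1) that(1)] le1[OF U(2) that(2)] by (intro mult_mono) auto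
      then show ?thesis by (simp add: abs_mult mult.assoc mult_left_le)
    qed
    then show "\<bar>bilin d M x y\<bar> \<le> (\<Sum>i<d. \<Sum>j<d. \<bar>M i j\<bar>)"
      unfolding bilin_def by (intro order_trans[OF sum_abs] sum_mono order_trans[OF sum_abs]) auto
  qed
  have leS: "\<bar>bilin d M x y\<bar> \<le> S" if "x \<in> U" "y \<in> U" for x y
    unfolding S_def using cSUP_upper[OF _ bdd, of "(x, y)"] that by auto
  have quarter: "\<bar>bilin d M e y\<bar> \<le> S / 4" "\<bar>bilin d M y e\<bar> \<le> S / 4"
    if "sq_norm d e \<le> 1 / 16" "y \<in> U" for e y
  proof -
    have U: "(\<lambda>i. 4 * e i) \<in> U" using that by (simp add: U_def sq_norm_scale)
    show "\<bar>bilin d M e y\<bar> \<le> S / 4"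
      using leS[OF U that(2)] bilin_scale[of d M 4 e 1 y] by (simp add: abs_mult)
    show "\<bar>bilin d M y e\<bar> \<le> S / 4"
      using leS[OF that(2) U] bilin_scale[of d M 1 y 4 e] by (simp add: abs_mult)
  qed
  have step: "\<bar>bilin d M x y\<bar> \<le> \<beta> + S / 2" if U: "x \<in> U" "y \<in> U" for x y
  proof -
    obtain v where v: "v \<in> lattice_net d" "sq_norm d (\<lambda>i. x i - net_point d v i) \<le> 1 / 16"
      using lattice_net_approx[of d x] U \<open>d > 0\<close> by (auto simp: U_def)
    have vU: "net_point d v \<in> U" using sq_norm_net_point_le[OF v(1) \<open>d > 0\<close>] by (simp add: U_def)
    obtain w where w: "w \<in> lattice_net d" "sq_norm d (\<lambda>i. y i - net_point d w i) \<le> 1 / 16"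
      using lattice_net_approx[of d y] U \<open>d > 0\<close> by (auto simp: U_def)
    have "bilin d M x y = bilin d M (net_point d v) (net_point d w)
        + bilin d M (\<lambda>i. x i - net_point d v i) y + bilin d M (net_point d v) (\<lambda>i. y i - net_point d w i)"
      by (simp add: bilin_diff_left bilin_diff_right)
    then show ?thesis
      using net[OF v(1) w(1)] quarter(1)[OF v(2) U(2)] quarter(2)[OF w(2) vU] by linarith
  qed
  have "(\<lambda>_. 0) \<in> U" by (simp add: U_def sq_norm_def)
  then have "S \<le> \<beta> + S / 2"
    unfolding S_def using step[unfolded S_def] by (intro cSUP_least) auto
  then show ?thesis using leS[of x y] x y by (simp add: U_def)
qed

lemma sq_norm_mat_vec_le_of_net:
  assumes net: "\<And>v w. v \<in> lattice_net d \<Longrightarrow> w \<in> lattice_net d \<Longrightarrow>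
      \<bar>bilin d M (net_point d v) (net_point d w)\<bar> \<le> \<beta>"
    and "d > 0"
  shows "sq_norm d (mat_vec d M x) \<le> (2 * \<beta>)\<^sup>2 * sq_norm d x"
proof (cases "sq_norm d x = 0 \<or> sq_norm d (mat_vec d M x) = 0")
  case True
  then show ?thesis
  proof
    assume "sq_norm d x = 0"
    then have "x j = 0" if "j < d" for j
      using sq_norm_component[OF that, of x] by simp
    then have "sq_norm d (mat_vec d M x) = 0" by (simp add: sq_norm_def mat_vec_def)
    then show ?thesis by (simp add: sq_norm_nonneg)
  qed (simp add: sq_norm_nonneg)
next
  case False
  define a b where "a = sq_norm d x" and "b = sq_norm d (mat_vec d M x)"
  have pos: "a > 0" "b > 0" using False sq_norm_nonneg by (auto simp: a_def b_def less_le)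
  let ?x = "\<lambda>i. 1 / sqrt a * x i" and ?y = "\<lambda>i. 1 / sqrt b * mat_vec d M x i"
  have "bilin d M ?y ?x = 1 / sqrt b * (1 / sqrt a) * b"
    unfolding bilin_scale by (simp add: bilin_eq_mat_vec b_def sq_norm_def power2_eq_square)
  also have "\<dots> = sqrt b / sqrt a" using pos by (simp add: field_simps)
  finally have "bilin d M ?y ?x = sqrt b / sqrt a" .
  moreover have "\<bar>bilin d M ?y ?x\<bar> \<le> 2 * \<beta>"
    using pos by (intro bilin_le_of_net[OF net \<open>d > 0\<close>])
      (simp_all only: sq_norm_scale power_divide, simp_all add: a_def[symmetric] b_def[symmetric])
  ultimately have "(sqrt b / sqrt a)\<^sup>2 \<le> (2 * \<beta>)\<^sup>2"
    using pos by (intro power_mono) auto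
  then show ?thesis using pos by (simp add: power_divide a_def[symmetric] b_def[symmetric] field_simps)
qed

lemma trace_power_le_net_sum:
  assumes sym: "symmetric_below d M" and "d > 0"
  shows "trace_power d M (2 * k) \<le> real d * 4 ^ k *
    (\<Sum>v\<in>lattice_net d. \<Sum>w\<in>lattice_net d. (bilin d M (net_point d v) (net_point d w)) ^ (2 * k))"
proof -
  let ?N = "lattice_net d \<times> lattice_net d"
  let ?f = "\<lambda>(v, w). \<bar>bilin d M (net_point d v) (net_point d w)\<bar>"
  have "\<exists>v. v \<in> lattice_net d"
    using lattice_net_approx[of d "\<lambda>_. 0"] \<open>d > 0\<close> by (auto simp: sq_norm_def)
  then have fin: "finite (?f ` ?N)" and ne: "?f ` ?N \<noteq> {}" by auto
  define \<beta> where "\<beta> = Max (?f ` ?N)"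
  from Max_in[OF fin ne] obtain v w where vw: "v \<in> lattice_net d" "w \<in> lattice_net d" "\<beta> = ?f (v, w)"
    unfolding \<beta>_def[symmetric] by auto
  have "trace_power d M (2 * k) \<le> real d * (2 * \<beta>) ^ (2 * k)"
  proof (rule trace_power_le_of_mat_vec_bound[OF sym sq_norm_mat_vec_le_of_net[OF _ \<open>d > 0\<close>]])
    fix v w assume "v \<in> lattice_net d" "w \<in> lattice_net d"
    then show "\<bar>bilin d M (net_point d v) (net_point d w)\<bar> \<le> \<beta>"
      unfolding \<beta>_def by (intro Max_ge fin) auto
  qed
  also have "(2 * \<beta>) ^ (2 * k) = 4 ^ k * \<beta> ^ (2 * k)"
    by (simp add: power_mult_distrib power_mult)
  also have "\<beta> ^ (2 * k) = (bilin d M (net_point d v) (net_point d w)) ^ (2 * k)"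
    using vw by (simp add: power_even_abs)
  also have "\<dots> \<le> (\<Sum>w\<in>lattice_net d. (bilin d M (net_point d v) (net_point d w)) ^ (2 * k))"
    using vw by (intro member_le_sum) (auto simp: zero_le_even_power)
  also have "\<dots> \<le> (\<Sum>v\<in>lattice_net d. \<Sum>w\<in>lattice_net d. (bilin d M (net_point d v) (net_point d w)) ^ (2 * k))"
    using vw by (intro member_le_sum) (auto simp: zero_le_even_power intro!: sum_nonneg)
  finally show ?thesis by (simp add: mult_left_mono mult.assoc)
qed


section \<open>Trace moments of a dense matrix of skewed signs\<close>

lemma sum_pairs:
  fixes F :: "nat \<Rightarrow> nat \<Rightarrow> real"
  shows "(\<Sum>i<n. \<Sum>j<n. F i j) = (\<Sum>i<n. F i i) + (\<Sum>(i, j)\<in>vertex_pairs n. F i j + F j i)"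
proof -
  let ?swap = "\<lambda>(i, j). (j, i)" and ?d = "\<lambda>i. (i, i)"
  have "{..<n} \<times> {..<n} = ?d ` {..<n} \<union> (vertex_pairs n \<union> ?swap ` vertex_pairs n)"
    by (auto simp: vertex_pairs_def image_iff)
  moreover have "?d ` {..<n} \<inter> (vertex_pairs n \<union> ?swap ` vertex_pairs n) = {}"
    "vertex_pairs n \<inter> ?swap ` vertex_pairs n = {}"
    by (auto simp: vertex_pairs_def)
  ultimately have "(\<Sum>(i, j)\<in>{..<n} \<times> {..<n}. F i j) =
      (\<Sum>(i, j)\<in>?d ` {..<n}. F i j) + ((\<Sum>(i, j)\<in>vertex_pairs n. F i j) + (\<Sum>(i, j)\<in>?swap ` vertex_pairs n. F i j))"
    by (simp add: sum.union_disjoint)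
  also have "(\<Sum>(i, j)\<in>?d ` {..<n}. F i j) = (\<Sum>i<n. F i i)"
    by (subst sum.reindex) (auto simp: inj_on_def)
  also have "(\<Sum>(i, j)\<in>?swap ` vertex_pairs n. F i j) = (\<Sum>(i, j)\<in>vertex_pairs n. F j i)"
    by (subst sum.reindex) (auto simp: inj_on_def case_prod_unfold)
  finally show ?thesis by (simp add: sum.cartesian_product sum.distrib case_prod_unfold)
qed

lemma bilin_sym_entry:
  "bilin n (sym_entry w) x y = (\<Sum>e\<in>vertex_pairs n. (x (fst e) * y (snd e) + x (snd e) * y (fst e)) * w e)"
  unfolding bilin_def sum_pairs
  by (auto simp: sym_entry_def vertex_pairs_def min_def max_def algebra_simps intro!: sum.cong)

text \<open>A two-valued distribution with mean zero all of whose higher moments, odd ones included, are at least 1.\<close>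

definition skew_sign :: "real pmf" where
  "skew_sign = map_pmf (\<lambda>b. if b then 2 else -1) (bernoulli_pmf (1 / 3))"

lemma expectation_skew_sign: "measure_pmf.expectation skew_sign f = (f 2 + 2 * f (-1)) / (3 :: real)"
  by (simp add: skew_sign_def)

lemma finite_skew_sign: "finite (set_pmf skew_sign)"
  by (simp add: skew_sign_def)

lemma skew_sign_mean: "measure_pmf.expectation skew_sign (\<lambda>v. v) = 0"
  by (simp add: expectation_skew_sign)

lemma skew_sign_moment: "j \<ge> 2 \<Longrightarrow> measure_pmf.expectation skew_sign (\<lambda>v. v ^ j) \<ge> 1"
proof -
  assume j: "j \<ge> 2"
  show ?thesis
  proof (cases "even j")
    case True
    have "(2::real) ^ 2 \<le> 2 ^ j" using j by (intro power_increasing) auto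
    then show ?thesis using True by (simp add: expectation_skew_sign)
  next
    case False
    then have "j \<ge> 3" using j by (cases "j = 2") auto
    then have "(2::real) ^ 3 \<le> 2 ^ j" by (intro power_increasing) auto
    then show ?thesis using False by (simp add: expectation_skew_sign)
  qed
qed

text \<open>Hoeffding's lemma for a variable of range 3. The auxiliary bound from its proof covers nonnegative
arguments, so for negative \<open>t\<close> it is applied to the reflected variable.\<close>

lemma skew_sign_mgf: "measure_pmf.expectation skew_sign (\<lambda>v. exp (t * v)) \<le> exp (9 / 8 * t\<^sup>2)"
proof (cases "t \<ge> 0")
  case True
  have pos: "1 + 1 / 3 * (exp (3 * t) - 1) > (0::real)"
    using exp_gt_zero[of "3 * t"] by (simp add: field_simps del: exp_gt_zero)
  have "- (3 * t) * (1 / 3) + ln (1 + 1 / 3 * (exp (3 * t) - 1)) \<le> (3 * t)\<^sup>2 / 8"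
    using True by (intro Hoeffdings_lemma_aux) auto
  moreover have "(3 * t)\<^sup>2 / 8 = 9 / 8 * t\<^sup>2" by (simp add: power2_eq_square)
  ultimately have "- t + ln (1 + 1 / 3 * (exp (3 * t) - 1)) \<le> 9 / 8 * t\<^sup>2" by linarith
  then have "exp (- t + ln (1 + 1 / 3 * (exp (3 * t) - 1))) \<le> exp (9 / 8 * t\<^sup>2)"
    by (simp only: exp_le_cancel_iff)
  then have le: "exp (- t) * (1 + 1 / 3 * (exp (3 * t) - 1)) \<le> exp (9 / 8 * t\<^sup>2)"
    by (simp only: exp_add exp_ln[OF pos])
  have "exp (t * 2) = exp (- t) * exp (3 * t)" by (simp add: mult_exp_exp)
  then have eq: "(exp (t * 2) + 2 * exp (t * - 1)) / 3 = exp (- t) * (1 + 1 / 3 * (exp (3 * t) - 1))"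
    by (simp add: algebra_simps)
  show ?thesis unfolding expectation_skew_sign eq by (rule le)
next
  case False
  have pos: "1 + 2 / 3 * (exp (- 3 * t) - 1) > (0::real)"
    using exp_gt_zero[of "- 3 * t"] by (simp add: field_simps del: exp_gt_zero)
  have "- (- 3 * t) * (2 / 3) + ln (1 + 2 / 3 * (exp (- 3 * t) - 1)) \<le> (- 3 * t)\<^sup>2 / 8"
    using False by (intro Hoeffdings_lemma_aux) auto
  moreover have "(- 3 * t)\<^sup>2 / 8 = 9 / 8 * t\<^sup>2" by (simp add: power2_eq_square)
  ultimately have "2 * t + ln (1 + 2 / 3 * (exp (- 3 * t) - 1)) \<le> 9 / 8 * t\<^sup>2" by linarith
  then have "exp (2 * t + ln (1 + 2 / 3 * (exp (- 3 * t) - 1))) \<le> exp (9 / 8 * t\<^sup>2)"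
    by (simp only: exp_le_cancel_iff)
  then have le: "exp (2 * t) * (1 + 2 / 3 * (exp (- 3 * t) - 1)) \<le> exp (9 / 8 * t\<^sup>2)"
    by (simp only: exp_add exp_ln[OF pos])
  have "exp (t * - 1) = exp (2 * t) * exp (- 3 * t)" by (simp add: mult_exp_exp)
  then have eq: "(exp (t * 2) + 2 * exp (t * - 1)) / 3 = exp (2 * t) * (1 + 2 / 3 * (exp (- 3 * t) - 1))"
    by (simp add: algebra_simps)
  show ?thesis unfolding expectation_skew_sign eq by (rule le)
qed

lemma sum_pair_coefficients_le:
  "(\<Sum>e\<in>vertex_pairs n. (x (fst e) * y (snd e) + x (snd e) * y (fst e))\<^sup>2) \<le> 2 * (sq_norm n x * sq_norm n y)"
proof -
  have sq: "(a + b)\<^sup>2 \<le> 2 * (a\<^sup>2 + b\<^sup>2)" for a b :: real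
    using zero_le_power2[of "a - b"] by (simp add: power2_eq_square algebra_simps)
  have "(\<Sum>e\<in>vertex_pairs n. (x (fst e) * y (snd e) + x (snd e) * y (fst e))\<^sup>2) \<le>
      (\<Sum>e\<in>vertex_pairs n. 2 * ((x (fst e) * y (snd e))\<^sup>2 + (x (snd e) * y (fst e))\<^sup>2))"
    by (intro sum_mono sq)
  also have "\<dots> = 2 * (\<Sum>(i, j)\<in>vertex_pairs n. (x i * y j)\<^sup>2 + (x j * y i)\<^sup>2)"
    by (simp add: sum_distrib_left case_prod_unfold)
  also have "\<dots> \<le> 2 * ((\<Sum>i<n. (x i * y i)\<^sup>2) + (\<Sum>(i, j)\<in>vertex_pairs n. (x i * y j)\<^sup>2 + (x j * y i)\<^sup>2))"
    by (simp add: sum_nonneg)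
  also have "\<dots> = 2 * (\<Sum>i<n. \<Sum>j<n. (x i * y j)\<^sup>2)"
    unfolding sum_pairs[of "\<lambda>i j. (x i * y j)\<^sup>2"] ..
  also have "\<dots> = 2 * (sq_norm n x * sq_norm n y)"
    by (simp add: sq_norm_def sum_product power_mult_distrib)
  finally show ?thesis .
qed

lemma skew_sign_bilin_mgf:
  assumes "sq_norm d x \<le> 1" "sq_norm d y \<le> 1"
  shows "measure_pmf.expectation (Pi_pmf (vertex_pairs d) b (\<lambda>_. skew_sign))
    (\<lambda>w. exp (t * bilin d (sym_entry w) x y)) \<le> exp (9 / 4 * t\<^sup>2)"
proof -
  let ?c = "\<lambda>e. x (fst e) * y (snd e) + x (snd e) * y (fst e)"
  have "measure_pmf.expectation (Pi_pmf (vertex_pairs d) b (\<lambda>_. skew_sign))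
      (\<lambda>w. exp (t * bilin d (sym_entry w) x y)) =
    measure_pmf.expectation (Pi_pmf (vertex_pairs d) b (\<lambda>_. skew_sign))
      (\<lambda>w. \<Prod>e\<in>vertex_pairs d. exp (t * ?c e * w e))"
    by (simp add: bilin_sym_entry sum_distrib_left exp_sum[symmetric] mult.assoc)
  also have "\<dots> = (\<Prod>e\<in>vertex_pairs d. measure_pmf.expectation skew_sign (\<lambda>v. exp (t * ?c e * v)))"
    by (rule expectation_prod_iid) (simp_all add: finite_skew_sign)
  also have "\<dots> \<le> (\<Prod>e\<in>vertex_pairs d. exp (9 / 8 * (t * ?c e)\<^sup>2))"
    by (intro prod_mono conjI skew_sign_mgf) (simp add: expectation_skew_sign)
  also have "\<dots> = exp (9 / 8 * t\<^sup>2 * (\<Sum>e\<in>vertex_pairs d. (?c e)\<^sup>2))"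
    by (simp add: exp_sum[symmetric] sum_distrib_left power_mult_distrib mult.assoc)
  also have "\<dots> \<le> exp (9 / 8 * t\<^sup>2 * 2)"
  proof -
    have "sq_norm d x * sq_norm d y \<le> 1 * 1"
      using assms by (intro mult_mono) (auto simp: sq_norm_nonneg)
    then have "(\<Sum>e\<in>vertex_pairs d. (?c e)\<^sup>2) \<le> 2"
      using sum_pair_coefficients_le[of x y d] by linarith
    then show ?thesis unfolding exp_le_cancel_iff by (intro mult_left_mono) simp_all
  qed
  finally show ?thesis by simp
qed

lemma power_le_fact_mult_exp:
  fixes y :: real
  assumes "y \<ge> 0"
  shows "y ^ m \<le> fact m * exp y"
proof -
  have "(\<Sum>i\<in>{m}. y ^ i /\<^sub>R fact i) \<le> (\<Sum>i. y ^ i /\<^sub>R fact i)"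
    using assms by (intro sum_le_suminf summable_exp_generic) auto
  then show ?thesis by (simp add: exp_def field_simps)
qed

text \<open>The moment generating function is dominated by that of a Gaussian; up to a constant, \<open>t = sqrt k\<close> is the
argument at which it bounds the \<open>2k\<close>-th moment best.\<close>

lemma skew_sign_bilin_moment:
  assumes "sq_norm d x \<le> 1" "sq_norm d y \<le> 1" "k > 0"
  shows "measure_pmf.expectation (Pi_pmf (vertex_pairs d) b (\<lambda>_. skew_sign))
    (\<lambda>w. (bilin d (sym_entry w) x y) ^ (2 * k)) \<le> 2 * (4 * exp (9 / 4) * real k) ^ k"
proof -
  let ?P = "Pi_pmf (vertex_pairs d) b (\<lambda>_. skew_sign)"
  let ?X = "\<lambda>w. bilin d (sym_entry w) x y"
  let ?t = "sqrt (real k)"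
  have fin: "finite (set_pmf ?P)" by (intro finite_set_Pi_pmf finite_skew_sign) simp
  note int = integrable_measure_pmf_finite[OF fin]
  have t: "?t ^ (2 * k) = real k ^ k" by (simp add: power_mult)
  have pw: "real k ^ k * ?X w ^ (2 * k) \<le> fact (2 * k) * (exp (?t * ?X w) + exp (- ?t * ?X w))" for w
  proof -
    have "real k ^ k * ?X w ^ (2 * k) = \<bar>?t * ?X w\<bar> ^ (2 * k)"
      by (simp add: power_even_abs power_mult_distrib t)
    also have "\<dots> \<le> fact (2 * k) * exp \<bar>?t * ?X w\<bar>"
      by (rule power_le_fact_mult_exp) simp
    also have "\<dots> \<le> fact (2 * k) * (exp (?t * ?X w) + exp (- ?t * ?X w))"
      by (intro mult_left_mono) (auto simp: abs_if)
    finally show ?thesis .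
  qed
  have "real k ^ k * measure_pmf.expectation ?P (\<lambda>w. ?X w ^ (2 * k)) =
      measure_pmf.expectation ?P (\<lambda>w. real k ^ k * ?X w ^ (2 * k))" by simp
  also have "\<dots> \<le> measure_pmf.expectation ?P (\<lambda>w. fact (2 * k) * (exp (?t * ?X w) + exp (- ?t * ?X w)))"
    by (intro integral_mono int pw)
  also have "\<dots> = fact (2 * k) * (measure_pmf.expectation ?P (\<lambda>w. exp (?t * ?X w))
      + measure_pmf.expectation ?P (\<lambda>w. exp (- ?t * ?X w)))"
    by (simp add: int)
  also have "\<dots> \<le> fact (2 * k) * (exp (9 / 4 * ?t\<^sup>2) + exp (9 / 4 * (- ?t)\<^sup>2))"
    by (intro mult_left_mono add_mono skew_sign_bilin_mgf assms) auto
  also have "\<dots> = 2 * fact (2 * k) * exp (9 / 4) ^ k"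
    by (simp add: exp_of_nat_mult[symmetric] mult.commute)
  also have "\<dots> \<le> 2 * (real ((2 * k) ^ (2 * k))) * exp (9 / 4) ^ k"
    using fact_le_power[of "2 * k", where 'a = real] by (intro mult_right_mono mult_left_mono) auto
  also have "\<dots> = real k ^ k * (2 * (4 * exp (9 / 4) * real k) ^ k)"
    by (simp add: power_mult_distrib power_mult power2_eq_square)
  finally show ?thesis using \<open>k > 0\<close> by simp
qed

definition dense_const :: real where
  "dense_const = 16 * exp (9 / 4) * (3 * exp 16) ^ 4"

text \<open>The net has at most exponentially many points in the dimension \<open>2k\<close>, so the sum over all pairs of net points
costs only a constant factor per unit of \<open>k\<close>.\<close>

lemma dense_trace_moment:
  assumes "k > 0"
  shows "measure_pmf.expectation (Pi_pmf (vertex_pairs (2 * k)) b (\<lambda>_. skew_sign))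
    (\<lambda>w. trace_power (2 * k) (sym_entry w) (2 * k)) \<le> real (2 * k) * (2 * (dense_const * real k) ^ k)"
proof -
  let ?d = "2 * k"
  let ?P = "Pi_pmf (vertex_pairs ?d) b (\<lambda>_. skew_sign)"
  let ?N = "lattice_net ?d"
  have "finite (set_pmf ?P)" by (intro finite_set_Pi_pmf finite_skew_sign) simp
  note int = integrable_measure_pmf_finite[OF this]
  have "measure_pmf.expectation ?P (\<lambda>w. trace_power ?d (sym_entry w) (2 * k)) \<le>
      measure_pmf.expectation ?P (\<lambda>w. real ?d * 4 ^ k *
        (\<Sum>v\<in>?N. \<Sum>w'\<in>?N. (bilin ?d (sym_entry w) (net_point ?d v) (net_point ?d w')) ^ (2 * k)))"
    using \<open>k > 0\<close> by (intro integral_mono int trace_power_le_net_sum symmetric_sym_entry) simp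
  also have "\<dots> = real ?d * 4 ^ k * (\<Sum>v\<in>?N. \<Sum>w'\<in>?N. measure_pmf.expectation ?P
        (\<lambda>w. (bilin ?d (sym_entry w) (net_point ?d v) (net_point ?d w')) ^ (2 * k)))"
    by (simp add: int Bochner_Integration.integral_sum)
  also have "\<dots> \<le> real ?d * 4 ^ k * (\<Sum>v\<in>?N. \<Sum>w'\<in>?N. 2 * (4 * exp (9 / 4) * real k) ^ k)"
    by (intro mult_left_mono sum_mono skew_sign_bilin_moment sq_norm_net_point_le) (use \<open>k > 0\<close> in auto)
  also have "\<dots> = real ?d * 4 ^ k * ((real (card ?N))\<^sup>2 * (2 * (4 * exp (9 / 4) * real k) ^ k))"
    by (simp add: power2_eq_square)
  also have "\<dots> \<le> real ?d * 4 ^ k * ((((3 * exp 16) ^ ?d)\<^sup>2) * (2 * (4 * exp (9 / 4) * real k) ^ k))"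
    by (intro mult_left_mono mult_right_mono power_mono card_lattice_net) auto
  also have "((3 * exp 16) ^ ?d)\<^sup>2 = ((3 * exp 16) ^ 4) ^ k"
    by (simp add: power_mult[symmetric] mult.commute)
  also have "real ?d * 4 ^ k * (((3 * exp 16) ^ 4) ^ k * (2 * (4 * exp (9 / 4) * real k) ^ k)) =
      real ?d * (2 * (dense_const * real k) ^ k)"
  proof -
    have "(dense_const * real k) ^ k = (4 * ((3 * exp 16) ^ 4) * (4 * exp (9 / 4) * real k)) ^ k"
      by (simp add: dense_const_def mult_ac)
    also have "\<dots> = 4 ^ k * ((3 * exp 16) ^ 4) ^ k * (4 * exp (9 / 4) * real k) ^ k"
      by (simp only: power_mult_distrib)
    finally show ?thesis by (simp only: mult_ac)
  qed
  finally show ?thesis .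
qed


section \<open>Noise and row sums of the signed edge weights\<close>

text \<open>The distribution of \<open>z\<^sub>i C\<^sub>i\<^sub>j z\<^sub>j\<close> for distinct \<open>i\<close> and \<open>j\<close>.\<close>

definition edge_sign :: "real \<Rightarrow> real \<Rightarrow> real pmf" where
  "edge_sign p \<delta> = do {
     present \<leftarrow> bernoulli_pmf p;
     if present then map_pmf (\<lambda>correct. if correct then 1 else -1) (bernoulli_pmf ((1 + \<delta>) / 2))
     else return_pmf 0
   }"

lemma finite_edge_sign: "finite (set_pmf (edge_sign p \<delta>))"
  by (auto simp: edge_sign_def)

lemma expectation_edge_sign:
  fixes f :: "real \<Rightarrow> real"
  assumes "0 \<le> p" "p \<le> 1" "0 \<le> \<delta>" "\<delta> \<le> 1"
  shows "measure_pmf.expectation (edge_sign p \<delta>) f =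
    p * ((1 + \<delta>) / 2 * f 1 + (1 - \<delta>) / 2 * f (-1)) + (1 - p) * f 0"
proof -
  have "measure_pmf.expectation (edge_sign p \<delta>) f = (\<Sum>b\<in>UNIV. pmf (bernoulli_pmf p) b *\<^sub>R
      measure_pmf.expectation (if b then map_pmf (\<lambda>c. if c then 1 else -1) (bernoulli_pmf ((1 + \<delta>) / 2))
        else return_pmf 0) f)"
    unfolding edge_sign_def by (rule pmf_expectation_bind) auto
  also have "\<dots> = p * ((1 + \<delta>) / 2 * f 1 + (1 - \<delta>) / 2 * f (-1)) + (1 - p) * f 0"
    using assms by (simp add: UNIV_bool field_simps)
  finally show ?thesis .
qed

abbreviation signs :: "nat \<Rightarrow> real \<Rightarrow> real \<Rightarrow> (nat \<times> nat \<Rightarrow> real) pmf" where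
  "signs n p \<delta> \<equiv> Pi_pmf (vertex_pairs n) 0 (\<lambda>_. edge_sign p \<delta>)"

lemma centred_sym_entry: "centred q (sym_entry s) = sym_entry (\<lambda>e. s e - q)"
  by (intro ext) (simp add: centred_def sym_entry_def)

text \<open>An absent edge contributes \<open>(p \<delta>)\<^sup>j \<le> p\<close> and a correct measurement at most 1. Together they fit below
\<open>2\<^sup>j p\<close> because a wrong measurement, the only one with deviation above 1, has probability at most \<open>1/2\<close>.\<close>

lemma centred_edge_sign_moment:
  assumes "0 \<le> p" "p \<le> 1" "0 \<le> \<delta>" "\<delta> \<le> 1" "j \<ge> 2"
  shows "\<bar>measure_pmf.expectation (edge_sign p \<delta>) (\<lambda>v. (v - p * \<delta>) ^ j)\<bar> \<le> 2 ^ j * p"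
proof -
  define q where "q = p * \<delta>"
  have q: "0 \<le> q" "q \<le> p" "q \<le> 1" using assms by (auto simp: q_def mult_left_le mult_le_one)
  have "\<bar>(1 - q) ^ j\<bar> \<le> 1" using q by (simp add: power_abs power_le_one)
  then have 1: "(1 + \<delta>) / 2 * \<bar>(1 - q) ^ j\<bar> \<le> (1 + \<delta>) / 2 * 1" using assms by (intro mult_left_mono) auto
  have "\<bar>- 1 - q\<bar> = 1 + q" using q by simp
  then have "\<bar>(- 1 - q) ^ j\<bar> = (1 + q) ^ j" by (simp only: power_abs)
  also have "\<dots> \<le> 2 ^ j" using q by (intro power_mono) auto
  finally have 2: "(1 - \<delta>) / 2 * \<bar>(- 1 - q) ^ j\<bar> \<le> (1 - \<delta>) / 2 * 2 ^ j" using assms by (intro mult_left_mono) auto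
  have "\<bar>(0 - q) ^ j\<bar> = q ^ j" using q by (simp add: power_abs)
  also have "\<dots> \<le> q ^ 1" using q assms by (intro power_decreasing) auto
  finally have "(1 - p) * \<bar>(0 - q) ^ j\<bar> \<le> 1 * p" using assms q by (intro mult_mono) auto
  then have 3: "(1 - p) * \<bar>(0 - q) ^ j\<bar> \<le> p" by simp
  have "\<bar>(1 + \<delta>) / 2 * (1 - q) ^ j + (1 - \<delta>) / 2 * (- 1 - q) ^ j\<bar> \<le>
      (1 + \<delta>) / 2 * \<bar>(1 - q) ^ j\<bar> + (1 - \<delta>) / 2 * \<bar>(- 1 - q) ^ j\<bar>"
    using assms by (intro order_trans[OF abs_triangle_ineq]) (simp add: abs_mult)
  then have 4: "p * \<bar>(1 + \<delta>) / 2 * (1 - q) ^ j + (1 - \<delta>) / 2 * (- 1 - q) ^ j\<bar> \<le>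
      p * ((1 + \<delta>) / 2 + (1 - \<delta>) / 2 * 2 ^ j)"
    using 1 2 assms by (intro mult_left_mono) linarith+
  have "\<bar>p * ((1 + \<delta>) / 2 * (1 - q) ^ j + (1 - \<delta>) / 2 * (- 1 - q) ^ j) + (1 - p) * (0 - q) ^ j\<bar> \<le>
      p * \<bar>(1 + \<delta>) / 2 * (1 - q) ^ j + (1 - \<delta>) / 2 * (- 1 - q) ^ j\<bar> + (1 - p) * \<bar>(0 - q) ^ j\<bar>"
    using assms by (intro order_trans[OF abs_triangle_ineq]) (simp add: abs_mult)
  also have "\<dots> \<le> p * ((1 + \<delta>) / 2 + (1 - \<delta>) / 2 * 2 ^ j) + p"
    by (rule add_mono[OF 4 3])
  also have "\<dots> = p * ((1 + \<delta>) / 2 + (1 - \<delta>) / 2 * 2 ^ j + 1)" by (simp add: algebra_simps)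
  also have "\<dots> \<le> p * 2 ^ j"
  proof (intro mult_left_mono)
    have "(2::real) ^ 2 \<le> 2 ^ j" using assms by (intro power_increasing) auto
    then have "(1 + \<delta>) / 2 * 4 \<le> (1 + \<delta>) / 2 * (2 ^ j)" using assms by (intro mult_left_mono) auto
    then show "(1 + \<delta>) / 2 + (1 - \<delta>) / 2 * 2 ^ j + 1 \<le> 2 ^ j"
      using assms by (simp add: algebra_simps add_divide_distrib diff_divide_distrib)
  qed (use assms in auto)
  finally show ?thesis
    unfolding expectation_edge_sign[OF assms(1-4)] q_def[symmetric] by (simp only: mult.commute[of "2 ^ j" p])
qed

text \<open>Markov's inequality for the trace of the power \<open>2k\<close>, compared with the dense matrix of dimension \<open>2k\<close>.\<close>

lemma noise_tail:
  assumes "0 \<le> p" "p \<le> 1" "0 \<le> \<delta>" "\<delta> \<le> 1" "k > 0" "real n * p \<le> real k" "B > 0"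
  shows "measure_pmf.prob (signs n p \<delta>)
      {s. \<not> (\<forall>x. \<bar>bilin n (centred (p * \<delta>) (sym_entry s)) x x\<bar> \<le> B * sq_norm n x)}
    \<le> 2 * real n * (4 * dense_const * real k / B\<^sup>2) ^ k"
proof -
  let ?q = "p * \<delta>"
  let ?\<mu> = "map_pmf (\<lambda>v. v - ?q) (edge_sign p \<delta>)"
  let ?P' = "Pi_pmf (vertex_pairs n) (- ?q) (\<lambda>_. ?\<mu>)"
  let ?T = "\<lambda>w. trace_power n (sym_entry w) (2 * k)"
  have P': "?P' = map_pmf (\<lambda>s. (\<lambda>v. v - ?q) \<circ> s) (signs n p \<delta>)"
    by (rule Pi_pmf_map) auto
  have fin: "finite (set_pmf ?\<mu>)" by (simp add: finite_edge_sign)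
  have fin': "finite (set_pmf ?P')" by (intro finite_set_Pi_pmf fin) simp
  have T0: "?T w \<ge> 0" for w
    by (simp add: trace_power_even[OF symmetric_sym_entry] sq_norm_nonneg sum_nonneg)
  have "measure_pmf.prob (signs n p \<delta>)
      {s. \<not> (\<forall>x. \<bar>bilin n (centred ?q (sym_entry s)) x x\<bar> \<le> B * sq_norm n x)}
    = measure_pmf.prob ?P' {w. \<not> (\<forall>x. \<bar>bilin n (sym_entry w) x x\<bar> \<le> B * sq_norm n x)}"
    unfolding P' by (simp add: centred_sym_entry vimage_def comp_def)
  also have "\<dots> \<le> measure_pmf.prob ?P' {w. ?T w \<ge> B ^ (2 * k)}"
    using quadratic_form_bound_of_trace[OF symmetric_sym_entry \<open>k > 0\<close>, of n _ B] \<open>B > 0\<close>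
    by (intro measure_pmf.finite_measure_mono) (auto, meson less_imp_le linorder_not_less)
  also have "\<dots> \<le> measure_pmf.expectation ?P' ?T / B ^ (2 * k)"
    using integral_Markov_inequality_measure[of "measure_pmf ?P'" ?T UNIV "B ^ (2 * k)"] T0 \<open>B > 0\<close>
    by (simp add: integrable_measure_pmf_finite[OF fin'])
  also have "\<dots> \<le> (2 * real n * (4 * (dense_const * real k)) ^ k) / B ^ (2 * k)"
  proof (intro divide_right_mono)
    have "real (2 * k) * measure_pmf.expectation ?P' ?T \<le> 4 ^ k * real n *
        measure_pmf.expectation (Pi_pmf (vertex_pairs (2 * k)) 0 (\<lambda>_. skew_sign)) (\<lambda>w. trace_power (2 * k) (sym_entry w) (2 * k))"
    proof (rule trace_moment_comparison[OF fin finite_skew_sign])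
      show "measure_pmf.expectation ?\<mu> (\<lambda>v. v) = 0"
        using assms by (simp add: expectation_edge_sign algebra_simps add_divide_distrib diff_divide_distrib)
      show "\<bar>measure_pmf.expectation ?\<mu> (\<lambda>v. v ^ j)\<bar> \<le> 2 ^ j * p" if "j \<ge> 2" for j
        using centred_edge_sign_moment[OF assms(1-4) that] by simp
      show "real n * p + real k \<le> real (2 * k)" using assms by simp
    qed (use assms skew_sign_mean skew_sign_moment in auto)
    also have "\<dots> \<le> 4 ^ k * real n * (real (2 * k) * (2 * (dense_const * real k) ^ k))"
      by (intro mult_left_mono dense_trace_moment \<open>k > 0\<close>) auto
    also have "\<dots> = real (2 * k) * (2 * real n * (4 * (dense_const * real k)) ^ k)"
      unfolding power_mult_distrib[of 4 "dense_const * real k" k] by (simp only: mult_ac)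
    finally show "measure_pmf.expectation ?P' ?T \<le> 2 * real n * (4 * (dense_const * real k)) ^ k"
      unfolding power_mult_distrib[of 4 "dense_const * real k" k] using \<open>k > 0\<close> by (simp add: mult_ac)
  qed (use \<open>B > 0\<close> in auto)
  also have "\<dots> = 2 * real n * (4 * dense_const * real k / B\<^sup>2) ^ k"
    by (simp add: power_divide power_mult mult.assoc)
  finally show ?thesis .
qed

text \<open>The row sum is a bilinear form at a unit vector and the all-ones vector, so it is already known as a sum over
edges.\<close>

lemma row_sum_sym_entry:
  assumes "i < n"
  shows "(\<Sum>j<n. sym_entry w i j) = (\<Sum>e\<in>vertex_pairs n. if i = fst e \<or> i = snd e then w e else 0)"
proof -
  have "(\<Sum>j<n. sym_entry w i j) = bilin n (sym_entry w) (unit_fun i) (\<lambda>_. 1)"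
    using assms by (simp add: bilin_eq_mat_vec sum_unit_fun mat_vec_def)
  also have "\<dots> = (\<Sum>e\<in>vertex_pairs n. if i = fst e \<or> i = snd e then w e else 0)"
    unfolding bilin_sym_entry by (intro sum.cong refl) (auto simp: unit_fun_def vertex_pairs_def)
  finally show ?thesis .
qed

lemma card_incident_pairs:
  assumes "i < n"
  shows "card {e \<in> vertex_pairs n. i = fst e \<or> i = snd e} = n - 1"
proof -
  have "real (card {e \<in> vertex_pairs n. i = fst e \<or> i = snd e}) =
      (\<Sum>e\<in>vertex_pairs n. if i = fst e \<or> i = snd e then 1 else 0)"
    by (simp add: sum.If_cases Int_def)
  also have "\<dots> = (\<Sum>j<n. sym_entry (\<lambda>_. 1) i j)"
    by (rule row_sum_sym_entry[OF assms, symmetric])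
  also have "\<dots> = (\<Sum>j<n. 1 - (if j = i then 1 else 0))"
    by (intro sum.cong refl) (simp add: sym_entry_def)
  also have "\<dots> = real (n - 1)" using assms by (simp add: sum_subtractf of_nat_diff)
  finally show ?thesis by simp
qed

lemma arg_le_sinh: "0 \<le> (t::real) \<Longrightarrow> t \<le> sinh t"
proof -
  assume t: "0 \<le> t"
  have "sinh 0 - 0 \<le> sinh t - t"
    by (rule DERIV_nonneg_imp_nondecreasing[OF t]) (auto intro!: derivative_eq_intros exI simp: cosh_real_ge_1)
  then show ?thesis by simp
qed

text \<open>Chernoff's bound. With \<open>x = \<theta>\<delta>\<close> and \<open>tanh t = x\<close>, the moment generating function is governed by
\<open>cosh t - \<delta> sinh t = sqrt (1 - x\<^sup>2) - (1 - \<theta>) \<delta> sinh t\<close>, and the factor \<open>exp (t (1 - \<theta>) n p \<delta>)\<close> of the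
bound is absorbed because \<open>t \<le> sinh t\<close>. The constant \<open>exp 1\<close> accounts for a row having
\<open>n - 1\<close> and not \<open>n\<close> entries.\<close>

lemma row_sum_tail:
  assumes p: "0 \<le> p" "p \<le> 1" and \<delta>: "0 < \<delta>" "\<delta> \<le> 1" and \<theta>: "0 \<le> \<theta>" "\<theta> < 1" and i: "i < n"
  shows "measure_pmf.prob (signs n p \<delta>) {s. (\<Sum>j<n. sym_entry s i j) \<le> (1 - \<theta>) * (real n * (p * \<delta>))}
    \<le> exp (1 - real n * p * (1 - sqrt (1 - \<theta>\<^sup>2 * \<delta>\<^sup>2)))"
proof -
  let ?P = "signs n p \<delta>"
  let ?D = "\<lambda>s. \<Sum>j<n. sym_entry s i j"
  define x where "x = \<theta> * \<delta>"
  have "x \<le> \<theta>" unfolding x_def using \<theta> \<delta> by (intro mult_left_le) auto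
  then have x: "0 \<le> x" "x < 1" using \<theta> \<delta> by (auto simp: x_def)
  define g where "g = sqrt (1 - x\<^sup>2)"
  have "x\<^sup>2 < 1" using x by (simp add: power_less_one_iff abs_square_less_1)
  then have g: "g > 0" "g\<^sup>2 = 1 - x\<^sup>2" by (auto simp: g_def)
  \<comment> \<open>the solution of \<open>tanh t = x\<close>\<close>
  define t where "t = arsinh (x / g)"
  have sinh: "sinh t = x / g" by (simp add: t_def)
  have "sinh t \<ge> 0" using x g by (simp add: sinh)
  then have t0: "t \<ge> 0" by simp
  have "(cosh t)\<^sup>2 = (1 / g)\<^sup>2"
    using g by (simp add: cosh_square_eq sinh power_divide field_simps)
  then have cosh: "cosh t = 1 / g"
    using g cosh_real_pos[of t] by (simp add: power2_eq_iff_nonneg less_imp_le)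
  define h where "h = cosh t - \<delta> * sinh t"
  have h0: "h \<ge> 0"
  proof -
    have "\<delta> * sinh t \<le> 1 * sinh t" using \<delta> x g by (intro mult_right_mono) (auto simp: sinh)
    then show ?thesis using sinh_le_cosh_real[of t] by (simp add: h_def)
  qed
  have ph: "p * (1 - h) \<le> 1"
  proof -
    have "p * (1 - h) \<le> p * 1" using p h0 by (intro mult_left_mono) auto
    then show ?thesis using p by simp
  qed
  have h: "h = g - (1 - \<theta>) * \<delta> * sinh t"
  proof -
    have "cosh t - x * sinh t = g"
      using g by (simp add: cosh sinh field_simps power2_eq_square)
    then show ?thesis by (simp add: h_def x_def algebra_simps)
  qed
  have mgf: "measure_pmf.expectation (edge_sign p \<delta>) (\<lambda>v. exp (- t * v)) = 1 + p * (h - 1)"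
    using assms by (simp add: expectation_edge_sign h_def cosh_def sinh_def field_simps)
  have fin: "finite (set_pmf ?P)" by (intro finite_set_Pi_pmf finite_edge_sign) simp
  let ?c = "(1 - \<theta>) * (real n * (p * \<delta>))"
  have "measure_pmf.prob ?P {s. ?D s \<le> ?c} \<le> measure_pmf.prob ?P {s. exp (- t * ?D s) \<ge> exp (- t * ?c)}"
    using t0 by (intro measure_pmf.finite_measure_mono) (auto intro: mult_left_mono)
  also have "\<dots> \<le> measure_pmf.expectation ?P (\<lambda>s. exp (- t * ?D s)) / exp (- t * ?c)"
    using integral_Markov_inequality_measure[of "measure_pmf ?P" "\<lambda>s. exp (- t * ?D s)" UNIV "exp (- t * ?c)"]
    by (simp add: integrable_measure_pmf_finite[OF fin])
  also have "measure_pmf.expectation ?P (\<lambda>s. exp (- t * ?D s)) = (1 + p * (h - 1)) ^ (n - 1)"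
  proof -
    let ?I = "{e \<in> vertex_pairs n. i = fst e \<or> i = snd e}"
    have "exp (- t * ?D s) = (\<Prod>e\<in>vertex_pairs n. if i = fst e \<or> i = snd e then exp (- t * s e) else 1)" for s
    proof -
      have "exp (- t * ?D s) = exp (\<Sum>e\<in>vertex_pairs n. if i = fst e \<or> i = snd e then - t * s e else 0)"
        unfolding row_sum_sym_entry[OF i] sum_distrib_left by (intro arg_cong[of _ _ exp] sum.cong refl) auto
      also have "\<dots> = (\<Prod>e\<in>vertex_pairs n. exp (if i = fst e \<or> i = snd e then - t * s e else 0))"
        by (rule exp_sum) simp
      finally show ?thesis by (simp add: if_distrib[of exp] cong: if_cong)
    qed
    then have "measure_pmf.expectation ?P (\<lambda>s. exp (- t * ?D s)) = (\<Prod>e\<in>vertex_pairs n.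
        measure_pmf.expectation (edge_sign p \<delta>) (\<lambda>v. if i = fst e \<or> i = snd e then exp (- t * v) else 1))"
      using expectation_prod_iid[OF finite_vertex_pairs finite_edge_sign,
          where f = "\<lambda>e v. if i = fst e \<or> i = snd e then exp (- t * v) else 1" and d = 0] by simp
    also have "\<dots> = (\<Prod>e\<in>vertex_pairs n. if i = fst e \<or> i = snd e then 1 + p * (h - 1) else 1)"
      by (intro prod.cong refl) (simp add: mgf[simplified])
    also have "\<dots> = (1 + p * (h - 1)) ^ (n - 1)"
      using card_incident_pairs[OF i] by (simp add: prod.If_cases Int_def)
    finally show ?thesis .
  qed
  also have "(1 + p * (h - 1)) ^ (n - 1) / exp (- t * ?c) \<le> exp (p * (h - 1)) ^ (n - 1) / exp (- t * ?c)"
  proof (intro divide_right_mono power_mono)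
    show "0 \<le> 1 + p * (h - 1)" using ph by (simp add: algebra_simps)
  qed (auto intro: exp_ge_add_one_self)
  also have "\<dots> = exp (real (n - 1) * (p * (h - 1)) + t * ?c)"
    by (simp only: exp_of_nat_mult[symmetric] exp_diff[symmetric]) simp
  also have "\<dots> \<le> exp (1 - real n * p * (1 - g))"
  proof -
    have "real (n - 1) * (p * (h - 1)) = real n * (p * (h - 1)) + p * (1 - h)"
      using i by (simp add: of_nat_diff algebra_simps)
    moreover have "real n * (p * (h - 1)) + t * ?c = - (real n * p * (1 - g)) + real n * p * ((1 - \<theta>) * \<delta>) * (t - sinh t)"
      by (simp add: h algebra_simps)
    moreover have "real n * p * ((1 - \<theta>) * \<delta>) * (t - sinh t) \<le> 0"
      using arg_le_sinh[OF t0] p \<theta> \<delta> by (intro mult_nonneg_nonpos) auto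
    ultimately show ?thesis using ph by simp
  qed
  finally show ?thesis by (simp add: g_def x_def power_mult_distrib)
qed


section \<open>Exact recovery with high probability\<close>

text \<open>Drawing first the edges and then the measurements on them amounts to drawing independent values on all
pairs, zero for an absent edge. After factoring out \<open>z\<^sub>i z\<^sub>j\<close> these values no longer depend on \<open>z\<close>.\<close>

lemma cost_pmf_eq_signs:
  "cost_pmf n z p \<delta> = map_pmf (\<lambda>s. mat n n (\<lambda>(i, j). z $ i * z $ j * sym_entry s i j)) (signs n p \<delta>)"
proof -
  let ?V = "vertex_pairs n" and ?m = "measurement z \<delta>"
  let ?a = "\<lambda>e. z $ fst e * z $ snd e"
  have cost: "cost_matrix n E R = cost_matrix n ?V R"
    if "E \<subseteq> ?V" "R \<in> set_pmf (Pi_pmf E 0 ?m)" for E R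
  proof -
    have "finite E" using that(1) by (rule finite_subset) simp
    then have "R e = 0" if "e \<notin> E" for e
      using set_Pi_pmf_subset[of E 0 ?m] \<open>R \<in> _\<close> that by blast
    moreover have "(j, i) \<notin> E" if "(i, j) \<in> ?V" for i j
      using that \<open>E \<subseteq> ?V\<close> by (auto simp: vertex_pairs_def)
    ultimately show ?thesis
      using \<open>E \<subseteq> ?V\<close> unfolding cost_matrix_def by (intro cong_mat) (auto simp: subset_iff)
  qed
  have edges: "Pi_pmf {e \<in> ?V. b e} 0 ?m = Pi_pmf ?V 0 (\<lambda>e. if b e then ?m e else return_pmf 0)" for b
  proof -
    have "Pi_pmf ?V 0 (\<lambda>e. if b e then ?m e else return_pmf 0) =
        Pi_pmf {e \<in> ?V. b e} 0 (\<lambda>e. if b e then ?m e else return_pmf 0)"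
      by (rule Pi_pmf_subset') auto
    also have "\<dots> = Pi_pmf {e \<in> ?V. b e} 0 ?m"
      by (rule Pi_pmf_cong) auto
    finally show ?thesis by simp
  qed
  have entry: "bernoulli_pmf p \<bind> (\<lambda>b. if b then ?m e else return_pmf 0) =
      edge_sign p \<delta> \<bind> (\<lambda>v. return_pmf (?a e * v))" for e
  proof -
    have "(if b then ?m e else return_pmf 0) = map_pmf (\<lambda>v. ?a e * v)
        (if b then map_pmf (\<lambda>c. if c then 1 else -1) (bernoulli_pmf ((1 + \<delta>) / 2)) else return_pmf 0)" for b
      by (auto simp: measurement_def case_prod_unfold pmf.map_comp comp_def intro!: map_pmf_cong)
    then show ?thesis
      by (simp add: edge_sign_def map_bind_pmf map_pmf_def[symmetric])
  qed
  have "cost_pmf n z p \<delta> = do {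
      b \<leftarrow> Pi_pmf ?V False (\<lambda>_. bernoulli_pmf p);
      R \<leftarrow> Pi_pmf {e \<in> ?V. b e} 0 ?m;
      return_pmf (cost_matrix n {e \<in> ?V. b e} R)}"
    by (simp add: cost_pmf_def erdos_renyi_def bind_map_pmf)
  also have "\<dots> = do {
      b \<leftarrow> Pi_pmf ?V False (\<lambda>_. bernoulli_pmf p);
      R \<leftarrow> Pi_pmf ?V 0 (\<lambda>e. if b e then ?m e else return_pmf 0);
      return_pmf (cost_matrix n ?V R)}"
    by (intro bind_pmf_cong refl) (auto simp: edges[symmetric] intro!: bind_pmf_cong arg_cong[of _ _ return_pmf] cost)
  also have "\<dots> = do {
      R \<leftarrow> Pi_pmf ?V 0 (\<lambda>e. bernoulli_pmf p \<bind> (\<lambda>b. if b then ?m e else return_pmf 0));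
      return_pmf (cost_matrix n ?V R)}"
    by (subst Pi_pmf_bind[where d' = False]) (simp_all add: bind_assoc_pmf)
  also have "\<dots> = do {
      s \<leftarrow> signs n p \<delta>;
      return_pmf (cost_matrix n ?V (\<lambda>e. if e \<in> ?V then ?a e * s e else 0))}"
    unfolding entry by (subst Pi_pmf_bind[where d' = 0]) (simp_all add: bind_assoc_pmf bind_return_pmf)
  also have "\<dots> = map_pmf (\<lambda>s. mat n n (\<lambda>(i, j). z $ i * z $ j * sym_entry s i j)) (signs n p \<delta>)"
    unfolding map_pmf_def cost_matrix_def
    by (intro bind_pmf_cong refl arg_cong[of _ _ return_pmf] cong_mat)
      (auto simp: vertex_pairs_def sym_entry_def min_def max_def)
  finally show ?thesis .
qed

lemma exact_recovery_of_small_noise: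
  assumes z: "z \<in> carrier_vec n" "\<And>i. i < n \<Longrightarrow> z $ i \<in> {1, -1}" and "n > 0" and r: "r \<ge> 4"
    and row: "\<And>i. i < n \<Longrightarrow> (\<Sum>j<n. sym_entry s i j) \<ge> \<mu>"
    and noise: "\<And>x. \<bar>bilin n (centred q (sym_entry s)) x x\<bar> \<le> B * sq_norm n x"
    and "q \<ge> 0" "B \<ge> 0" and gap: "(real r - 3) * \<mu> > (real r + 1) * B + 2 * q"
  shows "exact_recovery n r z (mat n n (\<lambda>(i, j). z $ i * z $ j * sym_entry s i j))"
  unfolding exact_recovery_def
proof (intro allI impI)
  let ?C = "mat n n (\<lambda>(i, j). z $ i * z $ j * sym_entry s i j)"
  fix Y assume crit: "second_order_critical n r (objective ?C) Y"
  have sym: "sym_entry s i j = sym_entry s j i" for i j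
    by (simp add: sym_entry_def min.commute max.commute)
  have C: "?C \<in> carrier_mat n n" "?C\<^sup>T = ?C" by (auto simp: sym[of _ _])
  have zz: "z $ i * z $ i = 1" if "i < n" for i using z(2)[OF that] by auto
  have Y: "Y \<in> carrier_mat n r" and unit: "\<And>i. i < n \<Longrightarrow> (\<Sum>k<r. (Y $$ (i, k))\<^sup>2) = 1"
    using crit by (auto simp: second_order_critical_def feasible_set_iff)
  let ?y = "\<lambda>i k. z $ i * Y $$ (i, k)"
  have yunit: "(\<Sum>k<r. (?y i k)\<^sup>2) = 1" if "i < n" for i
    using unit[OF that] zz[OF that] by (simp add: power_mult_distrib power2_eq_square[of "z $ i"])
  have W: "z $ i * ?C $$ (i, j) * z $ j = sym_entry s i j" if "i < n" "j < n" for i j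
  proof -
    have "z $ i * ?C $$ (i, j) * z $ j = (z $ i * z $ i) * (z $ j * z $ j) * sym_entry s i j"
      using that by simp
    then show ?thesis using that by (simp add: zz)
  qed
  let ?F = "\<lambda>i j. (real r - 1) * (1 - (\<Sum>k<r. ?y i k * ?y j k)) - (1 - (\<Sum>k<r. ?y i k * ?y j k)\<^sup>2)"
  have "(\<Sum>i<n. \<Sum>j<n. sym_entry s i j * ?F i j) = (\<Sum>i<n. \<Sum>j<n. (z $ i * ?C $$ (i, j) * z $ j) * ?F i j)"
    by (intro sum.cong refl) (simp only: W lessThan_iff)
  also have "\<dots> \<le> 0"
    using second_order_trace_inequality[OF C crit, of "\<lambda>i. z $ i"] zz by simp
  finally have second_order: "(\<Sum>i<n. \<Sum>j<n. sym_entry s i j * ?F i j) \<le> 0" .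
  from unit_rows_equal[OF symmetric_sym_entry yunit r second_order row noise \<open>q \<ge> 0\<close> \<open>B \<ge> 0\<close> gap]
  obtain u where u: "\<And>i k. i < n \<Longrightarrow> k < r \<Longrightarrow> ?y i k = u k" by blast
  have Yu: "Y $$ (i, k) = z $ i * u k" if "i < n" "k < r" for i k
    using u[OF that] zz[OF that(1)] by (metis mult.assoc mult_1)
  have "(\<Sum>k<r. u k * u k) = 1"
    using yunit[OF \<open>n > 0\<close>] u[OF \<open>n > 0\<close>] by (simp add: power2_eq_square)
  then have "vec_norm2 (vec r u) = 1"
    by (simp add: vec_norm2_def scalar_prod_def atLeast0LessThan)
  moreover have "Y = outer_prod z (vec r u)"
    using Y z(1) by (intro eq_matI) (auto simp: outer_prod_def scalar_prod_def Yu)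
  ultimately show "\<exists>u\<in>carrier_vec r. vec_norm2 u = 1 \<and> Y = outer_prod z u"
    by (intro bexI[of _ "vec r u"]) auto
qed

lemma recovery_prob_lower_bound:
  assumes z: "z \<in> carrier_vec n" "\<And>i. i < n \<Longrightarrow> z $ i \<in> {1, -1}" and "n > 0" and r: "r \<ge> 4"
    and p: "0 \<le> p" "p \<le> 1" and \<delta>: "0 < \<delta>" "\<delta> \<le> 1" and \<theta>: "0 \<le> \<theta>" "\<theta> < 1"
    and k: "k > 0" "real n * p \<le> real k" and B: "B > 0"
    and gap: "(real r - 3) * ((1 - \<theta>) * (real n * (p * \<delta>))) > (real r + 1) * B + 2 * (p * \<delta>)"
  shows "recovery_prob n z p \<delta> r \<ge> 1 - real n * exp (1 - real n * p * (1 - sqrt (1 - \<theta>\<^sup>2 * \<delta>\<^sup>2)))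
    - 2 * real n * (4 * dense_const * real k / B\<^sup>2) ^ k"
proof -
  let ?P = "signs n p \<delta>" and ?c = "(1 - \<theta>) * (real n * (p * \<delta>))"
  let ?C = "\<lambda>s. mat n n (\<lambda>(i, j). z $ i * z $ j * sym_entry s i j)"
  define R where "R i = {s. (\<Sum>j<n. sym_entry s i j) \<le> ?c}" for i
  define N where "N = {s. \<not> (\<forall>x. \<bar>bilin n (centred (p * \<delta>) (sym_entry s)) x x\<bar> \<le> B * sq_norm n x)}"
  have "{s. \<not> exact_recovery n r z (?C s)} \<subseteq> (\<Union>i<n. R i) \<union> N"
  proof
    fix s assume s: "s \<in> {s. \<not> exact_recovery n r z (?C s)}"
    show "s \<in> (\<Union>i<n. R i) \<union> N"
    proof (rule ccontr)
      assume "s \<notin> (\<Union>i<n. R i) \<union> N"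
      then have "\<And>i. i < n \<Longrightarrow> ?c \<le> (\<Sum>j<n. sym_entry s i j)"
        and "\<And>x. \<bar>bilin n (centred (p * \<delta>) (sym_entry s)) x x\<bar> \<le> B * sq_norm n x"
        by (force simp: R_def N_def not_le)+
      then have "exact_recovery n r z (?C s)"
        using p \<delta> B gap
        by (intro exact_recovery_of_small_noise[where \<mu> = ?c and q = "p * \<delta>" and B = B] z \<open>n > 0\<close> r) simp_all
      then show False using s by simp
    qed
  qed
  then have "measure_pmf.prob ?P {s. \<not> exact_recovery n r z (?C s)} \<le> measure_pmf.prob ?P ((\<Union>i<n. R i) \<union> N)"
    by (intro measure_pmf.finite_measure_mono) auto
  also have "\<dots> \<le> measure_pmf.prob ?P (\<Union>i<n. R i) + measure_pmf.prob ?P N"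
    by (rule measure_Un_le) auto
  also have "measure_pmf.prob ?P (\<Union>i<n. R i) \<le> (\<Sum>i<n. measure_pmf.prob ?P (R i))"
    by (rule measure_UNION_le) auto
  also have "\<dots> \<le> (\<Sum>i<n. exp (1 - real n * p * (1 - sqrt (1 - \<theta>\<^sup>2 * \<delta>\<^sup>2))))"
    unfolding R_def by (intro sum_mono row_sum_tail p \<delta> \<theta>) simp
  also have "measure_pmf.prob ?P N \<le> 2 * real n * (4 * dense_const * real k / B\<^sup>2) ^ k"
    unfolding N_def using p \<delta> k B by (intro noise_tail) auto
  finally have bad: "measure_pmf.prob ?P {s. \<not> exact_recovery n r z (?C s)} \<le>
      real n * exp (1 - real n * p * (1 - sqrt (1 - \<theta>\<^sup>2 * \<delta>\<^sup>2))) + 2 * real n * (4 * dense_const * real k / B\<^sup>2) ^ k"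
    by simp
  have "recovery_prob n z p \<delta> r = measure_pmf.prob ?P {s. exact_recovery n r z (?C s)}"
    unfolding recovery_prob_def cost_pmf_eq_signs by (simp add: vimage_def)
  also have "\<dots> = 1 - measure_pmf.prob ?P {s. \<not> exact_recovery n r z (?C s)}"
    using measure_pmf.prob_compl[of "{s. \<not> exact_recovery n r z (?C s)}" ?P]
    by (simp add: Compl_eq_Diff_UNIV[symmetric] Collect_neg_eq[symmetric])
  finally show ?thesis using bad by simp
qed

text \<open>The function \<open>1 - sqrt (1 - x)\<close> lies between \<open>x / 2\<close> and \<open>x\<close> and is superlinear; in the quotient form below
all of this is visible from its denominator.\<close>

lemma one_minus_sqrt_eq:
  assumes "0 \<le> x" "x \<le> (1::real)"
  shows "1 - sqrt (1 - x) = x / (1 + sqrt (1 - x))"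
proof -
  have "1 + sqrt (1 - x) > 0" using assms by (simp add: add_pos_nonneg)
  moreover have "(1 - sqrt (1 - x)) * (1 + sqrt (1 - x)) = x"
    using assms by (simp add: algebra_simps)
  ultimately show ?thesis by (simp add: field_simps)
qed

lemma one_minus_sqrt_le: "0 \<le> x \<Longrightarrow> x \<le> (1::real) \<Longrightarrow> 1 - sqrt (1 - x) \<le> x"
  unfolding one_minus_sqrt_eq by (intro divide_le_eq[THEN iffD2]) (auto simp: mult_le_cancel_left1 add_pos_nonneg not_less)

lemma one_minus_sqrt_ge: "0 \<le> x \<Longrightarrow> x \<le> (1::real) \<Longrightarrow> x / 2 \<le> 1 - sqrt (1 - x)"
  unfolding one_minus_sqrt_eq by (intro divide_left_mono) (auto simp: add_pos_nonneg)

lemma one_minus_sqrt_superlinear: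
  assumes "0 \<le> x" "c \<ge> 1" "c * x \<le> y" "y \<le> (1::real)"
  shows "c * (1 - sqrt (1 - x)) \<le> 1 - sqrt (1 - y)"
proof -
  have "1 * x \<le> c * x" using assms by (intro mult_right_mono) auto
  then have x: "x \<le> c * x" "c * x \<le> 1" using assms by auto
  have "c * (1 - sqrt (1 - x)) = c * x / (1 + sqrt (1 - x))"
    using one_minus_sqrt_eq[of x] assms x by simp
  also have "\<dots> \<le> c * x / (1 + sqrt (1 - c * x))"
    using assms x by (intro divide_left_mono mult_pos_pos add_pos_nonneg) auto
  also have "\<dots> = 1 - sqrt (1 - c * x)"
    using one_minus_sqrt_eq[of "c * x"] assms x by simp
  also have "\<dots> \<le> 1 - sqrt (1 - y)" using assms by simp
  finally show ?thesis .
qed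

text \<open>The row sums are required to exceed \<open>\<epsilon> n p \<delta> / 2\<close>, that is \<open>\<theta> = 1 - \<epsilon> / 2\<close>. As \<open>(r - 3) / (r - 1) \<le> 1\<close>, the
argument \<open>x\<close> of the threshold satisfies \<open>(1 + \<epsilon>) x \<le> \<theta>\<^sup>2 \<delta>\<^sup>2\<close>, so the failure probability of a row is
of order \<open>n\<close> to the power \<open>- 1 - \<epsilon>\<close>. The noise may then have norm \<open>\<epsilon> n p \<delta> / 20\<close>: the factor
\<open>(r + 1) / (r - 3)\<close> in the deterministic condition is at most 5, its value at \<open>r = 4\<close>.\<close>

lemma recovery_prob_asymptotic_bound:
  assumes z: "z \<in> carrier_vec n" "\<And>i. i < n \<Longrightarrow> z $ i \<in> {1, -1}"
    and p: "p \<in> {0..1}" and \<delta>: "\<delta> \<in> {0<..1}" and r: "r \<ge> 4" and \<epsilon>: "0 < \<epsilon>" "\<epsilon> \<le> 1 / 3"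
    and n: "real n > 8 / \<epsilon>" and ln1: "ln (real n) \<ge> 1"
    and ln2: "ln (real n) \<ge> 8 * dense_const * exp 2 / (\<epsilon> / 20)\<^sup>2"
    and threshold: "real n * p / ln (real n) *
      (1 - sqrt (1 - ((real r - 3) / (real r - 1) - \<epsilon>)\<^sup>2 * \<delta>\<^sup>2)) \<ge> 1"
  shows "recovery_prob n z p \<delta> r \<ge> 1 - exp (1 - \<epsilon> * ln (real n)) - 2 / real n"
proof -
  define L where "L = ln (real n)"
  have L: "L \<ge> 1" using ln1 by (simp add: L_def)
  have n0: "n > 0" using L by (cases n) (simp_all add: L_def)
  have expL: "exp L = real n" using n0 by (simp add: L_def)
  define s where "s = (real r - 3) / (real r - 1)"
  have s: "1 / 3 \<le> s" "s \<le> 1" using r by (auto simp: s_def field_simps)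
  define x where "x = (s - \<epsilon>)\<^sup>2 * \<delta>\<^sup>2"
  have s\<epsilon>: "0 \<le> s - \<epsilon>" "s - \<epsilon> \<le> 1 - \<epsilon>" using s \<epsilon> by auto
  have sq\<epsilon>: "(s - \<epsilon>)\<^sup>2 \<le> (1 - \<epsilon>)\<^sup>2" using s\<epsilon> by (intro power_mono) auto
  have one: "(1 - \<epsilon>)\<^sup>2 \<le> 1" using \<epsilon> by (intro power_le_one) auto
  have \<delta>2: "0 < \<delta>\<^sup>2" "\<delta>\<^sup>2 \<le> 1" using \<delta> by (auto intro: power_le_one)
  have "x \<le> 1 * \<delta>\<^sup>2" unfolding x_def using sq\<epsilon> one by (intro mult_right_mono) auto
  then have x: "0 \<le> x" "x \<le> \<delta>\<^sup>2" "x \<le> 1" using \<delta>2(2) by (simp add: x_def, simp, linarith)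
  define np where "np = real n * p"
  have np0: "np \<ge> 0" using p by (simp add: np_def)
  have thr: "np * (1 - sqrt (1 - x)) \<ge> L"
    using threshold L unfolding s_def[symmetric] x_def[symmetric] np_def[symmetric] L_def[symmetric]
    by (simp add: field_simps)
  have "L \<le> np * \<delta>\<^sup>2"
    using thr mult_left_mono[OF order_trans[OF one_minus_sqrt_le[OF x(1,3)] x(2)] np0] by linarith
  moreover have "np * \<delta>\<^sup>2 \<le> np * 1" using np0 \<delta>2 by (intro mult_left_mono) auto
  ultimately have np: "L \<le> np * \<delta>\<^sup>2" "L \<le> np" by auto
  define \<theta> where "\<theta> = 1 - \<epsilon> / 2"
  have \<theta>: "0 \<le> \<theta>" "\<theta> < 1" using \<epsilon> by (auto simp: \<theta>_def)
  have "(1 + \<epsilon>) * (1 - sqrt (1 - x)) \<le> 1 - sqrt (1 - \<theta>\<^sup>2 * \<delta>\<^sup>2)"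
  proof (rule one_minus_sqrt_superlinear)
    have "(1 + \<epsilon>) * (s - \<epsilon>)\<^sup>2 \<le> (1 + \<epsilon>) * (1 - \<epsilon>)\<^sup>2" using sq\<epsilon> \<epsilon> by (intro mult_left_mono) auto
    also have "\<dots> = \<theta>\<^sup>2 - \<epsilon>\<^sup>2 * (5 / 4 - \<epsilon>)"
      by (simp add: \<theta>_def power2_eq_square field_simps)
    also have "\<dots> \<le> \<theta>\<^sup>2" using \<epsilon> by simp
    finally show "(1 + \<epsilon>) * x \<le> \<theta>\<^sup>2 * \<delta>\<^sup>2"
      unfolding x_def mult.assoc[symmetric] by (intro mult_right_mono) auto
    have "\<theta>\<^sup>2 * \<delta>\<^sup>2 \<le> 1 * 1" using \<theta> \<delta>2 power_le_one[of \<theta> 2] by (intro mult_mono) auto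
    then show "\<theta>\<^sup>2 * \<delta>\<^sup>2 \<le> 1" by simp
  qed (use x \<epsilon> in auto)
  then have "(1 + \<epsilon>) * L \<le> np * (1 - sqrt (1 - \<theta>\<^sup>2 * \<delta>\<^sup>2))"
    using mult_left_mono[OF thr, of "1 + \<epsilon>"] mult_left_mono[OF _ np0] \<epsilon>
    by (smt (verit) mult.left_commute)
  then have "exp (1 - np * (1 - sqrt (1 - \<theta>\<^sup>2 * \<delta>\<^sup>2))) \<le> exp (1 - \<epsilon> * L - L)"
    by (simp add: algebra_simps)
  then have "real n * exp (1 - np * (1 - sqrt (1 - \<theta>\<^sup>2 * \<delta>\<^sup>2))) \<le> real n * exp (1 - \<epsilon> * L - L)"
    by (intro mult_left_mono) auto
  also have "\<dots> = exp (1 - \<epsilon> * L)"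
    using n0 by (simp add: exp_diff[of "1 - \<epsilon> * L" L] expL)
  finally have rows: "real n * exp (1 - np * (1 - sqrt (1 - \<theta>\<^sup>2 * \<delta>\<^sup>2))) \<le> exp (1 - \<epsilon> * L)" .
  define B where "B = \<epsilon> / 20 * (np * \<delta>)"
  have Bpos: "B > 0" using \<epsilon> \<delta> L np by (simp add: B_def)
  \<comment> \<open>The order of the moment is the expected degree: large enough to absorb the factor \<open>n\<close>, since
    \<open>np \<ge> ln n\<close>, and small enough for the dense matrix to have norm of order \<open>sqrt np\<close>.\<close>
  define k where "k = nat \<lceil>np\<rceil>"
  have k: "np \<le> real k" "real k \<le> 2 * np" "k > 0"
    using np L by (auto simp: k_def) linarith+
  have "4 * dense_const * real k / B\<^sup>2 \<le> exp (- 2)"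
  proof -
    have K: "dense_const > 0" by (simp add: dense_const_def)
    have "(\<epsilon> / 20)\<^sup>2 * (np * L) \<le> (\<epsilon> / 20)\<^sup>2 * (np * (np * \<delta>\<^sup>2))"
      using np np0 by (intro mult_left_mono) auto
    also have "\<dots> = B\<^sup>2" by (simp add: B_def power2_eq_square)
    finally have B2: "(\<epsilon> / 20)\<^sup>2 * (np * L) \<le> B\<^sup>2" .
    have "8 * dense_const * exp 2 \<le> (\<epsilon> / 20)\<^sup>2 * L"
      using ln2 \<epsilon> by (simp add: L_def field_simps)
    then have "8 * dense_const * exp 2 * np \<le> (\<epsilon> / 20)\<^sup>2 * L * np"
      using np0 by (intro mult_right_mono)
    then have B2': "8 * dense_const * exp 2 * np \<le> B\<^sup>2" using B2 by (simp add: mult_ac)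
    have "4 * dense_const * real k * exp 2 \<le> 4 * dense_const * (2 * np) * exp 2"
      using k K by (intro mult_left_mono mult_right_mono) auto
    also have "\<dots> = 8 * dense_const * exp 2 * np" by simp
    finally have "4 * dense_const * real k * exp 2 \<le> B\<^sup>2" using B2' by (rule order_trans)
    then show ?thesis using Bpos by (simp add: exp_minus field_simps)
  qed
  then have "(4 * dense_const * real k / B\<^sup>2) ^ k \<le> exp (- 2) ^ k"
    by (intro power_mono) (auto simp: dense_const_def)
  also have "\<dots> = exp (- (2 * real k))" by (simp add: exp_of_nat_mult[symmetric] mult.commute)
  also have "\<dots> \<le> exp (- (L + L))" using np k by simp
  also have "\<dots> = 1 / (real n * real n)" by (simp only: exp_minus exp_add expL) (simp add: field_simps)
  finally have "2 * real n * (4 * dense_const * real k / B\<^sup>2) ^ k \<le> 2 * real n * (1 / (real n * real n))"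
    by (intro mult_left_mono) auto
  also have "\<dots> = 2 / real n" using n0 by simp
  finally have noise: "2 * real n * (4 * dense_const * real k / B\<^sup>2) ^ k \<le> 2 / real n" .
  have gap: "(real r + 1) * B + 2 * (p * \<delta>) < (real r - 3) * ((1 - \<theta>) * (real n * (p * \<delta>)))"
  proof -
    define v where "v = np * \<delta>"
    have v: "v > 0" using np L \<delta> by (simp add: v_def)
    have pn: "p * \<delta> = v / real n" using n0 by (simp add: v_def np_def)
    have "2 * (p * \<delta>) < \<epsilon> / 4 * v"
    proof -
      have "8 < \<epsilon> * real n" using n \<epsilon> by (simp add: field_simps)
      then have "8 * v < \<epsilon> * real n * v" using v by simp
      then show ?thesis unfolding pn using n0 by (simp add: field_simps)
    qed
    also have "\<dots> \<le> (real r - 3) * (\<epsilon> / 4 * v)"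
      using r \<epsilon> v by simp
    finally have 1: "2 * (p * \<delta>) < (real r - 3) * (\<epsilon> / 4 * v)" .
    have "(real r + 1) * (\<epsilon> / 20 * v) \<le> (5 * (real r - 3)) * (\<epsilon> / 20 * v)"
      using r \<epsilon> v by (intro mult_right_mono) auto
    also have "\<dots> = (real r - 3) * (\<epsilon> / 4 * v)" by simp
    finally have 2: "(real r + 1) * B \<le> (real r - 3) * (\<epsilon> / 4 * v)"
      unfolding B_def v_def .
    have "(real r - 3) * ((1 - \<theta>) * (real n * (p * \<delta>))) = (real r - 3) * (\<epsilon> / 4 * v) + (real r - 3) * (\<epsilon> / 4 * v)"
      by (simp add: \<theta>_def v_def np_def)
    then show ?thesis using 1 2 by linarith
  qed
  have "recovery_prob n z p \<delta> r \<ge> 1 - real n * exp (1 - real n * p * (1 - sqrt (1 - \<theta>\<^sup>2 * \<delta>\<^sup>2)))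
      - 2 * real n * (4 * dense_const * real k / B\<^sup>2) ^ k"
    by (rule recovery_prob_lower_bound) (use z n0 r p \<delta> \<theta> k Bpos gap in \<open>auto simp: np_def\<close>)
  then show ?thesis using rows noise unfolding np_def L_def by linarith
qed

lemma recovery_prob_tendsto_1:
  fixes z :: "nat \<Rightarrow> real vec" and p \<delta> :: "nat \<Rightarrow> real" and r :: "nat \<Rightarrow> nat"
  assumes z: "\<And>n. z n \<in> carrier_vec n" "\<And>n i. i < n \<Longrightarrow> z n $ i \<in> {1, -1}"
    and p: "\<And>n. p n \<in> {0..1}" and \<delta>: "\<And>n. \<delta> n \<in> {0<..1}" and r: "\<And>n. r n \<ge> 4"
    and \<epsilon>: "0 < \<epsilon>" "\<epsilon> \<le> 1 / 3"
    and threshold: "\<forall>\<^sub>F n in sequentially. real n * p n / ln (real n) *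
      (1 - sqrt (1 - ((real (r n) - 3) / (real (r n) - 1) - \<epsilon>)\<^sup>2 * (\<delta> n)\<^sup>2)) \<ge> 1"
  shows "(\<lambda>n. recovery_prob n (z n) (p n) (\<delta> n) (r n)) \<longlonglongrightarrow> 1"
proof (rule tendsto_sandwich)
  have "\<forall>\<^sub>F n in sequentially. real n > 8 / \<epsilon>" by real_asymp
  moreover have "\<forall>\<^sub>F n in sequentially. ln (real n) \<ge> 1" by real_asymp
  moreover have "\<forall>\<^sub>F n in sequentially. ln (real n) \<ge> 8 * dense_const * exp 2 / (\<epsilon> / 20)\<^sup>2"
    by real_asymp
  ultimately show "\<forall>\<^sub>F n in sequentially. 1 - exp (1 - \<epsilon> * ln (real n)) - 2 / real n
      \<le> recovery_prob n (z n) (p n) (\<delta> n) (r n)"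
    using threshold by eventually_elim (intro recovery_prob_asymptotic_bound z p \<delta> r \<epsilon>)
  show "\<forall>\<^sub>F n in sequentially. recovery_prob n (z n) (p n) (\<delta> n) (r n) \<le> 1"
    by (simp add: recovery_prob_def)
  show "(\<lambda>n. 1 - exp (1 - \<epsilon> * ln (real n)) - 2 / real n) \<longlonglongrightarrow> 1"
    using \<epsilon> by real_asymp
qed simp

text \<open>With \<open>s = (r - 3) / (r - 1)\<close>, the bound \<open>1 - sqrt (1 - x) \<ge> x / 2\<close> turns the hypothesis into the threshold
with constant \<open>1 + \<epsilon> / 2\<close> in place of 1. Because \<open>s \<ge> 1/3\<close>, passing from \<open>s\<close> to \<open>s - \<epsilon>'\<close> loses at most
a factor \<open>(1 - 3 \<epsilon>')\<^sup>2 \<ge> 1 - 6 \<epsilon>'\<close>, and \<open>\<epsilon>'\<close> is chosen such that the surplus covers it.\<close>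

lemma threshold_of_simple_condition:
  assumes p: "p \<in> {0..1}" and \<delta>: "\<delta> \<in> {0<..1}" and r: "r \<ge> 4" and \<epsilon>: "0 < \<epsilon>" and ln: "ln (real n) > 0"
    and simple: "1 / \<delta> \<le> (real r - 3) / (real r - 1) * sqrt (real n * p / ((2 + \<epsilon>) * ln (real n)))"
  defines "\<epsilon>' \<equiv> \<epsilon> / (12 * (1 + \<epsilon>))"
  shows "real n * p / ln (real n) *
      (1 - sqrt (1 - ((real r - 3) / (real r - 1) - \<epsilon>')\<^sup>2 * \<delta>\<^sup>2)) \<ge> 1"
proof -
  define s where "s = (real r - 3) / (real r - 1)"
  define R where "R = real n * p / ln (real n)"
  have s: "1 / 3 \<le> s" "s \<le> 1" using r by (auto simp: s_def field_simps)
  have \<epsilon>': "0 < \<epsilon>'" "\<epsilon>' \<le> 1 / 12" using \<epsilon> by (auto simp: \<epsilon>'_def field_simps)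
  have R: "R \<ge> 0" using p ln by (simp add: R_def)
  have "1 \<le> (s * sqrt (R / (2 + \<epsilon>))) * \<delta>"
    using simple \<delta> unfolding s_def[symmetric] R_def by (simp add: field_simps)
  then have "1\<^sup>2 \<le> (s * sqrt (R / (2 + \<epsilon>)) * \<delta>)\<^sup>2" by (intro power_mono) auto
  also have "\<dots> = s\<^sup>2 * (R / (2 + \<epsilon>)) * \<delta>\<^sup>2"
    using R \<epsilon> by (simp add: power_mult_distrib)
  finally have sR: "2 + \<epsilon> \<le> R * (s\<^sup>2 * \<delta>\<^sup>2)" using \<epsilon> by (simp add: field_simps)
  have "s * (1 - 3 * \<epsilon>') \<le> s - \<epsilon>'"
    using s \<epsilon>' mult_right_mono[of "1 / 3" s "3 * \<epsilon>'"] by (simp add: algebra_simps)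
  then have "(s * (1 - 3 * \<epsilon>'))\<^sup>2 \<le> (s - \<epsilon>')\<^sup>2"
    using s \<epsilon>' by (intro power_mono) auto
  then have "s\<^sup>2 * (1 - 3 * \<epsilon>')\<^sup>2 * \<delta>\<^sup>2 \<le> (s - \<epsilon>')\<^sup>2 * \<delta>\<^sup>2"
    unfolding power_mult_distrib by (intro mult_right_mono) auto
  moreover have "(s - \<epsilon>')\<^sup>2 * \<delta>\<^sup>2 / 2 \<le> 1 - sqrt (1 - (s - \<epsilon>')\<^sup>2 * \<delta>\<^sup>2)"
  proof (rule one_minus_sqrt_ge)
    have "(s - \<epsilon>')\<^sup>2 * \<delta>\<^sup>2 \<le> 1 * 1"
      using s \<epsilon>' \<delta> by (intro mult_mono power_le_one) auto
    then show "(s - \<epsilon>')\<^sup>2 * \<delta>\<^sup>2 \<le> 1" by simp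
  qed simp
  ultimately have "s\<^sup>2 * (1 - 3 * \<epsilon>')\<^sup>2 * \<delta>\<^sup>2 / 2 \<le> 1 - sqrt (1 - (s - \<epsilon>')\<^sup>2 * \<delta>\<^sup>2)" by linarith
  then have "R * (s\<^sup>2 * (1 - 3 * \<epsilon>')\<^sup>2 * \<delta>\<^sup>2 / 2) \<le> R * (1 - sqrt (1 - (s - \<epsilon>')\<^sup>2 * \<delta>\<^sup>2))"
    using R by (intro mult_left_mono)
  moreover have "1 \<le> R * (s\<^sup>2 * (1 - 3 * \<epsilon>')\<^sup>2 * \<delta>\<^sup>2 / 2)"
  proof -
    have "1 + \<epsilon>\<^sup>2 / (4 * (1 + \<epsilon>)) = (2 + \<epsilon>) * (1 - 6 * \<epsilon>') / 2"
      using \<epsilon> by (simp add: \<epsilon>'_def field_simps power2_eq_square)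
    also have "\<dots> \<le> (2 + \<epsilon>) * (1 - 3 * \<epsilon>')\<^sup>2 / 2"
      using \<epsilon> by (intro divide_right_mono mult_left_mono) (auto simp: power2_diff)
    also have "\<dots> \<le> R * (s\<^sup>2 * \<delta>\<^sup>2) * (1 - 3 * \<epsilon>')\<^sup>2 / 2"
      using sR by (intro divide_right_mono mult_right_mono) auto
    finally have "1 + \<epsilon>\<^sup>2 / (4 * (1 + \<epsilon>)) \<le> R * (s\<^sup>2 * (1 - 3 * \<epsilon>')\<^sup>2 * \<delta>\<^sup>2 / 2)"
      by (simp add: mult_ac)
    moreover have "\<epsilon>\<^sup>2 / (4 * (1 + \<epsilon>)) \<ge> 0" using \<epsilon> by simp
    ultimately show ?thesis by linarith
  qed
  ultimately show ?thesis unfolding R_def s_def by linarith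
qed

theorem theorem2:
  fixes z :: "nat \<Rightarrow> real vec" and p \<delta> :: "nat \<Rightarrow> real" and r :: "nat \<Rightarrow> nat"
  assumes "\<And>n. z n \<in> carrier_vec n"
    and "\<And>n i. i < n \<Longrightarrow> z n $ i \<in> {1, -1}"
    and "\<And>n. p n \<in> {0..1}"
    and "\<And>n. \<delta> n \<in> {0<..1}"
    and "\<And>n. r n \<ge> 4"
  shows "(\<forall>\<epsilon>::real. 0 < \<epsilon> \<and> \<epsilon> \<le> 1 / 3 \<and>
      (\<forall>\<^sub>F n in sequentially.
        real n * p n / ln (real n) *
          (1 - sqrt (1 - ((real (r n) - 3) / (real (r n) - 1) - \<epsilon>)\<^sup>2 * (\<delta> n)\<^sup>2)) \<ge> 1)
      \<longrightarrow> (\<lambda>n. recovery_prob n (z n) (p n) (\<delta> n) (r n)) \<longlonglongrightarrow> 1)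
    \<and>
    (\<forall>\<epsilon>::real. 0 < \<epsilon> \<and>
      (\<forall>\<^sub>F n in sequentially.
        1 / \<delta> n \<le> (real (r n) - 3) / (real (r n) - 1) *
          sqrt (real n * p n / ((2 + \<epsilon>) * ln (real n))))
      \<longrightarrow> (\<exists>\<epsilon>'::real. 0 < \<epsilon>' \<and> \<epsilon>' \<le> 1 / 3 \<and>
            (\<forall>\<^sub>F n in sequentially.
              real n * p n / ln (real n) *
                (1 - sqrt (1 - ((real (r n) - 3) / (real (r n) - 1) - \<epsilon>')\<^sup>2 * (\<delta> n)\<^sup>2)) \<ge> 1))
        \<and> (\<lambda>n. recovery_prob n (z n) (p n) (\<delta> n) (r n)) \<longlonglongrightarrow> 1)"
proof (intro conjI allI impI; elim conjE)
  fix \<epsilon> :: real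
  assume "0 < \<epsilon>" "\<epsilon> \<le> 1 / 3" and "\<forall>\<^sub>F n in sequentially. real n * p n / ln (real n) *
      (1 - sqrt (1 - ((real (r n) - 3) / (real (r n) - 1) - \<epsilon>)\<^sup>2 * (\<delta> n)\<^sup>2)) \<ge> 1"
  then show "(\<lambda>n. recovery_prob n (z n) (p n) (\<delta> n) (r n)) \<longlonglongrightarrow> 1"
    by (intro recovery_prob_tendsto_1[where \<epsilon> = \<epsilon>] assms)
next
  fix \<epsilon> :: real
  assume \<epsilon>: "0 < \<epsilon>" and simple: "\<forall>\<^sub>F n in sequentially. 1 / \<delta> n \<le>
      (real (r n) - 3) / (real (r n) - 1) * sqrt (real n * p n / ((2 + \<epsilon>) * ln (real n)))"
  let ?\<epsilon>' = "\<epsilon> / (12 * (1 + \<epsilon>))"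
  have \<epsilon>': "0 < ?\<epsilon>'" "?\<epsilon>' \<le> 1 / 3" using \<epsilon> by (auto simp: field_simps)
  have "\<forall>\<^sub>F n in sequentially. ln (real n) > 0" by real_asymp
  with simple have thr: "\<forall>\<^sub>F n in sequentially. real n * p n / ln (real n) *
      (1 - sqrt (1 - ((real (r n) - 3) / (real (r n) - 1) - ?\<epsilon>')\<^sup>2 * (\<delta> n)\<^sup>2)) \<ge> 1"
    by eventually_elim (intro threshold_of_simple_condition assms \<epsilon>)
  then show "\<exists>\<epsilon>'::real. 0 < \<epsilon>' \<and> \<epsilon>' \<le> 1 / 3 \<and>
      (\<forall>\<^sub>F n in sequentially. real n * p n / ln (real n) *
        (1 - sqrt (1 - ((real (r n) - 3) / (real (r n) - 1) - \<epsilon>')\<^sup>2 * (\<delta> n)\<^sup>2)) \<ge> 1)"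
    using \<epsilon>' by blast
  show "(\<lambda>n. recovery_prob n (z n) (p n) (\<delta> n) (r n)) \<longlonglongrightarrow> 1"
    using \<epsilon>' thr by (intro recovery_prob_tendsto_1[where \<epsilon> = ?\<epsilon>'] assms)
qed

end
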